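(* Let $f:\Omega\times\Omega_{\mathrm{TJ}}\times[0,\infty)\to\mathbb{R}$ be a weak solution of the Fokker–Planck problem with initial datum $f_0=0$. Assume that $\sigma$ is a $C^1$ function on $\mathbb{R}$. Then $f=0$ in $\Omega\times\Omega_{\mathrm{TJ}}\times[0,\infty)$.
   Context: $\gamma,\eta,\beta_\theta,\beta_a>0$ are constants satisfying $\frac{6\gamma}{\beta_\theta^2}=\frac{2\eta}{\beta_a^2}$. $\theta=(\theta_1,\theta_2,\theta_3)$ (the misorientations) ranges over $\Omega=\{\theta\in(-\frac{\pi}{4},\frac{\pi}{4})^3:\theta_1+\theta_2+\theta_3=0\}\subset\mathbb{R}^3$, with $d\theta$ the 2-dimensional measure on this plane; $a$ (the triple junction) ranges over a bounded domain $\Omega_{\mathrm{TJ}}\subset\mathbb{R}^2$ with $C^2$ boundary. $\nabla^\Omega_\theta$ is the tangential gradient on the plane of $\Omega$ ($\nabla^\Omega_\theta\phi=(I-\frac13J)(\partial_{\theta_k}\phi)_{k}$, $I$ the identity and $J$ the all-ones $3\times 3$ matrix), with corresponding divergence and Laplacian $\Delta^\Omega_\theta=\nabla^\Omega_\theta\cdot\nabla^\Omega_\theta$; $\nabla_a,\Delta_a$ are the standard gradient and Laplacian in $a$; $\nu_\theta,\nu_a$ are outer unit normals to $\partial\Omega,\partial\Omega_{\mathrm{TJ}}$. $E(\theta,a)=\sum_{j=1}^3\sigma(\theta_j)|a-x^{(j)}|$ with $x^{(j)}\in\mathbb{R}^2$ fixed; $v_\theta=-3\gamma\nabla^\Omega_\theta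 E$, $v_a=-\eta\nabla_aE$. Fokker–Planck problem: $f_t+\nabla^\Omega_\theta\cdot(v_\theta f)+\nabla_a\cdot(v_af)=\frac{\beta_\theta^2}{2}\Delta^\Omega_\theta f+\frac{\beta_a^2}{2}\Delta_af$ in $\Omega\times\Omega_{\mathrm{TJ}}\times(0,\infty)$, with $(\frac{\beta_\theta^2}{2}\nabla^\Omega_\theta f-v_\theta f)\cdot\nu_\theta=0$ on $\partial\Omega\times\Omega_{\mathrm{TJ}}$, $(\frac{\beta_a^2}{2}\nabla_af-v_af)\cdot\nu_a=0$ on $\Omega\times\partial\Omega_{\mathrm{TJ}}$, $f|_{t=0}=f_0$. $f$ is a weak solution if $f\in L^\infty(0,\infty;L^2(\Omega\times\Omega_{\mathrm{TJ}}))$ with $\nabla^\Omega_\theta f,\nabla_af\in L^2(0,\infty;L^2(\Omega\times\Omega_{\mathrm{TJ}}))$, and for all $\phi\in C^\infty(\overline{\Omega\times\Omega_{\mathrm{TJ}}\times[0,\infty)})$ and almost every $T>0$, $$\iint f\phi\,d\theta da\Big|_{t=T}-\int_0^T\!\!\iint f\phi_t\,d\theta da\,dt+\int_0^T\!\!\iint\Bigl(\bigl(\tfrac{\beta_\theta^2}{2}\nabla^\Omega_\theta f-v_\theta f\bigr)\cdot\nabla^\Omega_\theta\phi+\bigl(\tfrac{\beta_a^2}{2}\nabla_af-v_af\bigr)\cdot\nabla_a\phi\Bigr)d\theta da\,dt=\iint f_0\,\phi\,d\theta da\Big|_{t=0},$$ all space integrals being over $\Omega\times\Omega_{\mathrm{TJ}}$.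 *)

theory Defs
  imports "HOL-Analysis.Analysis"
begin

section \<open>Classical differentiability\<close>

text \<open>
  All functions below live on finite-dimensional spaces, where having continuous directional
  derivatives of total differentials up to order \<open>k\<close> is the usual notion of class \<open>C\<^sup>k\<close>.
\<close>

primrec class_C :: "nat \<Rightarrow> ('a::euclidean_space \<Rightarrow> 'b::euclidean_space) \<Rightarrow> bool" where
  "class_C 0 f \<longleftrightarrow> continuous_on UNIV f"
| "class_C (Suc k) f \<longleftrightarrow> (\<forall>x. f differentiable (at x)) \<and>
     (\<forall>v. class_C k (\<lambda>x. frechet_derivative f (at x) v))"

definition smooth :: "('a::euclidean_space \<Rightarrow> 'b::euclidean_space) \<Rightarrow> bool" where
  "smooth f \<longleftrightarrow> (\<forall>k. class_C k f)"

definition grad :: "(real^'n \<Rightarrow> real) \<Rightarrow> real^'n \<Rightarrow> real^'n" where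
  "grad g x = (\<chi> k. frechet_derivative g (at x) (axis k 1))"

definition tangential_grad :: "(real^3 \<Rightarrow> real) \<Rightarrow> real^3 \<Rightarrow> real^3" where
  "tangential_grad g \<theta> = (mat 1 - (1/3) *\<^sub>R (\<chi> i j. 1)) *v grad g \<theta>"

section \<open>The domains and their measures\<close>

definition misorientations :: "(real^3) set" where
  "misorientations = {\<theta>. (\<forall>j. - pi/4 < \<theta>$j \<and> \<theta>$j < pi/4) \<and> \<theta>$1 + \<theta>$2 + \<theta>$3 = 0}"

text \<open>Local description of the boundary as a \<open>C\<^sup>2\<close> graph in rotated Cartesian coordinates;
  \<open>u, w\<close> are the rotated axes, with \<open>w\<close> pointing into \<open>D\<close>.\<close>

definition C2_boundary :: "(real^2) set \<Rightarrow> bool" where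
  "C2_boundary D \<longleftrightarrow> (\<forall>p\<in>frontier D. \<exists>r>0. \<exists>u w. \<exists>h :: real \<Rightarrow> real.
     norm u = 1 \<and> norm w = 1 \<and> u \<bullet> w = 0 \<and> class_C 2 h \<and>
     D \<inter> ball p r = {y \<in> ball p r. h (u \<bullet> y) < w \<bullet> y})"

text \<open>The 2-dimensional measure on the plane \<open>\<theta>\<^sub>1 + \<theta>\<^sub>2 + \<theta>\<^sub>3 = 0\<close> is the image of planar
  Lebesgue measure under an isometric parametrization of the plane
  (by rotation invariance, its choice is immaterial).\<close>

definition plane_chart :: "real^2 \<Rightarrow> real^3" where
  "plane_chart p = p$1 *\<^sub>R vector [1 / sqrt 2, - 1 / sqrt 2, 0]
                 + p$2 *\<^sub>R vector [1 / sqrt 6, 1 / sqrt 6, - 2 / sqrt 6]"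

definition plane_measure :: "(real^3) measure" where
  "plane_measure = distr lborel borel plane_chart"

lemma linear_plane_chart: "linear plane_chart"
  unfolding plane_chart_def
  by (intro linearI) (auto simp: algebra_simps)

lemma norm_plane_chart: "norm (plane_chart p) = norm p"
proof -
  have "(norm (plane_chart p))\<^sup>2 = (norm p)\<^sup>2"
    unfolding power2_norm_eq_inner plane_chart_def
    by (simp add: inner_vec_def sum_2 sum_3 field_simps)
  then show ?thesis by simp
qed

lemma range_plane_chart: "range plane_chart = {\<theta>. \<theta>$1 + \<theta>$2 + \<theta>$3 = 0}"
proof (intro equalityI subsetI)
  fix \<theta> assume "\<theta> \<in> range plane_chart"
  then show "\<theta> \<in> {\<theta>. \<theta>$1 + \<theta>$2 + \<theta>$3 = 0}"
    by (auto simp: plane_chart_def field_simps)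
next
  fix \<theta> :: "real^3" assume "\<theta> \<in> {\<theta>. \<theta>$1 + \<theta>$2 + \<theta>$3 = 0}"
  then have eq: "\<theta>$2 = - \<theta>$1 - \<theta>$3" by simp
  have s2: "sqrt 2 * (sqrt 2 * z) = 2 * z" for z :: real
    by (simp flip: mult.assoc)
  have "plane_chart (vector [(\<theta>$1 - \<theta>$2) / sqrt 2, - \<theta>$3 * sqrt 6 / 2]) = \<theta>"
    by (simp add: plane_chart_def vec_eq_iff forall_3 eq field_simps s2)
  then show "\<theta> \<in> range plane_chart" by (metis rangeI)
qed

text \<open>
  The measures are completed: the drift \<open>v\<^sub>a\<close> is unspecified on the null set where \<open>a\<close> is one
  of the points \<open>x\<^sup>(\<^sup>j\<^sup>)\<close>, and need not be Borel measurable there.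
\<close>

definition space_measure :: "(real^2) set \<Rightarrow> ((real^3) \<times> (real^2)) measure" where
  "space_measure D =
     restrict_space (completion (plane_measure \<Otimes>\<^sub>M lborel)) (misorientations \<times> D)"

definition spacetime_measure :: "(real^2) set \<Rightarrow> (((real^3) \<times> (real^2)) \<times> real) measure" where
  "spacetime_measure D =
     restrict_space (completion ((plane_measure \<Otimes>\<^sub>M lborel) \<Otimes>\<^sub>M lborel))
       ((misorientations \<times> D) \<times> {0<..})"

section \<open>Function spaces\<close>

definition square_integrable :: "'a measure \<Rightarrow> ('a \<Rightarrow> 'b::euclidean_space) \<Rightarrow> bool" where
  "square_integrable M u \<longleftrightarrow> u \<in> borel_measurable M \<and> integrable M (\<lambda>x. (norm (u x))\<^sup>2)"

text \<open>
  Elements of \<open>L\<^sup>p(0,\<infinity>; L\<^sup>2)\<close> are represented by jointly measurable functions on space-time.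
\<close>

definition in_Linf_L2 ::
    "(real^2) set \<Rightarrow> (((real^3) \<times> (real^2)) \<times> real \<Rightarrow> 'b::euclidean_space) \<Rightarrow> bool" where
  "in_Linf_L2 D u \<longleftrightarrow> u \<in> borel_measurable (spacetime_measure D) \<and>
     (\<exists>C. AE t in lebesgue_on {0<..}. square_integrable (space_measure D) (\<lambda>x. u (x, t)) \<and>
        (LINT x|space_measure D. (norm (u (x, t)))\<^sup>2) \<le> C)"

definition in_L2_L2 ::
    "(real^2) set \<Rightarrow> (((real^3) \<times> (real^2)) \<times> real \<Rightarrow> 'b::euclidean_space) \<Rightarrow> bool" where
  "in_L2_L2 D u \<longleftrightarrow> u \<in> borel_measurable (spacetime_measure D) \<and>
     (AE t in lebesgue_on {0<..}. square_integrable (space_measure D) (\<lambda>x. u (x, t))) \<and>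
     integrable (lebesgue_on {0<..}) (\<lambda>t. LINT x|space_measure D. (norm (u (x, t)))\<^sup>2)"

text \<open>
  Compactly supported smooth functions on the surface \<open>misorientations \<times> D\<close>, given by a smooth
  extension to the ambient space. Tangential derivatives on the surface do not depend on the
  extension.
\<close>

definition test_function :: "(real^2) set \<Rightarrow> ((real^3) \<times> (real^2) \<Rightarrow> real) \<Rightarrow> bool" where
  "test_function D \<psi> \<longleftrightarrow> smooth \<psi> \<and>
     (\<exists>K. compact K \<and> K \<subseteq> misorientations \<times> D \<and> (\<forall>x \<in> misorientations \<times> D - K. \<psi> x = 0))"

text \<open>\<open>G\<close> and \<open>H\<close> are the distributional gradients of \<open>u\<close> in \<open>\<theta>\<close> (tangential) and in \<open>a\<close>.\<close>

definition has_weak_gradients ::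
    "(real^2) set \<Rightarrow> ((real^3) \<times> (real^2) \<Rightarrow> real) \<Rightarrow> ((real^3) \<times> (real^2) \<Rightarrow> real^3) \<Rightarrow>
     ((real^3) \<times> (real^2) \<Rightarrow> real^2) \<Rightarrow> bool" where
  "has_weak_gradients D u G H \<longleftrightarrow> (\<forall>\<psi>. test_function D \<psi> \<longrightarrow>
     (LINT (\<theta>, a)|space_measure D. u (\<theta>, a) *\<^sub>R tangential_grad (\<lambda>\<theta>'. \<psi> (\<theta>', a)) \<theta>)
       = - (LINT x|space_measure D. \<psi> x *\<^sub>R G x) \<and>
     (LINT (\<theta>, a)|space_measure D. u (\<theta>, a) *\<^sub>R grad (\<lambda>a'. \<psi> (\<theta>, a')) a)
       = - (LINT x|space_measure D. \<psi> x *\<^sub>R H x))"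

section \<open>The Fokker--Planck problem\<close>

definition energy :: "(real \<Rightarrow> real) \<Rightarrow> (3 \<Rightarrow> real^2) \<Rightarrow> real^3 \<Rightarrow> real^2 \<Rightarrow> real" where
  "energy \<sigma> X \<theta> a = (\<Sum>j\<in>UNIV. \<sigma> (\<theta>$j) * norm (a - X j))"

definition drift_theta ::
    "real \<Rightarrow> (real \<Rightarrow> real) \<Rightarrow> (3 \<Rightarrow> real^2) \<Rightarrow> real^3 \<Rightarrow> real^2 \<Rightarrow> real^3" where
  "drift_theta \<gamma> \<sigma> X \<theta> a = - (3 * \<gamma>) *\<^sub>R tangential_grad (\<lambda>\<theta>'. energy \<sigma> X \<theta>' a) \<theta>"

definition drift_a ::
    "real \<Rightarrow> (real \<Rightarrow> real) \<Rightarrow> (3 \<Rightarrow> real^2) \<Rightarrow> real^3 \<Rightarrow> real^2 \<Rightarrow> real^2" where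
  "drift_a \<eta> \<sigma> X \<theta> a = - \<eta> *\<^sub>R grad (\<lambda>a'. energy \<sigma> X \<theta> a') a"

text \<open>
  Functions in \<open>C\<^sup>\<infinity>\<close> of the closed space-time cylinder are the restrictions of smooth
  functions on the ambient space, so \<open>\<phi>\<close> is taken there directly.
\<close>

definition weak_solution ::
    "real \<Rightarrow> real \<Rightarrow> real \<Rightarrow> real \<Rightarrow> (real \<Rightarrow> real) \<Rightarrow> (3 \<Rightarrow> real^2) \<Rightarrow> (real^2) set \<Rightarrow>
     ((real^3) \<times> (real^2) \<Rightarrow> real) \<Rightarrow> (((real^3) \<times> (real^2)) \<times> real \<Rightarrow> real) \<Rightarrow> bool" where
  "weak_solution \<gamma> \<eta> \<beta>\<theta> \<beta>a \<sigma> X D f0 f \<longleftrightarrow>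
     in_Linf_L2 D f \<and>
     (\<exists>G H. in_L2_L2 D G \<and> in_L2_L2 D H \<and>
        (AE t in lebesgue_on {0<..}.
           has_weak_gradients D (\<lambda>x. f (x, t)) (\<lambda>x. G (x, t)) (\<lambda>x. H (x, t))) \<and>
        (\<forall>\<phi> :: ((real^3) \<times> (real^2)) \<times> real \<Rightarrow> real. smooth \<phi> \<longrightarrow>
           (AE T in lebesgue_on {0<..}.
              (LINT x|space_measure D. f (x, T) * \<phi> (x, T))
              - (LINT t:{0<..<T}|lebesgue.
                   (LINT x|space_measure D. f (x, t) * deriv (\<lambda>s. \<phi> (x, s)) t))
              + (LINT t:{0<..<T}|lebesgue.
                   (LINT (\<theta>, a)|space_measure D.
                      ((\<beta>\<theta>\<^sup>2 / 2) *\<^sub>R G ((\<theta>, a), t) - f ((\<theta>, a), t) *\<^sub>R drift_theta \<gamma> \<sigma> X \<theta> a)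
                        \<bullet> tangential_grad (\<lambda>\<theta>'. \<phi> ((\<theta>', a), t)) \<theta>
                      + ((\<beta>a\<^sup>2 / 2) *\<^sub>R H ((\<theta>, a), t) - f ((\<theta>, a), t) *\<^sub>R drift_a \<eta> \<sigma> X \<theta> a)
                        \<bullet> grad (\<lambda>a'. \<phi> ((\<theta>, a'), t)) a))
              = (LINT x|space_measure D. f0 x * \<phi> (x, 0)))))"

end

theory Submission
  imports Defs
begin

text \<open>
  Time is removed by the Laplace transform: multiplying the weak formulation by
  \<open>s * exp (- (s * T))\<close> and integrating over \<open>T\<close> shows that the transform \<open>F\<close> of \<open>f\<close>, with weak
  gradient \<open>G\<close>, solves the stationary problem
  \<open>s * \<integral> F \<psi> = - \<integral> \<Phi> \<bullet> \<nabla>\<psi>\<close> with \<open>\<Phi> = (\<beta>\<theta>\<^sup>2/2 G\<^sub>\<theta> - F v\<^sub>\<theta>, \<beta>a\<^sup>2/2 G\<^sub>a - F v\<^sub>a)\<close>, for every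
  smooth \<open>\<psi>\<close>. Near each point of the closure the domain has the segment property, so mollification
  with a kernel shifted in a suitable direction needs only values of \<open>F\<close> inside the domain. This
  justifies the test function \<open>\<psi> = F\<close>, locally and then globally by a partition of unity. Since the
  drift is bounded, \<open>s * \<integral> F\<^sup>2 = - \<integral> \<Phi> \<bullet> G \<le> const * \<integral> F\<^sup>2\<close>, whence \<open>F = 0\<close> for all large \<open>s\<close>, and
  \<open>f = 0\<close> by injectivity of the Laplace transform.
\<close>

section \<open>Smooth functions and bump functions\<close>

text \<open>A weak solution carries no time derivative, and each weak identity holds only for almost
  every \<open>T\<close>, off a null set that may depend on the test function, so \<open>f\<close>
  itself cannot be inserted directly. The transform removes this obstacle, because \<open>T\<close>
  is integrated out for a fixed \<psi>; it passes through the equation because that is linear and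
  the drift does not depend on time.

  In the stationary problem the equation admits every function smooth up to the boundary, which
  encodes the no-flux condition, while the gradient of \<open>F\<close> is known only against
  functions with compact support. The shifted kernel K(x - y) serves both sides: in \<open>x\<close>
  it is merely smooth, in \<open>y\<close> it is compactly supported. A suitable shift direction
  exists only locally, whence the localisation.

  The domain is a flat piece of codimension one in R^5: kernels live on the ambient space, measures
  are images of Lebesgue measure on R^4 under an isometry, and only translations along the plane are
  admissible.

  Since the transform is known to vanish only above a threshold, injectivity is applied to
  \<open>f\<close> damped by exp(- s0 t), where s0 lies above it.\<close>

lemma class_C_imp_continuous: "class_C k f \<Longrightarrow> continuous_on UNIV f"
proof (cases k)
  case (Suc m)
  assume "class_C k f"
  then have "\<forall>x. f differentiable (at x)" using Suc by simp
  then have "\<forall>x\<in>UNIV. isCont f x" using differentiable_imp_continuous_within by blast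
  then show ?thesis by (rule continuous_at_imp_continuous_on)
qed simp

lemma class_C_SucD: "class_C (Suc k) f \<Longrightarrow> class_C k f"
proof (induction k arbitrary: f)
  case 0
  show ?case using class_C_imp_continuous[OF 0] unfolding class_C.simps .
next
  case (Suc k)
  then show ?case by (auto simp del: class_C.simps(1))
qed

text \<open>Uniqueness of the derivative identifies any explicit \<open>f'\<close> with the choice
  made by \<open>frechet_derivative\<close>, so each closure rule below can supply its own
  formula.\<close>

lemma class_C_SucI:
  assumes "\<And>x. (f has_derivative f' x) (at x)" and "\<And>v. class_C k (\<lambda>x. f' x v)"
  shows "class_C (Suc k) f"
proof -
  have "frechet_derivative f (at x) = f' x" for x
    using frechet_derivative_at[OF assms(1)] by simp
  then show ?thesis using assms by (auto simp: differentiable_def)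
qed

lemma class_C_const: "class_C k (\<lambda>_. c)"
proof (induction k arbitrary: c)
  case (Suc k)
  show ?case by (rule class_C_SucI[where f' = "\<lambda>_ _. 0"]) (use Suc in auto)
qed simp

lemma class_C_derivative:
  assumes "class_C (Suc k) f"
  shows "(f has_derivative frechet_derivative f (at x)) (at x)"
    and "class_C k (\<lambda>x. frechet_derivative f (at x) v)"
  using assms frechet_derivative_works by auto

lemma class_C_add:
  "class_C k f \<Longrightarrow> class_C k g \<Longrightarrow> class_C k (\<lambda>x. f x + g x)"
proof (induction k arbitrary: f g)
  case 0 then show ?case by (auto intro: continuous_intros)
next
  case (Suc k)
  show ?case
    by (rule class_C_SucI[OF has_derivative_add[OF class_C_derivative(1) class_C_derivative(1)]])
      (use Suc class_C_derivative(2) in blast)+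
qed

lemma class_C_linear_affine:
  assumes "bounded_linear L"
  shows "class_C k g \<Longrightarrow> class_C k (\<lambda>x. g (L x + c))"
proof (induction k arbitrary: g)
  case 0
  have "continuous_on UNIV (\<lambda>x. L x + c)"
    by (intro continuous_intros linear_continuous_on assms)
  with 0 show ?case using continuous_on_compose2[of UNIV g UNIV "\<lambda>x. L x + c"] by auto
next
  case (Suc k)
  have d: "((\<lambda>x. L x + c) has_derivative L) (at x)" for x
    using assms by (auto intro!: derivative_eq_intros bounded_linear_imp_has_derivative)
  show ?case
    by (rule class_C_SucI[where f' = "\<lambda>x v. frechet_derivative g (at (L x + c)) (L v)"])
      (use Suc class_C_derivative has_derivative_compose[OF d] in \<open>blast+\<close>)
qed

lemma class_C_bounded_linear: "bounded_linear L \<Longrightarrow> class_C k L"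
proof (induction k)
  case 0 then show ?case by (simp add: linear_continuous_on)
next
  case (Suc k)
  show ?case
    by (rule class_C_SucI[where f' = "\<lambda>_. L"])
      (use Suc bounded_linear_imp_has_derivative class_C_const in \<open>blast+\<close>)
qed

lemma class_C_mult:
  fixes f g :: "'a::euclidean_space \<Rightarrow> real"
  shows "class_C k f \<Longrightarrow> class_C k g \<Longrightarrow> class_C k (\<lambda>x. f x * g x)"
proof (induction k arbitrary: f g)
  case 0 then show ?case by (auto intro: continuous_intros)
next
  case (Suc k)
  show ?case
    by (rule class_C_SucI[OF has_derivative_mult[OF class_C_derivative(1)[OF Suc.prems(1)] class_C_derivative(1)[OF Suc.prems(2)]]],
        rule class_C_add[OF Suc.IH[OF class_C_SucD[OF Suc.prems(1)] class_C_derivative(2)[OF Suc.prems(2)]]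
          Suc.IH[OF class_C_derivative(2)[OF Suc.prems(1)] class_C_SucD[OF Suc.prems(2)]]])
qed

lemma class_C_sum:
  "finite I \<Longrightarrow> (\<And>i. i \<in> I \<Longrightarrow> class_C k (f i)) \<Longrightarrow> class_C k (\<lambda>x. \<Sum>i\<in>I. f i x)"
proof (induction I rule: finite_induct)
  case (insert i I)
  then show ?case using class_C_add[of k "f i" "\<lambda>x. \<Sum>i\<in>I. f i x"] by simp
qed (simp add: class_C_const)

lemma class_C_compose_real:
  fixes h :: "real \<Rightarrow> real"
  shows "class_C k h \<Longrightarrow> class_C k g \<Longrightarrow> class_C k (\<lambda>x. h (g x))"
proof (induction k arbitrary: g h)
  case 0
  then show ?case using continuous_on_compose2[of UNIV h UNIV g] by auto
next
  case (Suc k)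
  \<comment> \<open>The chain rule evaluates the derivative of \<open>h\<close> in a direction that
    moves with \<open>x\<close>, whereas \<open>class_C\<close> speaks about fixed directions.
    Linearity on the line reduces it to direction 1 times a scalar factor.\<close>
  have lin: "frechet_derivative h (at y) r = frechet_derivative h (at y) 1 * r" for y r
    using linear_cmul[OF has_derivative_linear[OF class_C_derivative(1)[OF Suc.prems(1)]], of y r 1]
    by (simp add: mult.commute)
  show ?case
  proof (rule class_C_SucI[where f' = "\<lambda>x v. frechet_derivative h (at (g x)) 1 * frechet_derivative g (at x) v"])
    fix x
    show "((\<lambda>x. h (g x)) has_derivative
        (\<lambda>v. frechet_derivative h (at (g x)) 1 * frechet_derivative g (at x) v)) (at x)"
      using has_derivative_compose[OF class_C_derivative(1)[OF Suc.prems(2)] class_C_derivative(1)[OF Suc.prems(1)]]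
      by (subst (asm) lin)
  next
    fix v
    show "class_C k (\<lambda>x. frechet_derivative h (at (g x)) 1 * frechet_derivative g (at x) v)"
      by (rule class_C_mult[OF Suc.IH[OF class_C_derivative(2)[OF Suc.prems(1)] class_C_SucD[OF Suc.prems(2)]]
            class_C_derivative(2)[OF Suc.prems(2)]])
  qed
qed

text \<open>The derivative - h'/h^2 is a product of h' and two copies of 1/h, so 1/h at one order
  below suffices.\<close>

lemma class_C_inverse:
  fixes h :: "'a::euclidean_space \<Rightarrow> real"
  shows "class_C k h \<Longrightarrow> (\<And>x. h x \<noteq> 0) \<Longrightarrow> class_C k (\<lambda>x. inverse (h x))"
proof (induction k)
  case 0 then show ?case by (auto intro: continuous_intros)
next
  case (Suc k)
  have ih: "class_C k (\<lambda>x. inverse (h x))" using Suc class_C_SucD by blast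
  show ?case
  proof (rule class_C_SucI)
    show "((\<lambda>x. inverse (h x)) has_derivative
        (\<lambda>v. - (inverse (h x) * frechet_derivative h (at x) v * inverse (h x)))) (at x)" for x
      using Deriv.has_derivative_inverse[OF Suc.prems(2) class_C_derivative(1)[OF Suc.prems(1)]] by blast
    show "class_C k (\<lambda>x. - (inverse (h x) * frechet_derivative h (at x) v * inverse (h x)))" for v
      using class_C_mult[OF class_C_const[where c = "-1"]
          class_C_mult[OF class_C_mult[OF ih class_C_derivative(2)[OF Suc.prems(1)]] ih]] by simp
  qed
qed

text \<open>The case \<open>n = 0\<close> is the classical flat function exp(-1/u). The powers of
  1/u make the family closed under differentiation up to linear combinations, so smoothness follows
  by one induction for all \<open>n\<close> at once.\<close>

definition flat_exp :: "nat \<Rightarrow> real \<Rightarrow> real" where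
  "flat_exp n u = (if u > 0 then (1 / u) ^ n * exp (- (1 / u)) else 0)"

lemma flat_exp_tendsto_0: "(flat_exp n \<longlongrightarrow> 0) (at 0)"
proof -
  have "((\<lambda>u::real. (1/u) ^ n / exp (1/u)) \<longlongrightarrow> 0) (at_right 0)"
    by (rule filterlim_compose[OF tendsto_power_div_exp_0])
      (simp add: inverse_eq_divide[symmetric] filterlim_inverse_at_top_right)
  then have "(flat_exp n \<longlongrightarrow> 0) (at_right 0)"
    by (rule Lim_transform_eventually)
      (auto simp: flat_exp_def exp_minus divide_simps eventually_at_filter)
  moreover have "(flat_exp n \<longlongrightarrow> 0) (at_left 0)"
    by (rule Lim_transform_eventually[OF tendsto_const])
      (auto simp: flat_exp_def eventually_at_filter)
  ultimately show ?thesis using filterlim_split_at by blast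
qed

lemma flat_exp_has_derivative:
  "(flat_exp n has_real_derivative (flat_exp (n + 2) u - real n * flat_exp (n + 1) u)) (at u)"
proof -
  consider "u > 0" | "u < 0" | "u = 0" by linarith
  then show ?thesis
  proof cases
    case 1
    have "((\<lambda>u. (1 / u) ^ n * exp (- (1 / u))) has_real_derivative
        (flat_exp (n + 2) u - real n * flat_exp (n + 1) u)) (at u)"
    proof -
      have w: "((\<lambda>u. 1 / u) has_real_derivative - ((1 / u)\<^sup>2)) (at u)"
        using 1 by (auto intro!: derivative_eq_intros simp: field_simps power2_eq_square)
      have e: "((\<lambda>u. exp (- (1 / u))) has_real_derivative exp (- (1/u)) * (1 / u)\<^sup>2) (at u)"
        using DERIV_fun_exp[OF DERIV_minus[OF w]] by simp
      show ?thesis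
      proof (rule DERIV_cong[OF DERIV_mult[OF DERIV_power[OF w, of n] e]])
        \<comment> \<open>Here y stands for 1/u and z for exp(-1/u). For \<open>n = 0\<close> the
          truncated exponent \<open>n - Suc 0\<close> is harmless, because its coefficient is
          0.\<close>
        have "real n * (- y\<^sup>2 * y ^ (n - Suc 0)) * z + z * y\<^sup>2 * y ^ n
            = y ^ (n + 2) * z - real n * (y ^ (n + 1) * z)" for y z :: real
          by (cases n) (simp_all add: power2_eq_square algebra_simps)
        then show "real n * (- (1 / u)\<^sup>2 * (1 / u) ^ (n - Suc 0)) * exp (- (1 / u))
            + exp (- (1 / u)) * (1 / u)\<^sup>2 * (1 / u) ^ n
            = flat_exp (n + 2) u - real n * flat_exp (n + 1) u"
          using 1 unfolding flat_exp_def by (simp only: if_True)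
      qed
    qed
    then show ?thesis
      by (rule has_field_derivative_transform_within_open[where S = "{0<..}"])
        (use 1 in \<open>auto simp: flat_exp_def\<close>)
  next
    case 2
    have "((\<lambda>_. 0) has_real_derivative (flat_exp (n + 2) u - real n * flat_exp (n + 1) u)) (at u)"
      using 2 by (auto simp: flat_exp_def)
    then show ?thesis
      by (rule has_field_derivative_transform_within_open[where S = "{..<0}"])
        (use 2 in \<open>auto simp: flat_exp_def\<close>)
  next
    case 3
    \<comment> \<open>The difference quotient at 0 is the next member of the family, which tends to
      0.\<close>
    have "((\<lambda>h. (flat_exp n (0 + h) - flat_exp n 0) / h) \<longlongrightarrow> 0) (at 0)"
      by (rule Lim_transform_eventually[OF flat_exp_tendsto_0[of "Suc n"]])
        (auto simp: flat_exp_def eventually_at_filter divide_simps)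
    moreover have "flat_exp (n + 2) 0 - real n * flat_exp (n + 1) 0 = 0"
      by (simp add: flat_exp_def)
    ultimately show ?thesis unfolding 3 DERIV_def by (simp only:)
  qed
qed

lemma class_C_flat_exp: "class_C k (flat_exp n)"
proof (induction k arbitrary: n)
  case 0
  have "isCont (flat_exp n) u" for u
    by (rule DERIV_isCont[OF flat_exp_has_derivative])
  then show ?case by (simp add: continuous_on_eq_continuous_at)
next
  case (Suc k)
  show ?case
  proof (rule class_C_SucI[OF flat_exp_has_derivative[unfolded has_field_derivative_def]])
    fix v :: real
    have "class_C k (\<lambda>x. (flat_exp (n+2) x + (- real n) * flat_exp (n + 1) x) * v)"
      by (intro class_C_mult class_C_add class_C_const Suc)
    then show "class_C k (\<lambda>x. (flat_exp (n+2) x - real n * flat_exp (n + 1) x) * v)"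
      by simp
  qed
qed

section \<open>Algebra of smooth functions, bumps and plateaus\<close>

lemma smooth_const: "smooth (\<lambda>_. c)"
  and smooth_add: "smooth f \<Longrightarrow> smooth g \<Longrightarrow> smooth (\<lambda>x. f x + g x)"
  and smooth_affine: "bounded_linear L \<Longrightarrow> smooth f \<Longrightarrow> smooth (\<lambda>x. f (L x + c))"
  by (auto simp: smooth_def class_C_const class_C_add class_C_linear_affine)

lemma smooth_mult:
  fixes u v :: "'a::euclidean_space \<Rightarrow> real"
  shows "smooth u \<Longrightarrow> smooth v \<Longrightarrow> smooth (\<lambda>x. u x * v x)"
  by (auto simp: smooth_def class_C_mult)

lemma smooth_inverse:
  fixes u :: "'a::euclidean_space \<Rightarrow> real"
  shows "smooth u \<Longrightarrow> (\<And>x. u x \<noteq> 0) \<Longrightarrow> smooth (\<lambda>x. inverse (u x))"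
  by (simp add: smooth_def class_C_inverse)

lemma smooth_minus:
  fixes u v :: "'a::euclidean_space \<Rightarrow> real"
  assumes "smooth u" "smooth v"
  shows "smooth (\<lambda>x. u x - v x)"
  using smooth_add[OF assms(1) smooth_mult[OF smooth_const[where c = "-1"] assms(2)]] by simp

lemma smooth_differentiable: "smooth f \<Longrightarrow> f differentiable (at x)"
  unfolding smooth_def by (drule spec[of _ "Suc 0"]) simp

lemma smooth_continuous_on: "smooth f \<Longrightarrow> continuous_on S f"
  unfolding smooth_def by (drule spec[of _ 0]) (auto intro: continuous_on_subset)

lemma smooth_derivative_continuous_on:
  "smooth f \<Longrightarrow> continuous_on S (\<lambda>x. frechet_derivative f (at x) v)"
  unfolding smooth_def by (drule spec[of _ "Suc 0"]) (auto intro: continuous_on_subset)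

lemma class_C_norm_square: "class_C k (\<lambda>x::'a::euclidean_space. (norm (x - p))\<^sup>2)"
proof -
  have "class_C k (\<lambda>x. \<Sum>b\<in>Basis. (x \<bullet> b + - (p \<bullet> b)) * (x \<bullet> b + - (p \<bullet> b)))"
    by (rule class_C_sum[OF finite_Basis], rule class_C_mult;
        rule class_C_add[OF class_C_bounded_linear[OF bounded_linear_inner_left] class_C_const])
  moreover have "(\<Sum>b\<in>Basis. (x \<bullet> b + - (p \<bullet> b)) * (x \<bullet> b + - (p \<bullet> b))) = (norm (x - p))\<^sup>2" for x
    unfolding power2_norm_eq_inner euclidean_inner[of "x - p" "x - p"] by (simp add: inner_diff_left)
  ultimately show ?thesis by (simp only:)
qed

text \<open>The squared distance avoids the singularity of the norm at \<open>p\<close>.\<close>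

definition bump :: "'a::euclidean_space \<Rightarrow> real \<Rightarrow> 'a \<Rightarrow> real" where
  "bump p r x = flat_exp 0 (r\<^sup>2 - (norm (x - p))\<^sup>2)"

lemma smooth_bump: "smooth (bump p r)"
proof -
  have "class_C k (\<lambda>x. flat_exp 0 (r\<^sup>2 + (-1) * (norm (x - p))\<^sup>2))" for k
    by (rule class_C_compose_real[OF class_C_flat_exp],
        rule class_C_add[OF class_C_const class_C_mult[OF class_C_const class_C_norm_square]])
  then show ?thesis unfolding smooth_def bump_def[abs_def] by simp
qed

lemma bump_nonneg: "bump p r x \<ge> 0"
  and bump_le_1: "bump p r x \<le> 1"
  by (auto simp: bump_def flat_exp_def)

lemma bump_pos_iff:
  assumes "r > 0"
  shows "bump p r x > 0 \<longleftrightarrow> dist x p < r"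
proof -
  have "bump p r x > 0 \<longleftrightarrow> (norm (x - p))\<^sup>2 < r\<^sup>2"
    by (simp add: bump_def flat_exp_def)
  also have "\<dots> \<longleftrightarrow> dist x p < r"
    using assms power_mono_iff[of r "norm (x - p)" 2] unfolding dist_norm
    by (metis less_le_not_le linorder_not_le norm_ge_zero pos2)
  finally show ?thesis .
qed

text \<open>The quotient n/(n + m) works, with \<open>n\<close> positive exactly inside radius r and
  \<open>m\<close> positive exactly outside radius r/2. These two regions cover the space, so the
  denominator never vanishes.\<close>

lemma smooth_plateau:
  fixes p :: "'a::euclidean_space"
  assumes "r > 0"
  obtains z where "smooth z" "\<And>x. dist x p < r / 2 \<Longrightarrow> z x = 1" "\<And>x. r \<le> dist x p \<Longrightarrow> z x = (0::real)"
proof -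
  let ?n = "bump p r"
  let ?m = "\<lambda>x. flat_exp 0 ((norm (x - p))\<^sup>2 + - (r/2)\<^sup>2)"
  have pos: "?n x + ?m x > 0" for x
  proof (cases "dist x p < r")
    case True
    then show ?thesis using bump_pos_iff[OF assms, of p x] by (auto simp: flat_exp_def add_pos_nonneg)
  next
    case False
    then have "(r/2)\<^sup>2 < (norm (x - p))\<^sup>2"
      using assms by (intro power_strict_mono) (auto simp: dist_norm)
    then show ?thesis using bump_nonneg[of p r x] by (auto simp: flat_exp_def add_nonneg_pos)
  qed
  have m: "smooth ?m"
    unfolding smooth_def
    by (rule allI, rule class_C_compose_real[OF class_C_flat_exp],
        rule class_C_add[OF class_C_norm_square class_C_const])
  show thesis
  proof
    have "smooth (\<lambda>x. inverse (?n x + ?m x))"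
      by (rule smooth_inverse[OF smooth_add[OF smooth_bump m] less_imp_neq[OF pos, symmetric]])
    then show "smooth (\<lambda>x. ?n x * inverse (?n x + ?m x))"
      by (rule smooth_mult[OF smooth_bump])
  next
    fix x assume *: "dist x p < r / 2"
    then have "(norm (x - p))\<^sup>2 \<le> (r/2)\<^sup>2"
      using assms by (intro power_mono) (auto simp: dist_norm)
    then have "?m x = 0" by (simp add: flat_exp_def)
    then show "?n x * inverse (?n x + ?m x) = 1"
      using pos[of x] by simp
  next
    fix x assume "r \<le> dist x p"
    then show "?n x * inverse (?n x + ?m x) = 0"
      using bump_pos_iff[OF assms, of p x] bump_nonneg[of p r x] by simp
  qed
qed

section \<open>Approximate identities in \<open>L\<^sup>2\<close>\<close>

lemma norm_square_integrable_imp_integrable: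
  fixes g :: "'a \<Rightarrow> 'b::euclidean_space"
  assumes "finite_measure M" "g \<in> borel_measurable M" "integrable M (\<lambda>x. (norm (g x))\<^sup>2)"
  shows "integrable M g"
proof -
  interpret finite_measure M by fact
  show ?thesis
  proof (rule Bochner_Integration.integrable_bound)
    show "integrable M (\<lambda>x. 1 + (norm (g x))\<^sup>2)" using assms by simp
    have "norm (g x) \<le> 1 + (norm (g x))\<^sup>2" for x
      using sum_squares_bound[of 1 "norm (g x)"] norm_ge_zero[of "g x"] by (simp del: norm_ge_zero)
    then show "AE x in M. norm (g x) \<le> norm (1 + (norm (g x))\<^sup>2)" by simp
  qed fact
qed

lemma integrable_inner_square:
  fixes u v :: "'a \<Rightarrow> 'b::euclidean_space"
  assumes [measurable]: "u \<in> borel_measurable M" "v \<in> borel_measurable M"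
    and "integrable M (\<lambda>x. (norm (u x))\<^sup>2)" "integrable M (\<lambda>x. (norm (v x))\<^sup>2)"
  shows "integrable M (\<lambda>x. u x \<bullet> v x)"
proof (rule Bochner_Integration.integrable_bound)
  show "integrable M (\<lambda>x. (norm (u x))\<^sup>2 + (norm (v x))\<^sup>2)" using assms by simp
  have "norm (u x \<bullet> v x) \<le> (norm (u x))\<^sup>2 + (norm (v x))\<^sup>2" for x
  proof -
    have "norm (u x \<bullet> v x) \<le> norm (u x) * norm (v x)" by (simp add: Cauchy_Schwarz_ineq2)
    also have "\<dots> \<le> (norm (u x))\<^sup>2 + (norm (v x))\<^sup>2"
      using sum_squares_bound[of "norm (u x)" "norm (v x)"]
        mult_nonneg_nonneg[OF norm_ge_zero norm_ge_zero, of "u x" "v x"] by linarith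
    finally show ?thesis .
  qed
  then show "AE x in M. norm (u x \<bullet> v x) \<le> norm ((norm (u x))\<^sup>2 + (norm (v x))\<^sup>2)"
    by simp
qed measurable

lemma norm_square_add_le: "(norm (a + b))\<^sup>2 \<le> 2 * (norm a)\<^sup>2 + 2 * (norm b)\<^sup>2"
proof -
  have "(norm (a + b))\<^sup>2 \<le> (norm a + norm b)\<^sup>2"
    by (intro power_mono norm_triangle_ineq) simp
  then show ?thesis using sum_squares_bound[of "norm a" "norm b"] by (simp add: power2_sum)
qed

lemma norm_square_diff_le: "(norm (a - b))\<^sup>2 \<le> 2 * (norm a)\<^sup>2 + 2 * (norm b)\<^sup>2"
  using norm_square_add_le[of a "-b"] by simp

lemma integrable_square_add:
  fixes u v :: "'a \<Rightarrow> 'b::euclidean_space"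
  assumes [measurable]: "u \<in> borel_measurable M" "v \<in> borel_measurable M"
    and "integrable M (\<lambda>x. (norm (u x))\<^sup>2)" "integrable M (\<lambda>x. (norm (v x))\<^sup>2)"
  shows "integrable M (\<lambda>x. (norm (u x + v x))\<^sup>2)"
proof (rule Bochner_Integration.integrable_bound)
  show "integrable M (\<lambda>x. 2 * (norm (u x))\<^sup>2 + 2 * (norm (v x))\<^sup>2)" using assms by simp
qed (use norm_square_add_le in auto)

lemma integrable_square_diff:
  fixes u v :: "'a \<Rightarrow> 'b::euclidean_space"
  assumes "u \<in> borel_measurable M" "v \<in> borel_measurable M"
    and "integrable M (\<lambda>x. (norm (u x))\<^sup>2)" "integrable M (\<lambda>x. (norm (v x))\<^sup>2)"
  shows "integrable M (\<lambda>x. (norm (u x - v x))\<^sup>2)"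
  using integrable_square_add[of u M "\<lambda>x. - v x"] assms by simp

text \<open>Young's inequality with a free parameter \<open>s\<close> replaces Cauchy-Schwarz for
  integrals: a small \<open>s\<close> tames the fixed factor \<open>w\<close>, and then a large
  \<open>n\<close> tames the norm of \<open>d n\<close> divided by \<open>s\<close>.\<close>

lemma integral_inner_tendsto_0:
  fixes w :: "'a \<Rightarrow> 'b::euclidean_space" and d :: "nat \<Rightarrow> 'a \<Rightarrow> 'b"
  assumes [measurable]: "w \<in> borel_measurable M" "\<And>n. d n \<in> borel_measurable M"
    and w: "integrable M (\<lambda>x. (norm (w x))\<^sup>2)" and d: "\<And>n. integrable M (\<lambda>x. (norm (d n x))\<^sup>2)"
    and lim: "(\<lambda>n. LINT x|M. (norm (d n x))\<^sup>2) \<longlonglongrightarrow> 0"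
  shows "(\<lambda>n. LINT x|M. w x \<bullet> d n x) \<longlonglongrightarrow> 0"
proof -
  let ?W = "LINT x|M. (norm (w x))\<^sup>2" and ?D = "\<lambda>n. LINT x|M. (norm (d n x))\<^sup>2"
  have W: "?W \<ge> 0" by (rule integral_nonneg_AE) simp
  have bound: "norm (LINT x|M. w x \<bullet> d n x) \<le> s * ?W + ?D n / s" if s: "s > 0" for n s
  proof -
    have pt: "norm (w x \<bullet> d n x) \<le> s * (norm (w x))\<^sup>2 + (norm (d n x))\<^sup>2 / s" for x
    proof -
      have "norm (w x \<bullet> d n x) \<le> norm (w x) * norm (d n x)" by (simp add: Cauchy_Schwarz_ineq2)
      moreover have "0 \<le> (s * norm (w x) - norm (d n x))\<^sup>2" by simp
      then have "2 * s * (norm (w x) * norm (d n x)) \<le> s * (s * (norm (w x))\<^sup>2) + (norm (d n x))\<^sup>2"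
        by (simp add: power2_diff power_mult_distrib power2_eq_square algebra_simps)
      then have "2 * (norm (w x) * norm (d n x)) \<le> s * (norm (w x))\<^sup>2 + (norm (d n x))\<^sup>2 / s"
        using s by (simp add: field_simps)
      moreover have "0 \<le> norm (w x) * norm (d n x)" by simp
      ultimately show ?thesis by linarith
    qed
    have "norm (LINT x|M. w x \<bullet> d n x) \<le> (LINT x|M. norm (w x \<bullet> d n x))" by simp
    also have "\<dots> \<le> (LINT x|M. s * (norm (w x))\<^sup>2 + (norm (d n x))\<^sup>2 / s)"
      using w d pt by (intro integral_mono integrable_norm integrable_inner_square) auto
    also have "\<dots> = s * ?W + ?D n / s" using w d by simp
    finally show ?thesis .
  qed
  show ?thesis
  proof (rule LIMSEQ_I)
    fix e :: real assume e: "e > 0"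
    \<comment> \<open>Chosen so that \<open>s * ?W < e / 2\<close>; the \<open>+ 1\<close> covers
      \<open>?W = 0\<close>.\<close>
    define s where "s = e / (2 * (?W + 1))"
    have s: "s > 0" using e W unfolding s_def by (intro divide_pos_pos mult_pos_pos add_nonneg_pos) simp_all
    have "s * (w + 1) = e / 2" if "s = e / (2 * (w + 1))" "w \<ge> 0" for w
      using that by (simp add: field_simps)
    from this[OF s_def W] have sW: "s * ?W < e / 2"
      using s by (simp only: distrib_left)
    obtain N where N: "\<And>n. n \<ge> N \<Longrightarrow> norm (?D n - 0) < e * s / 2"
      using LIMSEQ_D[OF lim, of "e * s / 2"] e s by auto
    have "norm ((LINT x|M. w x \<bullet> d n x) - 0) < e" if "n \<ge> N" for n
    proof -
      have "?D n < e * s / 2" using N[OF that] by simp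
      then have "?D n / s < e / 2" using s by (simp add: field_simps)
      then show ?thesis using bound[OF s, of n] sW unfolding diff_zero by linarith
    qed
    then show "\<exists>N. \<forall>n\<ge>N. norm ((LINT x|M. w x \<bullet> d n x) - 0) < e" by blast
  qed
qed

lemma integrable_prod_mult:
  fixes u :: "'a \<Rightarrow> real" and v :: "'b \<Rightarrow> real"
  assumes "sigma_finite_measure M" "sigma_finite_measure N" "integrable M u" "integrable N v"
  shows "integrable (M \<Otimes>\<^sub>M N) (\<lambda>z. u (fst z) * v (snd z))"
proof -
  interpret N: sigma_finite_measure N by fact
  interpret pair_sigma_finite M N using assms by (simp add: pair_sigma_finite_def)
  have [measurable]: "u \<in> borel_measurable M" "v \<in> borel_measurable N" using assms by auto
  show ?thesis
    by (rule Fubini_integrable) (use assms in \<open>auto simp: abs_mult\<close>)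
qed

text \<open>The two normalisations have different tasks. Mass exactly one in \<open>y\<close> for
  \<open>x\<close> in \<open>V\<close> reproduces constants and gives convergence; mass at most one
  in \<open>x\<close> gives contraction in L^1 and, with Jensen, in L^2. \<open>V\<close> is
  separate from the support of \<open>M\<close> because a shifted kernel keeps its full mass inside
  the domain only near one point.\<close>

locale approximate_identity = finite_measure M
  for M :: "'a::euclidean_space measure" +
  fixes V :: "'a set" and k :: "nat \<Rightarrow> 'a \<Rightarrow> 'a \<Rightarrow> real" and r :: "nat \<Rightarrow> real"
  assumes sets_M [measurable_cong]: "sets M = sets borel"
    and V [measurable]: "V \<in> sets borel"
    and k_measurable [measurable]: "\<And>n. (\<lambda>z. k n (fst z) (snd z)) \<in> borel_measurable (borel \<Otimes>\<^sub>M borel)"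
    and k_nonneg: "\<And>n x y. 0 \<le> k n x y"
    and k_bounded: "\<And>n. \<exists>B. \<forall>x y. k n x y \<le> B"
    and k_fst: "\<And>n x. x \<in> V \<Longrightarrow> (LINT y|M. k n x y) = 1"
    and k_snd: "\<And>n. AE y in M. (LINT x|M. indicator V x * k n x y) \<le> 1"
    and k_local: "\<And>n x y. r n \<le> dist x y \<Longrightarrow> k n x y = 0"
    and r: "r \<longlonglongrightarrow> 0"
begin

sublocale MM: pair_sigma_finite M M ..

text \<open>The cutoff to \<open>V\<close> is part of the operator, since off \<open>V\<close> the
  mass of the kernel is not controlled from below and the contraction bound \<open>k_snd\<close>
  covers \<open>V\<close> only.\<close>

definition avg :: "nat \<Rightarrow> ('a \<Rightarrow> 'b::euclidean_space) \<Rightarrow> 'a \<Rightarrow> 'b" where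
  "avg n g x = indicator V x *\<^sub>R (LINT y|M. k n x y *\<^sub>R g y)"

lemma space_M: "space M = UNIV"
  using sets_eq_imp_space_eq[OF sets_M] by simp

lemma k_meas_MM [measurable]: "(\<lambda>z. k n (fst z) (snd z)) \<in> borel_measurable (M \<Otimes>\<^sub>M M)"
  by (subst measurable_cong_sets[OF sets_pair_measure_cong[OF sets_M sets_M] refl]) (rule k_measurable)

lemma k_measurable_snd [measurable]: "k n x \<in> borel_measurable M"
  using measurable_compose[OF measurable_Pair1'[of x M M] k_meas_MM] space_M by simp

lemma integrable_k_scale:
  fixes g :: "'a \<Rightarrow> 'b::euclidean_space"
  assumes "integrable M g"
  shows "integrable M (\<lambda>y. k n x y *\<^sub>R g y)"
proof -
  obtain B where B: "\<And>x y. k n x y \<le> B" using k_bounded by blast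
  have [measurable]: "g \<in> borel_measurable M" using assms by auto
  show ?thesis
  proof (rule Bochner_Integration.integrable_bound)
    show "integrable M (\<lambda>y. B * norm (g y))" using assms by simp
    have "norm (k n x y *\<^sub>R g y) \<le> norm (B * norm (g y))" for y
      using B[of x y] k_nonneg[of n x y] by (auto simp: abs_mult intro!: mult_right_mono)
    then show "AE y in M. norm (k n x y *\<^sub>R g y) \<le> norm (B * norm (g y))" by simp
  qed measurable
qed

lemma avg_measurable [measurable]:
  assumes [measurable]: "g \<in> borel_measurable M"
  shows "avg n g \<in> borel_measurable M"
proof -
  have "(\<lambda>(x, y). k n x y *\<^sub>R g y) \<in> borel_measurable (M \<Otimes>\<^sub>M M)"
    unfolding case_prod_beta by measurable
  then have [measurable]: "(\<lambda>x. LINT y|M. k n x y *\<^sub>R g y) \<in> borel_measurable M"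
    by (rule borel_measurable_lebesgue_integral)
  show ?thesis unfolding avg_def[abs_def] by measurable
qed

text \<open>Half of the Schur test: after exchanging the integrals, \<open>k_snd\<close> bounds the
  inner one.\<close>

lemma integral_kernel_le:
  fixes h :: "'a \<Rightarrow> real"
  assumes h: "integrable M h" and pos: "\<And>y. 0 \<le> h y"
  shows "integrable M (\<lambda>x. indicator V x * (LINT y|M. k n x y * h y))"
    and "(LINT x|M. indicator V x * (LINT y|M. k n x y * h y)) \<le> (LINT y|M. h y)"
proof -
  obtain B where B: "\<And>x y. k n x y \<le> B" using k_bounded by blast
  have [measurable]: "h \<in> borel_measurable M" using h by auto
  have int: "integrable (M \<Otimes>\<^sub>M M) (\<lambda>(x, y). indicator V x * k n x y * h y)"
  proof (rule Bochner_Integration.integrable_bound)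
    show "integrable (M \<Otimes>\<^sub>M M) (\<lambda>z. B * h (snd z))"
      by (rule integrable_prod_mult[of M M "\<lambda>_. B" h])
        (use h in \<open>auto simp: sigma_finite_measure_axioms\<close>)
    show "(\<lambda>(x, y). indicator V x * k n x y * h y) \<in> borel_measurable (M \<Otimes>\<^sub>M M)"
      unfolding case_prod_beta by measurable
    have "\<bar>indicator V x * k n x y * h y\<bar> \<le> \<bar>B * h y\<bar>" for x y
      using B[of x y] k_nonneg[of n x y] pos[of y] by (auto simp: abs_mult indicator_def intro!: mult_right_mono)
    then show "AE z in M \<Otimes>\<^sub>M M. norm (case z of (x, y) \<Rightarrow> indicator V x * k n x y * h y) \<le> norm (B * h (snd z))"
      by (auto simp: case_prod_beta)
  qed
  have eq: "(LINT y|M. indicator V x * k n x y * h y) = indicator V x * (LINT y|M. k n x y * h y)" for x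
    by (simp add: mult.assoc)
  show "integrable M (\<lambda>x. indicator V x * (LINT y|M. k n x y * h y))"
    using MM.integrable_fst[OF int] by (simp add: eq)
  have "(LINT x|M. indicator V x * (LINT y|M. k n x y * h y))
      = (LINT y|M. (LINT x|M. indicator V x * k n x y * h y))"
    using MM.Fubini_integral[OF int] by (simp add: eq)
  also have "\<dots> \<le> (LINT y|M. h y)"
  proof (rule integral_mono_AE)
    show "integrable M (\<lambda>y. LINT x|M. indicator V x * k n x y * h y)"
      using MM.integrable_snd[OF int] .
    show "AE y in M. (LINT x|M. indicator V x * k n x y * h y) \<le> h y"
      using k_snd[of n]
    proof eventually_elim
      case (elim y)
      have "(LINT x|M. indicator V x * k n x y * h y) = (LINT x|M. indicator V x * k n x y) * h y" by simp
      also have "\<dots> \<le> h y" using mult_right_mono[OF elim pos[of y]] by simp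
      finally show ?case .
    qed
  qed (use h in auto)
  finally show "(LINT x|M. indicator V x * (LINT y|M. k n x y * h y)) \<le> (LINT y|M. h y)" .
qed

lemma norm_avg_le:
  assumes "integrable M g"
  shows "norm (avg n g x) \<le> indicator V x * (LINT y|M. k n x y * norm (g y))"
proof -
  have "norm (LINT y|M. k n x y *\<^sub>R g y) \<le> (LINT y|M. norm (k n x y *\<^sub>R g y))"
    by (rule integral_norm_bound)
  also have "\<dots> = (LINT y|M. k n x y * norm (g y))" using k_nonneg by simp
  finally show ?thesis by (auto simp: avg_def indicator_def)
qed

lemma avg_contraction_L1:
  assumes g: "integrable M g"
  shows "integrable M (avg n g)" "(LINT x|M. norm (avg n g x)) \<le> (LINT x|M. norm (g x))"
proof -
  note * = integral_kernel_le[of "\<lambda>y. norm (g y)" n]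
  have [measurable]: "g \<in> borel_measurable M" using g by auto
  show i: "integrable M (avg n g)"
    by (rule Bochner_Integration.integrable_bound[OF *(1)])
      (use g norm_avg_le[OF g] in \<open>auto intro: order_trans[OF _ abs_ge_self]\<close>)
  have "(LINT x|M. norm (avg n g x)) \<le> (LINT x|M. indicator V x * (LINT y|M. k n x y * norm (g y)))"
    by (rule integral_mono) (use i g * norm_avg_le in auto)
  also have "\<dots> \<le> (LINT x|M. norm (g x))" using * g by simp
  finally show "(LINT x|M. norm (avg n g x)) \<le> (LINT x|M. norm (g x))" .
qed

text \<open>Jensen's inequality, obtained by expanding the nonnegative variance of
  \<open>norm (g y)\<close> about its mean \<open>m\<close> under the probability density
  \<open>k n x\<close>.\<close>

lemma norm_avg_square_le:
  assumes [measurable]: "g \<in> borel_measurable M" and g: "integrable M (\<lambda>x. (norm (g x))\<^sup>2)"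
  shows "(norm (avg n g x))\<^sup>2 \<le> indicator V x * (LINT y|M. k n x y * (norm (g y))\<^sup>2)"
proof (cases "x \<in> V")
  case True
  have gi: "integrable M g"
    by (rule norm_square_integrable_imp_integrable[OF finite_measure_axioms]) (use g in auto)
  define m where "m = (LINT y|M. k n x y * norm (g y))"
  have i1: "integrable M (\<lambda>y. k n x y * norm (g y))"
    using integrable_k_scale[of "\<lambda>y. norm (g y)" n x] gi by simp
  have i2: "integrable M (\<lambda>y. k n x y * (norm (g y))\<^sup>2)"
    using integrable_k_scale[of "\<lambda>y. (norm (g y))\<^sup>2" n x] g by simp
  have i0: "integrable M (\<lambda>y. k n x y)"
    using integrable_k_scale[of "\<lambda>y. 1::real" n x] by simp
  have "0 \<le> (LINT y|M. k n x y * (norm (g y) - m)\<^sup>2)"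
    using k_nonneg by simp
  also have "\<dots> = (LINT y|M. k n x y * (norm (g y))\<^sup>2 - 2 * m * (k n x y * norm (g y)) + m\<^sup>2 * k n x y)"
    by (rule Bochner_Integration.integral_cong) (auto simp: power2_eq_square algebra_simps)
  also have "\<dots> = (LINT y|M. k n x y * (norm (g y))\<^sup>2) - 2 * m * m + m\<^sup>2"
    using i0 i1 i2 k_fst[OF True, of n] by (simp add: m_def)
  finally have "m\<^sup>2 \<le> (LINT y|M. k n x y * (norm (g y))\<^sup>2)" by (simp add: power2_eq_square)
  moreover have "norm (avg n g x) \<le> m" using norm_avg_le[OF gi, of n x] True by (simp add: m_def)
  then have "(norm (avg n g x))\<^sup>2 \<le> m\<^sup>2" by (intro power_mono) auto
  ultimately show ?thesis using True by simp
qed (simp add: avg_def)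

lemma avg_contraction_L2:
  assumes [measurable]: "g \<in> borel_measurable M" and g: "integrable M (\<lambda>x. (norm (g x))\<^sup>2)"
  shows "integrable M (\<lambda>x. (norm (avg n g x))\<^sup>2)"
    and "(LINT x|M. (norm (avg n g x))\<^sup>2) \<le> (LINT x|M. (norm (g x))\<^sup>2)"
proof -
  note * = integral_kernel_le[OF g, of n]
  show i: "integrable M (\<lambda>x. (norm (avg n g x))\<^sup>2)"
    by (rule Bochner_Integration.integrable_bound[OF *(1)])
      (use g norm_avg_square_le[of g n] in \<open>auto intro: order_trans[OF _ abs_ge_self]\<close>)
  have "(LINT x|M. (norm (avg n g x))\<^sup>2) \<le> (LINT x|M. indicator V x * (LINT y|M. k n x y * (norm (g y))\<^sup>2))"
    by (rule integral_mono) (use i g * norm_avg_square_le[of g n] in auto)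
  also have "\<dots> \<le> (LINT x|M. (norm (g x))\<^sup>2)" using * by simp
  finally show "(LINT x|M. (norm (avg n g x))\<^sup>2) \<le> (LINT x|M. (norm (g x))\<^sup>2)" .
qed

lemma avg_diff: "integrable M g \<Longrightarrow> integrable M h \<Longrightarrow> avg n (\<lambda>x. g x - h x) x = avg n g x - avg n h x"
  using integrable_k_scale[of g n x] integrable_k_scale[of h n x]
  by (simp add: avg_def scaleR_diff_right)

section \<open>Convergence of the averages in L^1\<close>

definition L1_error :: "('a \<Rightarrow> 'b::euclidean_space) \<Rightarrow> nat \<Rightarrow> real" where
  "L1_error g n = (LINT x|M. norm (avg n g x - indicator V x *\<^sub>R g x))"

lemma integrable_err:
  assumes "integrable M g"
  shows "integrable M (\<lambda>x. avg n g x - indicator V x *\<^sub>R g x)"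
  using avg_contraction_L1[OF assms] assms integrable_mult_indicator[of V M g] sets_M V by auto

text \<open>One of the two copies of the distance is the direct error; the other is its average, no
  larger by the L^1 contraction.\<close>

lemma L1_error_approx:
  assumes g: "integrable M g" and h: "integrable M h"
  shows "L1_error g n \<le> L1_error h n + 2 * (LINT x|M. norm (g x - h x))"
proof -
  have gh: "integrable M (\<lambda>x. g x - h x)" using g h by simp
  have "L1_error g n \<le> (LINT x|M. norm (avg n h x - indicator V x *\<^sub>R h x) + norm (avg n (\<lambda>x. g x - h x) x) + norm (g x - h x))"
    unfolding L1_error_def
  proof (rule integral_mono)
    fix x
    have "avg n g x - indicator V x *\<^sub>R g x = (avg n h x - indicator V x *\<^sub>R h x) + avg n (\<lambda>x. g x - h x) x
        - indicator V x *\<^sub>R (g x - h x)"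
      by (simp add: avg_diff[OF g h] scaleR_diff_right)
    also have "norm \<dots> \<le> norm (avg n h x - indicator V x *\<^sub>R h x) + norm (avg n (\<lambda>x. g x - h x) x)
        + norm (indicator V x *\<^sub>R (g x - h x))"
      by (meson norm_triangle_ineq norm_triangle_ineq4 add_mono_thms_linordered_semiring(3) order_trans)
    also have "norm (indicator V x *\<^sub>R (g x - h x)) \<le> norm (g x - h x)"
      by (simp add: indicator_def)
    finally show "norm (avg n g x - indicator V x *\<^sub>R g x) \<le> norm (avg n h x - indicator V x *\<^sub>R h x)
        + norm (avg n (\<lambda>x. g x - h x) x) + norm (g x - h x)" by simp
  qed (use integrable_err[OF g] integrable_err[OF h] avg_contraction_L1(1)[OF gh] gh in auto)
  also have "\<dots> = L1_error h n + (LINT x|M. norm (avg n (\<lambda>x. g x - h x) x)) + (LINT x|M. norm (g x - h x))"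
    unfolding L1_error_def
    using integrable_err[OF h] avg_contraction_L1(1)[OF gh] gh by simp
  also have "\<dots> \<le> L1_error h n + 2 * (LINT x|M. norm (g x - h x))"
    using avg_contraction_L1(2)[OF gh, of n] by simp
  finally show ?thesis .
qed

lemma L1_error_nonneg: "L1_error g n \<ge> 0" by (simp add: L1_error_def)

lemma L1_error_closure:
  assumes g: "integrable M g" and h: "\<And>i::nat. integrable M (h i)" "\<And>i. L1_error (h i) \<longlonglongrightarrow> 0"
    and lim: "(\<lambda>i. LINT x|M. norm (g x - h i x)) \<longlonglongrightarrow> 0"
  shows "L1_error g \<longlonglongrightarrow> 0"
proof (rule LIMSEQ_I)
  fix e :: real assume e: "e > 0"
  obtain i where i: "(LINT x|M. norm (g x - h i x)) < e / 4"
    using LIMSEQ_D[OF lim, of "e / 4"] e by auto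
  obtain N where N: "\<And>n. n \<ge> N \<Longrightarrow> L1_error (h i) n < e / 2"
    using LIMSEQ_D[OF h(2)[of i], of "e / 2"] e L1_error_nonneg[of "h i"] by force
  have "norm (L1_error g n - 0) < e" if "n \<ge> N" for n
    using L1_error_approx[OF g h(1)[of i], of n] N[OF that] i L1_error_nonneg[of g n] by simp
  then show "\<exists>N. \<forall>n\<ge>N. norm (L1_error g n - 0) < e" by blast
qed

text \<open>Since the kernel has mass one and shrinking support, continuity gives pointwise
  convergence on \<open>V\<close>; the bound 2B dominates.\<close>

lemma avg_tendsto_continuous:
  assumes cont: "continuous_on UNIV h" and bnd: "\<And>x. norm (h x) \<le> B"
  shows "L1_error h \<longlonglongrightarrow> 0"
proof -
  have [measurable]: "h \<in> borel_measurable borel" using cont by (rule borel_measurable_continuous_onI)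
  then have [measurable]: "h \<in> borel_measurable M" by measurable
  have B: "0 \<le> B" using norm_ge_zero[of "h undefined"] bnd[of undefined] by linarith
  have hi: "integrable M h"
    by (rule integrable_const_bound[where B = B]) (use bnd in auto)
  have i0: "integrable M (\<lambda>y. k n x y)" for n x
    using integrable_k_scale[of "\<lambda>y. 1::real" n x] by simp
  have pt: "(\<lambda>n. norm (avg n h x - indicator V x *\<^sub>R h x)) \<longlonglongrightarrow> 0" for x
  proof (cases "x \<in> V")
    case True
    show ?thesis
    proof (rule LIMSEQ_I)
      fix e :: real assume e: "e > 0"
      obtain d where d: "d > 0" "\<And>y. dist y x < d \<Longrightarrow> dist (h y) (h x) < e / 2"
        using cont e unfolding continuous_on_iff by (metis UNIV_I half_gt_zero)
      obtain N where N: "\<And>n. n \<ge> N \<Longrightarrow> r n < d" using LIMSEQ_D[OF r d(1)] by force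
      have "norm (norm (avg n h x - indicator V x *\<^sub>R h x) - 0) < e" if n: "n \<ge> N" for n
      proof -
        have "avg n h x - indicator V x *\<^sub>R h x = (LINT y|M. k n x y *\<^sub>R h y) - (LINT y|M. k n x y *\<^sub>R h x)"
          using True k_fst[OF True, of n] i0[of n x] by (simp add: avg_def)
        also have "\<dots> = (LINT y|M. k n x y *\<^sub>R (h y - h x))"
          using integrable_k_scale[OF hi, of n x] i0[of n x] by (simp add: scaleR_diff_right)
        also have "norm \<dots> \<le> (LINT y|M. norm (k n x y *\<^sub>R (h y - h x)))"
          by (rule integral_norm_bound)
        also have "\<dots> \<le> (LINT y|M. k n x y * (e/2))"
        proof (rule integral_mono)
          show "integrable M (\<lambda>y. norm (k n x y *\<^sub>R (h y - h x)))"
            by (intro integrable_norm integrable_k_scale) (use hi in auto)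
          show "integrable M (\<lambda>y. k n x y * (e/2))" using i0[of n x] by simp
          show "norm (k n x y *\<^sub>R (h y - h x)) \<le> k n x y * (e/2)" for y
          proof (cases "dist x y < r n")
            case True
            then have "dist (h y) (h x) < e / 2" using d(2)[of y] N[OF n] by (simp add: dist_commute)
            then have "norm (h y - h x) \<le> e / 2" by (simp add: dist_norm)
            from mult_left_mono[OF this k_nonneg[of n x y]] show ?thesis
              using k_nonneg[of n x y] by simp
          next
            case False
            then show ?thesis using k_local[of n x y] by simp
          qed
        qed
        also have "\<dots> = e / 2" using k_fst[OF True, of n] by simp
        finally show ?thesis using e by simp
      qed
      then show "\<exists>N. \<forall>n\<ge>N. norm (norm (avg n h x - indicator V x *\<^sub>R h x) - 0) < e" by blast
    qed
  qed (simp add: avg_def)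
  have avb: "norm (avg n h x) \<le> B" for n x
  proof (cases "x \<in> V")
    case True
    have "norm (avg n h x) \<le> (LINT y|M. k n x y * norm (h y))"
      using norm_avg_le[OF hi, of n x] True by simp
    also have "\<dots> \<le> (LINT y|M. k n x y * B)"
      by (rule integral_mono)
        (use integrable_k_scale[of "\<lambda>y. norm (h y)" n x] hi i0[of n x] bnd k_nonneg in \<open>auto intro!: mult_left_mono\<close>)
    also have "\<dots> = B" using k_fst[OF True, of n] by simp
    finally show ?thesis .
  qed (simp add: avg_def B)
  have "(\<lambda>n. LINT x|M. norm (avg n h x - indicator V x *\<^sub>R h x)) \<longlonglongrightarrow> (LINT x|M. 0)"
  proof (rule integral_dominated_convergence[where w = "\<lambda>_. 2 * B"])
    have "norm (norm (avg n h x - indicator V x *\<^sub>R h x)) \<le> 2 * B" for n x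
    proof -
      have "norm (avg n h x - indicator V x *\<^sub>R h x) \<le> norm (avg n h x) + norm (indicator V x *\<^sub>R h x)"
        by (rule norm_triangle_ineq4)
      also have "norm (indicator V x *\<^sub>R h x) \<le> B" using bnd[of x] B by (simp add: indicator_def)
      finally show ?thesis using avb[of n x] by simp
    qed
    then show "AE x in M. norm (norm (avg n h x - indicator V x *\<^sub>R h x)) \<le> 2 * B" for n by simp
  qed (use pt in auto)
  then show ?thesis by (simp add: L1_error_def[abs_def])
qed

lemma L1_error_add:
  assumes g: "integrable M g" and h: "integrable M h" and "L1_error g \<longlonglongrightarrow> 0" "L1_error h \<longlonglongrightarrow> 0"
  shows "L1_error (\<lambda>x. g x + h x) \<longlonglongrightarrow> 0"
proof (rule tendsto_sandwich[OF _ _ tendsto_const])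
  show "(\<lambda>n. L1_error g n + L1_error h n) \<longlonglongrightarrow> 0" using tendsto_add[OF assms(3,4)] by simp
  have "L1_error (\<lambda>x. g x + h x) n \<le> L1_error g n + L1_error h n" for n
  proof -
    have "L1_error (\<lambda>x. g x + h x) n \<le> (LINT x|M. norm (avg n g x - indicator V x *\<^sub>R g x) + norm (avg n h x - indicator V x *\<^sub>R h x))"
      unfolding L1_error_def
    proof (rule integral_mono)
      fix x
      have "avg n (\<lambda>x. g x + h x) x = avg n g x + avg n h x"
        using integrable_k_scale[OF g, of n x] integrable_k_scale[OF h, of n x]
        by (simp add: avg_def scaleR_add_right)
      then have "avg n (\<lambda>x. g x + h x) x - indicator V x *\<^sub>R (g x + h x)
         = (avg n g x - indicator V x *\<^sub>R g x) + (avg n h x - indicator V x *\<^sub>R h x)"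
        by (simp add: scaleR_add_right)
      then show "norm (avg n (\<lambda>x. g x + h x) x - indicator V x *\<^sub>R (g x + h x))
         \<le> norm (avg n g x - indicator V x *\<^sub>R g x) + norm (avg n h x - indicator V x *\<^sub>R h x)"
        by (metis norm_triangle_ineq)
    qed (use integrable_err[OF g] integrable_err[OF h] integrable_err[of "\<lambda>x. g x + h x"] g h in auto)
    also have "\<dots> = L1_error g n + L1_error h n"
      unfolding L1_error_def using integrable_err[OF g] integrable_err[OF h] by simp
    finally show ?thesis .
  qed
  then show "\<forall>\<^sub>F n in sequentially. L1_error (\<lambda>x. g x + h x) n \<le> L1_error g n + L1_error h n" by simp
qed (simp add: L1_error_nonneg)

lemma L1_error_minus: "L1_error (\<lambda>x. - g x) = L1_error g"
proof -
  have "avg n (\<lambda>x. - g x) x - indicator V x *\<^sub>R (- g x) = - (avg n g x - indicator V x *\<^sub>R g x)" for n x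
    by (simp add: avg_def)
  then show ?thesis unfolding L1_error_def[abs_def] by (simp only: norm_minus_cancel)
qed

lemma integrable_indicator_scaleR:
  "A \<in> sets borel \<Longrightarrow> integrable M (\<lambda>x. indicator A x *\<^sub>R (c::'b::euclidean_space))"
  using sets_M by (intro integrable_const_bound[where B = "norm c"]) (auto simp: indicator_def)

lemma Int_stable_closed: "Int_stable {S :: 'b::topological_space set. closed S}"
  by (auto simp: Int_stable_def)

lemma closed_subset_Pow_UNIV: "{S :: 'b::topological_space set. closed S} \<subseteq> Pow UNIV"
  by simp

text \<open>A Dynkin argument over closed sets, which are stable under intersection and generate the
  Borel sets. A closed set is reached by continuous functions of the distance to it, complements and
  disjoint unions by additivity and closure under L^1 limits.\<close>

lemma L1_error_indicator:
  assumes "A \<in> sets borel"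
  shows "L1_error (\<lambda>x. indicator A x *\<^sub>R (c::'b::euclidean_space)) \<longlonglongrightarrow> 0"
proof -
  have "A \<in> sigma_sets UNIV (Collect closed)"
    using assms by (simp add: borel_eq_closed)
  from Int_stable_closed closed_subset_Pow_UNIV this show ?thesis
  proof (induction A rule: sigma_sets_induct_disjoint)
    case (basic C)
    then have C: "closed C" by simp
    show ?case
    \<comment> \<open>The empty set is treated apart because \<open>infdist x {} = 0\<close> by
      convention, so the functions \<open>h i\<close> below would all be the constant
      \<open>c\<close>.\<close>
    proof (cases "C = {}")
      case True
      then show ?thesis by (simp add: L1_error_def[abs_def] avg_def)
    next
      case False
      define h where "h i x = max 0 (1 - real i * infdist x C) *\<^sub>R c" for i x
      have cont: "continuous_on UNIV (h i)" for i
        unfolding h_def by (intro continuous_intros)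
      have bnd: "norm (h i x) \<le> norm c" for i x
      proof -
        have "\<bar>max 0 (1 - real i * infdist x C)\<bar> \<le> 1" by (auto simp: infdist_nonneg)
        from mult_right_mono[OF this norm_ge_zero[of c]] show ?thesis by (simp add: h_def)
      qed
      have [measurable]: "h i \<in> borel_measurable M" for i
        using borel_measurable_continuous_onI[OF cont] by measurable
      have hi: "integrable M (h i)" for i
        by (rule integrable_const_bound[where B = "norm c"]) (use bnd in auto)
      have [measurable]: "C \<in> sets borel" using C by simp
      show ?thesis
      proof (rule L1_error_closure[OF integrable_indicator_scaleR hi avg_tendsto_continuous[OF cont bnd]])
        have "(\<lambda>i. LINT x|M. norm (indicator C x *\<^sub>R c - h i x)) \<longlonglongrightarrow> (LINT x|M. 0)"
        proof (rule integral_dominated_convergence[where w = "\<lambda>_. 2 * norm c"])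
          have "(\<lambda>i. norm (indicator C x *\<^sub>R c - h i x)) \<longlonglongrightarrow> 0" for x
          proof (cases "x \<in> C")
            case True
            then have "h i x = c" for i by (simp add: h_def)
            then show ?thesis using True by simp
          next
            case nin: False
            then have p: "infdist x C > 0"
              using C False infdist_pos_not_in_closed by blast
            obtain N :: nat where N: "1 / infdist x C < real N" using reals_Archimedean2 by blast
            have "norm (indicator C x *\<^sub>R c - h i x) = 0" if "i \<ge> N" for i
            proof -
              have "1 < real N * infdist x C" using N p by (simp add: field_simps)
              also have "\<dots> \<le> real i * infdist x C" using that p by (intro mult_right_mono) auto
              finally show ?thesis using nin by (simp add: h_def)
            qed
            then show ?thesis
              by (intro tendsto_eventually) (auto simp: eventually_sequentially)
          qed
          then show "AE x in M. (\<lambda>i. norm (indicator C x *\<^sub>R c - h i x)) \<longlonglongrightarrow> 0" by simp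
          have "norm (norm (indicator C x *\<^sub>R c - h i x)) \<le> 2 * norm c" for i x
            using norm_triangle_ineq4[of "indicator C x *\<^sub>R c" "h i x"] bnd[of i x] norm_ge_zero[of c]
            by (auto simp: indicator_def simp del: norm_ge_zero split: if_splits)
          then show "AE x in M. norm (norm (indicator C x *\<^sub>R c - h i x)) \<le> 2 * norm c" for i by simp
        qed auto
        then show "(\<lambda>i. LINT x|M. norm (indicator C x *\<^sub>R c - h i x)) \<longlonglongrightarrow> 0" by simp
      qed simp
    qed
  next
    case empty
    then show ?case by (simp add: L1_error_def[abs_def] avg_def)
  next
    case (compl A)
    then have A: "A \<in> sets borel" by (simp add: borel_eq_closed)
    have eq: "(\<lambda>x. indicator (UNIV - A) x *\<^sub>R c) = (\<lambda>x. c + - (indicator A x *\<^sub>R c))"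
      by (auto simp: indicator_def)
    have "L1_error (\<lambda>x. c) \<longlonglongrightarrow> 0" by (rule avg_tendsto_continuous[where B = "norm c"]) auto
    moreover have "L1_error (\<lambda>x. - (indicator A x *\<^sub>R c)) \<longlonglongrightarrow> 0"
      unfolding L1_error_minus by (rule compl)
    ultimately show ?case
      unfolding eq using integrable_indicator_scaleR[OF A, of c] by (intro L1_error_add) auto
  next
    case (union A)
    then have A: "A i \<in> sets borel" for i by (auto simp: borel_eq_closed)
    define h where "h m x = (\<Sum>i<m. indicator (A i) x *\<^sub>R c)" for m x
    have hi: "integrable M (h m)" for m
      unfolding h_def using integrable_indicator_scaleR[OF A] by (intro Bochner_Integration.integrable_sum) auto
    have e: "L1_error (h m) \<longlonglongrightarrow> 0" for m
    proof (induction m)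
      case 0
      then show ?case by (simp add: h_def L1_error_def[abs_def] avg_def)
    next
      case (Suc m)
      have "h (Suc m) = (\<lambda>x. h m x + indicator (A m) x *\<^sub>R c)" by (auto simp: h_def)
      then show ?case using L1_error_add[OF hi integrable_indicator_scaleR[OF A] Suc union(3)] by simp
    qed
    have UN: "(\<Union>i. A i) \<in> sets borel" using A by auto
    have [measurable]: "A i \<in> sets borel" for i by (rule A)
    have heq: "h m x = indicator (\<Union>i<m. A i) x *\<^sub>R c" for m x
    proof -
      have "indicat_real (\<Union>i<m. A i) x = (\<Sum>i<m. indicator (A i) x)"
        using union(1) by (intro indicator_UN_disjoint) (auto simp: disjoint_family_on_def)
      then show ?thesis by (simp only: h_def scaleR_sum_left)
    qed
    show ?case
    proof (rule L1_error_closure[OF integrable_indicator_scaleR[OF UN] hi e])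
      have "(\<lambda>m. LINT x|M. norm (indicator (\<Union>i. A i) x *\<^sub>R c - h m x)) \<longlonglongrightarrow> (LINT x|M. 0)"
      proof (rule integral_dominated_convergence[where w = "\<lambda>_. 2 * norm c"])
        have "(\<lambda>m. norm (indicator (\<Union>i. A i) x *\<^sub>R c - h m x)) \<longlonglongrightarrow> 0" for x
        proof (cases "x \<in> (\<Union>i. A i)")
          case True
          then obtain j where "x \<in> A j" by blast
          then have "norm (indicator (\<Union>i. A i) x *\<^sub>R c - h m x) = 0" if "m \<ge> Suc j" for m
            using that True by (force simp: heq indicator_def)
          then show ?thesis
            by (intro tendsto_eventually) (auto simp: eventually_sequentially)
        next
          case False
          then have "norm (indicator (\<Union>i. A i) x *\<^sub>R c - h m x) = 0" for m
            by (simp add: heq indicator_def)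
          then show ?thesis by simp
        qed
        then show "AE x in M. (\<lambda>m. norm (indicator (\<Union>i. A i) x *\<^sub>R c - h m x)) \<longlonglongrightarrow> 0" by simp
        have "norm (norm (indicator (\<Union>i. A i) x *\<^sub>R c - h m x)) \<le> 2 * norm c" for m x
          by (auto simp: heq indicator_def)
        then show "AE x in M. norm (norm (indicator (\<Union>i. A i) x *\<^sub>R c - h m x)) \<le> 2 * norm c" for m by simp
      qed (use hi UN sets_M in auto)
      then show "(\<lambda>m. LINT x|M. norm (indicator (\<Union>i. A i) x *\<^sub>R c - h m x)) \<longlonglongrightarrow> 0" by simp
    qed
  qed
qed

lemma avg_tendsto_L1:
  assumes "integrable M g"
  shows "L1_error g \<longlonglongrightarrow> 0"
  using assms
proof (induction g rule: integrable_induct)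
  case (base A c)
  then show ?case using L1_error_indicator[of A c] sets_M by simp
next
  case (add f g)
  then show ?case using L1_error_add by blast
next
  case (lim f s)
  show ?case
  proof (rule L1_error_closure[OF lim(4) lim(1) lim(5)])
    have [measurable]: "f \<in> borel_measurable M" "s i \<in> borel_measurable M" for i
      using lim(1,4) by auto
    have "(\<lambda>i. LINT x|M. norm (f x - s i x)) \<longlonglongrightarrow> (LINT x|M. 0)"
    proof (rule integral_dominated_convergence[where w = "\<lambda>x. 3 * norm (f x)"])
      show "AE x in M. (\<lambda>i. norm (f x - s i x)) \<longlonglongrightarrow> 0"
      proof (rule AE_I2)
        fix x assume "x \<in> space M"
        from tendsto_norm[OF tendsto_diff[OF tendsto_const[of "f x"] lim(2)[OF this]]]
        show "(\<lambda>i. norm (f x - s i x)) \<longlonglongrightarrow> 0" by simp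
      qed
      show "AE x in M. norm (norm (f x - s i x)) \<le> 3 * norm (f x)" for i
      proof (rule AE_I2)
        fix x assume "x \<in> space M"
        then have "norm (s i x) \<le> 2 * norm (f x)" using lim(3) by blast
        then show "norm (norm (f x - s i x)) \<le> 3 * norm (f x)"
          using norm_triangle_ineq4[of "f x" "s i x"] by simp
      qed
    qed (use lim(4) in auto)
    then show "(\<lambda>i. LINT x|M. norm (f x - s i x)) \<longlonglongrightarrow> 0" by simp
  qed
qed

text \<open>Truncation at height \<open>B\<close> reduces L^2 to L^1: for the bounded part the
  squared error is at most a constant times the error, and the remaining part is small in L^2 and
  stays small by the L^2 contraction.\<close>

lemma avg_tendsto_L2:
  assumes [measurable]: "g \<in> borel_measurable M" and g: "integrable M (\<lambda>x. (norm (g x))\<^sup>2)"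
  shows "(\<lambda>n. LINT x|M. (norm (avg n g x - indicator V x *\<^sub>R g x))\<^sup>2) \<longlonglongrightarrow> 0"
proof (rule LIMSEQ_I)
  fix e :: real assume e: "e > 0"
  define h where "h (B::nat) x = (if norm (g x) \<le> real B then g x else 0)" for B x
  have [measurable]: "h B \<in> borel_measurable M" for B unfolding h_def by measurable
  have le: "norm (h B x) \<le> norm (g x)" "norm (h B x) \<le> real B" for B x by (auto simp: h_def)
  have h2: "integrable M (\<lambda>x. (norm (h B x))\<^sup>2)" for B
    by (rule Bochner_Integration.integrable_bound[OF g]) (auto intro!: power_mono le)
  have d2: "integrable M (\<lambda>x. (norm (g x - h B x))\<^sup>2)" for B
    using integrable_square_diff[of g M "h B"] g h2 by auto
  have gi: "integrable M g"
    by (rule norm_square_integrable_imp_integrable[OF finite_measure_axioms assms(1) g])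
  have hi: "integrable M (h B)" for B
    by (rule norm_square_integrable_imp_integrable[OF finite_measure_axioms _ h2]) measurable
  have "(\<lambda>B. LINT x|M. (norm (g x - h B x))\<^sup>2) \<longlonglongrightarrow> (LINT x|M. 0)"
  proof (rule integral_dominated_convergence[where w = "\<lambda>x. (norm (g x))\<^sup>2"])
    have "(\<lambda>B. (norm (g x - h B x))\<^sup>2) \<longlonglongrightarrow> 0" for x
    proof -
      obtain N :: nat where "norm (g x) \<le> real N" using real_arch_simple by blast
      then have "(norm (g x - h B x))\<^sup>2 = 0" if "B \<ge> N" for B
        using that by (auto simp: h_def)
      then show ?thesis by (intro tendsto_eventually) (auto simp: eventually_sequentially)
    qed
    then show "AE x in M. (\<lambda>B. (norm (g x - h B x))\<^sup>2) \<longlonglongrightarrow> 0" by simp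
    show "AE x in M. norm ((norm (g x - h B x))\<^sup>2) \<le> (norm (g x))\<^sup>2" for B
      by (auto simp: h_def)
  qed (use g in auto)
  \<comment> \<open>The discarded part enters 4 times directly and 4 times through its average, so 8
    times e/16 leaves half of \<open>e\<close>.\<close>
  then obtain B where B: "(LINT x|M. (norm (g x - h B x))\<^sup>2) < e / 16"
    using LIMSEQ_D[of "\<lambda>B. LINT x|M. (norm (g x - h B x))\<^sup>2" 0 "e/16"] e by auto
  \<comment> \<open>The truncated function and its average are each at most \<open>B\<close>, so
    their difference is at most 2B; the \<open>+ 1\<close> keeps \<open>C\<close> positive when
    \<open>B = 0\<close>.\<close>
  define C where "C = 2 * real B + 1"
  have C: "C > 0" by (simp add: C_def)
  obtain N where N: "\<And>n. n \<ge> N \<Longrightarrow> L1_error (h B) n < e / (4 * C)"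
    using LIMSEQ_D[OF avg_tendsto_L1[OF hi[of B]], of "e / (4 * C)"] e C L1_error_nonneg[of "h B"] by force
  let ?d = "\<lambda>n f x. avg n f x - indicator V x *\<^sub>R f x"
  have "norm ((LINT x|M. (norm (?d n g x))\<^sup>2) - 0) < e" if n: "n \<ge> N" for n
  proof -
    have avb: "norm (avg n (h B) x) \<le> real B" for x
    proof (cases "x \<in> V")
      case True
      have "norm (avg n (h B) x) \<le> (LINT y|M. k n x y * norm (h B y))"
        using norm_avg_le[OF hi[of B], of n x] True by simp
      also have "\<dots> \<le> (LINT y|M. k n x y * real B)"
        by (rule integral_mono)
          (use integrable_k_scale[of "\<lambda>y. norm (h B y)" n x] integrable_k_scale[of "\<lambda>y. 1::real" n x]
              hi[of B] le k_nonneg in \<open>auto intro!: mult_left_mono\<close>)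
      also have "\<dots> = real B" using k_fst[OF True, of n] by simp
      finally show ?thesis .
    qed (simp add: avg_def)
    have "(LINT x|M. (norm (?d n g x))\<^sup>2)
        \<le> (LINT x|M. 2 * (C * norm (?d n (h B) x)) + (4 * (norm (avg n (\<lambda>x. g x - h B x) x))\<^sup>2 + 4 * (norm (g x - h B x))\<^sup>2))"
    proof (rule integral_mono)
      have "indicator V x *\<^sub>R g x = (if x \<in> V then g x else 0)" for x by simp
      then have i2: "integrable M (\<lambda>x. (norm (indicator V x *\<^sub>R g x))\<^sup>2)"
        by (intro Bochner_Integration.integrable_bound[OF g]) (auto simp: indicator_def sets_M)
      show "integrable M (\<lambda>x. (norm (?d n g x))\<^sup>2)"
        by (rule integrable_square_diff) (use avg_contraction_L2(1)[OF _ g] i2 sets_M in auto)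
      show "integrable M (\<lambda>x. 2 * (C * norm (?d n (h B) x)) + (4 * (norm (avg n (\<lambda>x. g x - h B x) x))\<^sup>2 + 4 * (norm (g x - h B x))\<^sup>2))"
        using integrable_err[OF hi[of B], of n] avg_contraction_L2(1)[OF _ d2[of B], of n] d2[of B] by auto
      fix x
      have eq: "?d n g x = ?d n (h B) x + (avg n (\<lambda>x. g x - h B x) x - indicator V x *\<^sub>R (g x - h B x))"
        by (simp add: avg_diff[OF gi hi] scaleR_diff_right)
      have "(norm (?d n g x))\<^sup>2 \<le> 2 * (norm (?d n (h B) x))\<^sup>2
          + 2 * (norm (avg n (\<lambda>x. g x - h B x) x - indicator V x *\<^sub>R (g x - h B x)))\<^sup>2"
        unfolding eq by (rule norm_square_add_le)
      moreover have "(norm (avg n (\<lambda>x. g x - h B x) x - indicator V x *\<^sub>R (g x - h B x)))\<^sup>2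
          \<le> 2 * (norm (avg n (\<lambda>x. g x - h B x) x))\<^sup>2 + 2 * (norm (indicator V x *\<^sub>R (g x - h B x)))\<^sup>2"
        by (rule norm_square_diff_le)
      moreover have "(norm (indicator V x *\<^sub>R (g x - h B x)))\<^sup>2 \<le> (norm (g x - h B x))\<^sup>2"
        by (simp add: indicator_def)
      moreover have "(norm (?d n (h B) x))\<^sup>2 \<le> C * norm (?d n (h B) x)"
      proof -
        have "norm (?d n (h B) x) \<le> norm (avg n (h B) x) + norm (indicator V x *\<^sub>R h B x)"
          by (rule norm_triangle_ineq4)
        also have "norm (indicator V x *\<^sub>R h B x) \<le> real B" using le(2)[of B x] by (simp add: indicator_def)
        finally have "norm (?d n (h B) x) \<le> C" using avb[of x] by (simp add: C_def)
        then show ?thesis unfolding power2_eq_square by (intro mult_right_mono) auto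
      qed
      ultimately show "(norm (?d n g x))\<^sup>2 \<le> 2 * (C * norm (?d n (h B) x))
          + (4 * (norm (avg n (\<lambda>x. g x - h B x) x))\<^sup>2 + 4 * (norm (g x - h B x))\<^sup>2)"
        by linarith
    qed
    also have "\<dots> = 2 * C * L1_error (h B) n + 4 * (LINT x|M. (norm (avg n (\<lambda>x. g x - h B x) x))\<^sup>2)
         + 4 * (LINT x|M. (norm (g x - h B x))\<^sup>2)"
      using integrable_err[OF hi[of B], of n] avg_contraction_L2(1)[OF _ d2[of B], of n] d2[of B]
      by (simp add: L1_error_def)
    also have "\<dots> \<le> 2 * C * L1_error (h B) n + 8 * (LINT x|M. (norm (g x - h B x))\<^sup>2)"
      using avg_contraction_L2(2)[OF _ d2[of B], of n] by simp
    also have "\<dots> < e"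
    proof -
      have "2 * C * L1_error (h B) n < e / 2" using N[OF n] C by (simp add: field_simps)
      then show ?thesis using B by simp
    qed
    finally show ?thesis by simp
  qed
  then show "\<exists>N. \<forall>n\<ge>N. norm ((LINT x|M. (norm (?d n g x))\<^sup>2) - 0) < e" by blast
qed

text \<open>The form used in the limit of the tested equation: a weight supported in
  \<open>V\<close> absorbs the cutoff of \<open>avg\<close>, so the plain kernel integral
  appears.\<close>

lemma avg_tendsto_inner:
  fixes g w :: "'a \<Rightarrow> 'b::euclidean_space"
  assumes [measurable]: "g \<in> borel_measurable M" "w \<in> borel_measurable M"
    and g: "integrable M (\<lambda>x. (norm (g x))\<^sup>2)" and w: "integrable M (\<lambda>x. (norm (w x))\<^sup>2)"
    and supp: "\<And>x. x \<notin> V \<Longrightarrow> w x = 0"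
  shows "(\<lambda>n. LINT x|M. w x \<bullet> (LINT y|M. k n x y *\<^sub>R g y)) \<longlonglongrightarrow> (LINT x|M. w x \<bullet> g x)"
proof -
  have i2: "integrable M (\<lambda>x. (norm (indicator V x *\<^sub>R g x))\<^sup>2)"
    by (intro Bochner_Integration.integrable_bound[OF g]) (auto simp: indicator_def sets_M)
  have "(\<lambda>n. LINT x|M. w x \<bullet> (avg n g x - indicator V x *\<^sub>R g x)) \<longlonglongrightarrow> 0"
  proof (rule integral_inner_tendsto_0[OF _ _ w _ avg_tendsto_L2[OF _ g]])
    show "integrable M (\<lambda>x. (norm (avg n g x - indicator V x *\<^sub>R g x))\<^sup>2)" for n
      by (rule integrable_square_diff) (use avg_contraction_L2(1)[OF _ g] i2 sets_M in auto)
  qed (use sets_M in auto)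
  moreover have "(LINT x|M. w x \<bullet> (avg n g x - indicator V x *\<^sub>R g x))
      = (LINT x|M. w x \<bullet> (LINT y|M. k n x y *\<^sub>R g y)) - (LINT x|M. w x \<bullet> g x)" for n
  proof -
    have "(LINT x|M. w x \<bullet> (avg n g x - indicator V x *\<^sub>R g x))
       = (LINT x|M. w x \<bullet> avg n g x) - (LINT x|M. w x \<bullet> (indicator V x *\<^sub>R g x))"
      unfolding inner_diff_right
      by (rule Bochner_Integration.integral_diff; rule integrable_inner_square)
        (use w i2 avg_contraction_L2(1)[OF _ g] sets_M in auto)
    moreover have "w x \<bullet> avg n g x = w x \<bullet> (LINT y|M. k n x y *\<^sub>R g y)"
       "w x \<bullet> (indicator V x *\<^sub>R g x) = w x \<bullet> g x" for x
      using supp[of x] by (auto simp: avg_def indicator_def)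
    ultimately show ?thesis by (simp only:)
  qed
  ultimately have "(\<lambda>n. (LINT x|M. w x \<bullet> (LINT y|M. k n x y *\<^sub>R g y)) - (LINT x|M. w x \<bullet> g x)) \<longlonglongrightarrow> 0"
    by simp
  then show ?thesis by (simp add: LIM_zero_iff)
qed

end

section \<open>The stationary weak problem\<close>

type_synonym state = "(real^3) \<times> (real^2)"

definition kgrad :: "(state \<Rightarrow> real) \<Rightarrow> state \<Rightarrow> state" where
  "kgrad \<psi> x = (tangential_grad (\<lambda>\<theta>. \<psi> (\<theta>, snd x)) (fst x), grad (\<lambda>a. \<psi> (fst x, a)) (snd x))"

text \<open>The linear map that sends a total differential to the joint gradient. Its linearity
  transfers the sum and product rules to \<open>kgrad\<close>.\<close>

definition functional_grad :: "(state \<Rightarrow> real) \<Rightarrow> state" where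
  "functional_grad D = ((mat 1 - (1/3) *\<^sub>R (\<chi> i j. 1)) *v (\<chi> k. D (axis k 1, 0)), (\<chi> k. D (0, axis k 1)))"

lemma vec_lambda_add: "(\<chi> k. u k + v k) = (\<chi> k. u k) + (\<chi> k. v k)"
  and vec_lambda_scaleR: "(\<chi> k. c * w k) = c *\<^sub>R (\<chi> k. w k)" for u v :: "'n::finite \<Rightarrow> 'a::plus" and w :: "'n::finite \<Rightarrow> real"
  by (simp_all add: vec_eq_iff)

lemma functional_grad_add: "functional_grad (\<lambda>v. D v + D' v) = functional_grad D + functional_grad D'"
  and functional_grad_scale: "functional_grad (\<lambda>v. c * D v) = c *\<^sub>R functional_grad D"
  by (simp_all add: functional_grad_def vec_lambda_add vec_lambda_scaleR
      matrix_vector_right_distrib matrix_vector_mult_scaleR)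

lemma kgrad_eq:
  assumes "(\<psi> has_derivative D) (at x)"
  shows "kgrad \<psi> x = functional_grad D"
proof -
  obtain \<theta> a where x: "x = (\<theta>, a)" by (cases x)
  have D: "(\<psi> has_derivative D) (at (\<theta>, a))" using assms x by simp
  have "((\<lambda>t. (t, a)) has_derivative (\<lambda>h. (h, 0))) (at \<theta>)"
    by (auto intro!: derivative_eq_intros)
  from has_derivative_compose[OF this D]
  have 1: "frechet_derivative (\<lambda>t. \<psi> (t, a)) (at \<theta>) = (\<lambda>h. D (h, 0))"
    by (rule frechet_derivative_at[symmetric])
  have "((\<lambda>t. (\<theta>, t)) has_derivative (\<lambda>h. (0, h))) (at a)"
    by (auto intro!: derivative_eq_intros)
  from has_derivative_compose[OF this D]
  have 2: "frechet_derivative (\<lambda>t. \<psi> (\<theta>, t)) (at a) = (\<lambda>h. D (0, h))"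
    by (rule frechet_derivative_at[symmetric])
  show ?thesis
    by (simp add: x kgrad_def tangential_grad_def grad_def 1 2 functional_grad_def)
qed

lemma smooth_has_derivative:
  "smooth \<psi> \<Longrightarrow> (\<psi> has_derivative frechet_derivative \<psi> (at x)) (at x)"
  using smooth_differentiable frechet_derivative_works by blast

lemma kgrad_smooth: "smooth \<psi> \<Longrightarrow> kgrad \<psi> x = functional_grad (frechet_derivative \<psi> (at x))"
  by (rule kgrad_eq[OF smooth_has_derivative])

lemma kgrad_add:
  assumes "smooth u" "smooth v"
  shows "kgrad (\<lambda>x. u x + v x) x = kgrad u x + kgrad v x"
  using kgrad_eq[OF has_derivative_add[OF smooth_has_derivative[OF assms(1)] smooth_has_derivative[OF assms(2)]]]
  by (simp add: kgrad_smooth assms functional_grad_add)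

lemma kgrad_mult:
  assumes "smooth u" "smooth v"
  shows "kgrad (\<lambda>x. u x * v x) x = u x *\<^sub>R kgrad v x + v x *\<^sub>R kgrad u x"
proof -
  have "kgrad (\<lambda>x. u x * v x) x
      = functional_grad (\<lambda>h. u x * frechet_derivative v (at x) h + v x * frechet_derivative u (at x) h)"
    using kgrad_eq[OF has_derivative_mult[OF smooth_has_derivative[OF assms(1)] smooth_has_derivative[OF assms(2)]]]
    by (simp add: mult.commute)
  then show ?thesis by (simp add: kgrad_smooth assms functional_grad_add functional_grad_scale)
qed

text \<open>The opposite signs in \<open>x\<close> and \<open>y\<close> are what let a derivative of
  the kernel in \<open>x\<close> be handed to the weak gradient, which acts in
  \<open>y\<close>.\<close>

lemma kgrad_translate:
  assumes "smooth K"
  shows "kgrad (\<lambda>x. K (x - y)) x = kgrad K (x - y)"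
    and "kgrad (\<lambda>y. K (x - y)) y = - kgrad K (x - y)"
proof -
  have "((\<lambda>x. x - y) has_derivative (\<lambda>h. h)) (at x)"
    by (auto intro!: derivative_eq_intros)
  from kgrad_eq[OF has_derivative_compose[OF this smooth_has_derivative[OF assms]]]
  show "kgrad (\<lambda>x. K (x - y)) x = kgrad K (x - y)" by (simp add: kgrad_smooth assms)
  have d: "((\<lambda>y. x - y) has_derivative (\<lambda>h. - h)) (at y)"
    by (auto intro!: derivative_eq_intros)
  have "frechet_derivative K (at z) (- h) = (-1) * frechet_derivative K (at z) h" for z h
    using linear_neg[OF has_derivative_linear[OF smooth_has_derivative[OF assms]]] by simp
  with kgrad_eq[OF has_derivative_compose[OF d smooth_has_derivative[OF assms]]]
  have "kgrad (\<lambda>y. K (x - y)) y = functional_grad (\<lambda>h. (-1) * frechet_derivative K (at (x - y)) h)"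
    by simp
  then show "kgrad (\<lambda>y. K (x - y)) y = - kgrad K (x - y)"
    unfolding functional_grad_scale by (simp add: kgrad_smooth assms)
qed

lemma kgrad_const: "kgrad (\<lambda>_. c) x = 0"
proof -
  \<comment> \<open>The zero functional is written as \<open>0 * 0\<close> so that
    \<open>functional_grad_scale\<close> extracts the factor 0.\<close>
  have "kgrad (\<lambda>_. c) x = functional_grad (\<lambda>_. 0 * 0)"
    using kgrad_eq[OF has_derivative_const] by simp
  then show ?thesis unfolding functional_grad_scale by simp
qed

lemma kgrad_locally_const:
  assumes "open S" "x \<in> S" "\<And>y. y \<in> S \<Longrightarrow> u y = c"
  shows "kgrad u x = 0"
proof -
  have "(u has_derivative (\<lambda>_. 0)) (at x)"
    by (rule has_derivative_transform_within_open[OF has_derivative_const assms(1,2)])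
      (use assms(3) in auto)
  then have "kgrad u x = functional_grad (\<lambda>_. 0 * 0)" using kgrad_eq by simp
  then show ?thesis unfolding functional_grad_scale by simp
qed

lemma continuous_on_kgrad:
  assumes "smooth u"
  shows "continuous_on S (kgrad u)"
proof -
  have "continuous_on S (\<lambda>x. functional_grad (frechet_derivative u (at x)))"
    unfolding functional_grad_def
    by (intro continuous_on_Pair continuous_on_vec_lambda smooth_derivative_continuous_on[OF assms]
        linear_continuous_on_compose[OF _ matrix_vector_mul_linear])
  then show ?thesis by (simp add: kgrad_smooth assms)
qed

lemma smooth_reflect: "smooth K \<Longrightarrow> smooth (\<lambda>y. K (x - y))"
  using smooth_affine[of "\<lambda>y. - y" K x] by (simp add: bounded_linear_minus[OF bounded_linear_ident])

lemma smooth_translate: "smooth K \<Longrightarrow> smooth (\<lambda>x. K (x - y))"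
  using smooth_affine[of "\<lambda>x. x" K "- y"] by simp

lemma smooth_prod:
  fixes b :: "'i \<Rightarrow> 'a::euclidean_space \<Rightarrow> real"
  assumes "finite I" "\<And>i. i \<in> I \<Longrightarrow> smooth (b i)"
  shows "smooth (\<lambda>x. \<Prod>i\<in>I. b i x)"
  using assms
proof (induction I rule: finite_induct)
  case (insert i I)
  then show ?case using smooth_mult[of "b i" "\<lambda>x. \<Prod>i\<in>I. b i x"] by simp
qed (simp add: smooth_const)

definition mollifiable :: "state measure \<Rightarrow> state set \<Rightarrow> state \<Rightarrow> real \<Rightarrow> bool" where
  "mollifiable M U p \<rho> \<longleftrightarrow> (\<exists>K r. approximate_identity M (U \<inter> ball p \<rho>) (\<lambda>n x y. K n (x - y)) r \<and>
     (\<forall>n. smooth (K n)) \<and>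
     (\<forall>n. \<forall>x\<in>U \<inter> ball p \<rho>. \<exists>C. compact C \<and> C \<subseteq> U \<and> (\<forall>y\<in>U - C. K n (x - y) = 0)))"

lemma continuous_norm_bounded_on:
  fixes h :: "'a::euclidean_space \<Rightarrow> 'b::euclidean_space"
  assumes "continuous_on UNIV h" "bounded S"
  obtains B where "B \<ge> 0" "\<And>x. x \<in> S \<Longrightarrow> norm (h x) \<le> B"
proof -
  have "compact (h ` closure S)"
    using assms by (intro compact_continuous_image) (auto intro: continuous_on_subset)
  from compact_imp_bounded[OF this] obtain B where B: "\<forall>y\<in>h ` closure S. norm y \<le> B"
    unfolding bounded_iff by (rule exE)
  have "norm (h x) \<le> max 0 B" if "x \<in> S" for x
    using B that closure_subset[of S] by (auto intro: max.coboundedI2)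
  then show ?thesis using that[of "max 0 B"] by simp
qed

text \<open>\<open>weak_grad\<close> is restricted to compact support in \<open>U\<close>, whereas
  \<open>weak_eq\<close> holds up to the boundary, which contains the no-flux condition. The flux
  \<Phi> is kept abstract: its relation to \<open>F\<close> and \<open>G\<close> enters only through
  the coercivity assumption of \<open>solution_zero\<close>.\<close>

locale weak_elliptic = finite_measure M for M :: "state measure" +
  fixes U :: "state set" and F :: "state \<Rightarrow> real" and G \<Phi> :: "state \<Rightarrow> state" and \<kappa> :: real
  assumes sets_M [measurable_cong]: "sets M = sets borel"
    and U [measurable]: "U \<in> sets borel" and bounded_U: "bounded U"
    and F [measurable]: "F \<in> borel_measurable M" and F2: "integrable M (\<lambda>x. (norm (F x))\<^sup>2)"
    and G [measurable]: "G \<in> borel_measurable M" and G2: "integrable M (\<lambda>x. (norm (G x))\<^sup>2)"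
    and \<Phi> [measurable]: "\<Phi> \<in> borel_measurable M" and \<Phi>2: "integrable M (\<lambda>x. (norm (\<Phi> x))\<^sup>2)"
    and outside: "\<And>x. x \<notin> U \<Longrightarrow> F x = 0" "\<And>x. x \<notin> U \<Longrightarrow> \<Phi> x = 0"
    and weak_grad: "\<And>\<psi> C. smooth \<psi> \<Longrightarrow> compact C \<Longrightarrow> C \<subseteq> U \<Longrightarrow> (\<And>x. x \<in> U - C \<Longrightarrow> \<psi> x = 0) \<Longrightarrow>
        (LINT x|M. F x *\<^sub>R kgrad \<psi> x) = - (LINT x|M. \<psi> x *\<^sub>R G x)"
    and weak_eq: "\<And>\<psi>. smooth \<psi> \<Longrightarrow> \<kappa> * (LINT x|M. F x * \<psi> x) = - (LINT x|M. \<Phi> x \<bullet> kgrad \<psi> x)"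
begin

sublocale MM: pair_sigma_finite M M ..

lemma integrable_F: "integrable M F"
  by (rule norm_square_integrable_imp_integrable[OF finite_measure_axioms F F2])

lemma integrable_\<Phi>: "integrable M \<Phi>"
  by (rule norm_square_integrable_imp_integrable[OF finite_measure_axioms \<Phi> \<Phi>2])

lemma bounded_on_differences:
  assumes "continuous_on UNIV (h :: state \<Rightarrow> 'b::euclidean_space)"
  obtains B where "B \<ge> 0" "\<And>x y. x \<in> U \<Longrightarrow> y \<in> U \<Longrightarrow> norm (h (x - y)) \<le> B"
proof -
  have "bounded ((\<lambda>(x, y). x - y) ` (U \<times> U))"
    using bounded_minus[OF bounded_U bounded_U] .
  from continuous_norm_bounded_on[OF assms this] obtain B
    where "B \<ge> 0" "\<And>z. z \<in> (\<lambda>(x, y). x - y) ` (U \<times> U) \<Longrightarrow> norm (h z) \<le> B" by blast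
  then show ?thesis using that[of B] by force
qed

lemma square_integrable_scale:
  fixes h :: "state \<Rightarrow> real" and u :: "state \<Rightarrow> 'b::euclidean_space"
  assumes h: "continuous_on UNIV h" and [measurable]: "u \<in> borel_measurable M"
    and u: "integrable M (\<lambda>x. (norm (u x))\<^sup>2)" "\<And>x. x \<notin> U \<Longrightarrow> u x = 0"
  shows "integrable M (\<lambda>x. (norm (h x *\<^sub>R u x))\<^sup>2)"
proof -
  obtain B where B: "B \<ge> 0" "\<And>x. x \<in> U \<Longrightarrow> norm (h x) \<le> B" using continuous_norm_bounded_on[OF h bounded_U] by blast
  have [measurable]: "h \<in> borel_measurable M"
    using borel_measurable_continuous_onI[OF h] by measurable
  show ?thesis
  proof (rule Bochner_Integration.integrable_bound)
    show "integrable M (\<lambda>x. B\<^sup>2 * (norm (u x))\<^sup>2)" using u by simp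
    have "norm ((norm (h x *\<^sub>R u x))\<^sup>2) \<le> norm (B\<^sup>2 * (norm (u x))\<^sup>2)" for x
    proof (cases "x \<in> U")
      case True
      have "(norm (h x))\<^sup>2 \<le> B\<^sup>2" using B(2)[OF True] by (intro power_mono) auto
      then show ?thesis using B by (simp add: power_mult_distrib mult_right_mono)
    qed (simp add: u)
    then show "AE x in M. norm ((norm (h x *\<^sub>R u x))\<^sup>2) \<le> norm (B\<^sup>2 * (norm (u x))\<^sup>2)" by simp
  qed measurable
qed

lemma square_integrable_inner:
  fixes h :: "state \<Rightarrow> 'b::euclidean_space" and u :: "state \<Rightarrow> 'b"
  assumes h: "continuous_on UNIV h" and [measurable]: "u \<in> borel_measurable M"
    and u: "integrable M (\<lambda>x. (norm (u x))\<^sup>2)" "\<And>x. x \<notin> U \<Longrightarrow> u x = 0"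
  shows "integrable M (\<lambda>x. (norm (u x \<bullet> h x))\<^sup>2)"
proof -
  have [measurable]: "h \<in> borel_measurable M"
    using borel_measurable_continuous_onI[OF h] by measurable
  have n: "continuous_on UNIV (\<lambda>x. norm (h x))" by (intro continuous_intros h)
  have *: "integrable M (\<lambda>x. (norm (norm (h x) *\<^sub>R u x))\<^sup>2)"
    by (rule square_integrable_scale[OF n _ u]) measurable
  show ?thesis
  proof (rule Bochner_Integration.integrable_bound[OF *])
    have "(norm (u x \<bullet> h x))\<^sup>2 \<le> (norm (norm (h x) *\<^sub>R u x))\<^sup>2" for x
      using Cauchy_Schwarz_ineq2[of "u x" "h x"] by (intro power_mono) (auto simp: mult.commute)
    then show "AE x in M. norm ((norm (u x \<bullet> h x))\<^sup>2) \<le> norm ((norm (norm (h x) *\<^sub>R u x))\<^sup>2)"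
      by simp
  qed measurable
qed

text \<open>The formal result of testing with the product of \<zeta> and \<open>F\<close>, whose
  gradient is \<open>F x *\<^sub>R kgrad \<zeta> x + \<zeta> x *\<^sub>R G x\<close>.\<close>

definition energy_identity :: "(state \<Rightarrow> real) \<Rightarrow> bool" where
  "energy_identity \<zeta> \<longleftrightarrow> \<kappa> * (LINT x|M. \<zeta> x * (F x)\<^sup>2) = - (LINT x|M. \<Phi> x \<bullet> (F x *\<^sub>R kgrad \<zeta> x + \<zeta> x *\<^sub>R G x))"

text \<open>The equation is tested with \<open>x \<mapsto> \<zeta> x * K n (x - y)\<close> for each \<open>y\<close>, weighted with \<open>F y\<close>
  and integrated over \<open>y\<close>; the weak gradient then acts on \<open>y \<mapsto> K n (x - y)\<close>, which has compact
  support in \<open>U\<close>.\<close>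

lemma energy_identity_local:
  assumes moll: "mollifiable M U p \<rho>" and \<zeta>: "smooth \<zeta>" and "\<rho>' < \<rho>"
    and supp: "\<And>x. \<rho>' \<le> dist x p \<Longrightarrow> \<zeta> x = 0"
  shows "energy_identity \<zeta>"
proof -
  let ?V = "U \<inter> ball p \<rho>"
  obtain K r where ai: "approximate_identity M ?V (\<lambda>n x y. K n (x - y)) r"
    and K: "\<And>n. smooth (K n)"
    and Ksupp: "\<And>n x. x \<in> ?V \<Longrightarrow> \<exists>C. compact C \<and> C \<subseteq> U \<and> (\<forall>y\<in>U - C. K n (x - y) = 0)"
    using moll unfolding mollifiable_def by blast
  interpret approximate_identity M ?V "\<lambda>n x y. K n (x - y)" r by (rule ai)
  have contK: "continuous_on UNIV (K n)" for n by (rule smooth_continuous_on[OF K])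
  have contgK: "continuous_on UNIV (kgrad (K n))" for n by (rule continuous_on_kgrad[OF K])
  have cont\<zeta>: "continuous_on UNIV \<zeta>" by (rule smooth_continuous_on[OF \<zeta>])
  have contg\<zeta>: "continuous_on UNIV (kgrad \<zeta>)" by (rule continuous_on_kgrad[OF \<zeta>])
  have [measurable]: "\<zeta> \<in> borel_measurable borel" "kgrad \<zeta> \<in> borel_measurable borel"
     "\<And>n. K n \<in> borel_measurable borel" "\<And>n. kgrad (K n) \<in> borel_measurable borel"
    using contK contgK cont\<zeta> contg\<zeta> by (auto intro: borel_measurable_continuous_onI)
  \<comment> \<open>The gap between \<rho>' and \<rho> gives an open set on which \<zeta> vanishes
    around each such point, so its derivative vanishes too.\<close>
  have gsupp: "kgrad \<zeta> x = 0" if "x \<notin> ball p \<rho>" for x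
  proof (rule kgrad_locally_const[of "{x. \<rho>' < dist x p}"])
    show "open {x. \<rho>' < dist x p}" by (intro open_Collect_less continuous_intros)
    show "x \<in> {x. \<rho>' < dist x p}" using that \<open>\<rho>' < \<rho>\<close> by (simp add: dist_commute)
  qed (use supp in force)
  have \<zeta>supp: "\<zeta> x = 0" if "x \<notin> ball p \<rho>" for x
    using that \<open>\<rho>' < \<rho>\<close> supp by (simp add: dist_commute)
  have Kab: "integrable M (\<lambda>y. K n (x - y) *\<^sub>R g y)" if "integrable M g" for n x and g :: "state \<Rightarrow> 'b::euclidean_space"
    using integrable_k_scale[OF that] .
  \<comment> \<open>These are the averages without the cutoff; the factors \<zeta> and
    \<open>kgrad \<zeta>\<close>, together with \<open>outside\<close>, restore it.\<close>
  define KF where "KF n x = (LINT y|M. K n (x - y) *\<^sub>R F y)" for n x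
  define KG where "KG n x = (LINT y|M. K n (x - y) *\<^sub>R G y)" for n x
  have ident: "\<kappa> * (LINT x|M. (\<zeta> x *\<^sub>R F x) \<bullet> KF n x)
      = - ((LINT x|M. (\<zeta> x *\<^sub>R \<Phi> x) \<bullet> KG n x) + (LINT x|M. (\<Phi> x \<bullet> kgrad \<zeta> x) \<bullet> KF n x))" for n
  proof -
    obtain B1 where B1: "B1 \<ge> 0" "\<And>x. x \<in> U \<Longrightarrow> norm (\<zeta> x) \<le> B1" using continuous_norm_bounded_on[OF cont\<zeta> bounded_U] by blast
    obtain B2 where B2: "B2 \<ge> 0" "\<And>x. x \<in> U \<Longrightarrow> norm (kgrad \<zeta> x) \<le> B2" using continuous_norm_bounded_on[OF contg\<zeta> bounded_U] by blast
    obtain B3 where B3: "B3 \<ge> 0" "\<And>x y. x \<in> U \<Longrightarrow> y \<in> U \<Longrightarrow> norm (K n (x - y)) \<le> B3"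
      using bounded_on_differences[OF contK[of n]] by blast
    obtain B4 where B4: "B4 \<ge> 0" "\<And>x y. x \<in> U \<Longrightarrow> y \<in> U \<Longrightarrow> norm (kgrad (K n) (x - y)) \<le> B4"
      using bounded_on_differences[OF contgK[of n]] by blast
    let ?g = "\<lambda>x y. \<zeta> x *\<^sub>R kgrad (K n) (x - y) + K n (x - y) *\<^sub>R kgrad \<zeta> x"
    \<comment> \<open>As a function of \<open>x\<close> the product need not vanish near the
      boundary of \<open>U\<close>; \<open>weak_eq\<close> admits it all the same.\<close>
    have tested: "\<kappa> * (LINT x|M. F x * (\<zeta> x * K n (x - y))) = - (LINT x|M. \<Phi> x \<bullet> ?g x y)" for y
      using weak_eq[OF smooth_mult[OF \<zeta> smooth_translate[OF K[of n], of y]]]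
      by (simp add: kgrad_mult[OF \<zeta> smooth_translate[OF K]] kgrad_translate(1)[OF K])
    have int1: "integrable (M \<Otimes>\<^sub>M M) (\<lambda>(x, y). F x * (\<zeta> x * K n (x - y)) * F y)"
    proof (rule Bochner_Integration.integrable_bound)
      show "integrable (M \<Otimes>\<^sub>M M) (\<lambda>z. (B1 * B3 * norm (F (fst z))) * norm (F (snd z)))"
        by (rule integrable_prod_mult) (use integrable_F in \<open>auto intro: sigma_finite_measure_axioms\<close>)
      show "(\<lambda>(x, y). F x * (\<zeta> x * K n (x - y)) * F y) \<in> borel_measurable (M \<Otimes>\<^sub>M M)"
        unfolding case_prod_beta by measurable
      have "norm (F x * (\<zeta> x * K n (x - y)) * F y) \<le> norm ((B1 * B3 * norm (F x)) * norm (F y))" for x y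
      proof (cases "x \<in> U \<and> y \<in> U")
        case True
        have "\<bar>\<zeta> x\<bar> * \<bar>K n (x - y)\<bar> \<le> B1 * B3"
          using B1 B3 True by (intro mult_mono) auto
        then have "(\<bar>\<zeta> x\<bar> * \<bar>K n (x - y)\<bar>) * (\<bar>F x\<bar> * \<bar>F y\<bar>) \<le> (B1 * B3) * (\<bar>F x\<bar> * \<bar>F y\<bar>)"
          by (intro mult_right_mono) auto
        then show ?thesis using B1 B3 by (simp add: abs_mult ac_simps)
      qed (use outside[of x] outside[of y] in auto)
      then show "AE z in M \<Otimes>\<^sub>M M. norm (case z of (x, y) \<Rightarrow> F x * (\<zeta> x * K n (x - y)) * F y)
          \<le> norm ((B1 * B3 * norm (F (fst z))) * norm (F (snd z)))" by (auto simp: case_prod_beta)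
    qed
    have int2: "integrable (M \<Otimes>\<^sub>M M) (\<lambda>(x, y). (\<Phi> x \<bullet> ?g x y) * F y)"
    proof (rule Bochner_Integration.integrable_bound)
      let ?B = "B1 * B4 + B3 * B2"
      show "integrable (M \<Otimes>\<^sub>M M) (\<lambda>z. (?B * norm (\<Phi> (fst z))) * norm (F (snd z)))"
        by (rule integrable_prod_mult) (use integrable_F integrable_\<Phi> in \<open>auto intro: sigma_finite_measure_axioms\<close>)
      show "(\<lambda>(x, y). (\<Phi> x \<bullet> ?g x y) * F y) \<in> borel_measurable (M \<Otimes>\<^sub>M M)"
        unfolding case_prod_beta by measurable
      have "norm ((\<Phi> x \<bullet> ?g x y) * F y) \<le> norm ((?B * norm (\<Phi> x)) * norm (F y))" for x y
      proof (cases "x \<in> U \<and> y \<in> U")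
        case True
        have "norm (?g x y) \<le> norm (\<zeta> x) * norm (kgrad (K n) (x - y)) + norm (K n (x - y)) * norm (kgrad \<zeta> x)"
          by (rule order_trans[OF norm_triangle_ineq]) simp
        also have "\<dots> \<le> ?B"
          using B1 B2 B3 B4 True by (intro add_mono mult_mono) auto
        finally have "norm (\<Phi> x) * norm (?g x y) \<le> norm (\<Phi> x) * ?B" by (intro mult_left_mono) auto
        then have "\<bar>\<Phi> x \<bullet> ?g x y\<bar> \<le> ?B * norm (\<Phi> x)"
          using Cauchy_Schwarz_ineq2[of "\<Phi> x" "?g x y"] by (simp add: mult.commute)
        then have "\<bar>\<Phi> x \<bullet> ?g x y\<bar> * \<bar>F y\<bar> \<le> ?B * norm (\<Phi> x) * \<bar>F y\<bar>" by (intro mult_right_mono) auto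
        also have "\<dots> \<le> norm ((?B * norm (\<Phi> x)) * norm (F y))" using abs_ge_self by simp
        finally show ?thesis by (simp add: abs_mult)
      qed (use outside[of x] outside[of y] in auto)
      then show "AE z in M \<Otimes>\<^sub>M M. norm (case z of (x, y) \<Rightarrow> (\<Phi> x \<bullet> ?g x y) * F y)
          \<le> norm ((?B * norm (\<Phi> (fst z))) * norm (F (snd z)))" by (auto simp: case_prod_beta)
    qed
    have "\<kappa> * (LINT x|M. (\<zeta> x *\<^sub>R F x) \<bullet> KF n x)
        = \<kappa> * (LINT x|M. (LINT y|M. F x * (\<zeta> x * K n (x - y)) * F y))"
      by (simp add: KF_def ac_simps flip: integral_mult_right_zero)
    also have "\<dots> = \<kappa> * (LINT y|M. (LINT x|M. F x * (\<zeta> x * K n (x - y)) * F y))"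
      using MM.Fubini_integral[OF int1] by simp
    also have "\<dots> = (LINT y|M. (\<kappa> * (LINT x|M. F x * (\<zeta> x * K n (x - y)))) * F y)"
      by (simp flip: integral_mult_right_zero mult.assoc)
    also have "\<dots> = - (LINT y|M. (LINT x|M. (\<Phi> x \<bullet> ?g x y) * F y))"
      unfolding tested by simp
    also have "(LINT y|M. (LINT x|M. (\<Phi> x \<bullet> ?g x y) * F y)) = (LINT x|M. (LINT y|M. (\<Phi> x \<bullet> ?g x y) * F y))"
      using MM.Fubini_integral[OF int2] .
    also have "\<dots> = (LINT x|M. (\<zeta> x *\<^sub>R \<Phi> x) \<bullet> KG n x + (\<Phi> x \<bullet> kgrad \<zeta> x) \<bullet> KF n x)"
    proof (rule Bochner_Integration.integral_cong[OF refl])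
      fix x
      show "(LINT y|M. (\<Phi> x \<bullet> ?g x y) * F y) = (\<zeta> x *\<^sub>R \<Phi> x) \<bullet> KG n x + (\<Phi> x \<bullet> kgrad \<zeta> x) \<bullet> KF n x"
      \<comment> \<open>Compact support of the kernel in \<open>y\<close> is available only for
        \<open>x\<close> in \<open>?V\<close>. Elsewhere either the flux is zero or both \<zeta> and
        its gradient are.\<close>
      proof (cases "x \<in> ?V")
        case False
        then have "\<Phi> x = 0 \<or> (\<zeta> x = 0 \<and> kgrad \<zeta> x = 0)"
          using \<zeta>supp[of x] gsupp[of x] outside(2)[of x] by blast
        then show ?thesis by (elim disjE conjE) simp_all
      next
        case True
        then have xU: "x \<in> U" by simp
        from Ksupp[OF True]
        obtain C where "compact C \<and> C \<subseteq> U \<and> (\<forall>y\<in>U - C. K n (x - y) = 0)" by (rule exE)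
        then have C: "compact C" "C \<subseteq> U" "\<And>y. y \<in> U - C \<Longrightarrow> K n (x - y) = 0" by simp_all
        \<comment> \<open>The minus sign from differentiating the reflected kernel cancels the one
          in \<open>weak_grad\<close>.\<close>
        have wg: "(LINT y|M. F y *\<^sub>R kgrad (K n) (x - y)) = KG n x"
          using weak_grad[OF smooth_reflect[OF K[of n]] C] unfolding kgrad_translate(2)[OF K] KG_def
          by simp
        have i1: "integrable M (\<lambda>y. F y *\<^sub>R kgrad (K n) (x - y))"
        proof (rule Bochner_Integration.integrable_bound)
          show "integrable M (\<lambda>y. B4 * norm (F y))" using integrable_F by simp
          have "norm (F y *\<^sub>R kgrad (K n) (x - y)) \<le> norm (B4 * norm (F y))" for y
          proof (cases "y \<in> U")
            case True
            from mult_left_mono[OF B4(2)[OF xU True] abs_ge_zero[of "F y"]]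
            show ?thesis using B4(1) by (simp add: mult.commute)
          qed (simp add: outside)
          then show "AE y in M. norm (F y *\<^sub>R kgrad (K n) (x - y)) \<le> norm (B4 * norm (F y))" by simp
        qed measurable
        have "(LINT y|M. (\<Phi> x \<bullet> ?g x y) * F y)
            = (LINT y|M. (\<zeta> x *\<^sub>R \<Phi> x) \<bullet> (F y *\<^sub>R kgrad (K n) (x - y)) + (\<Phi> x \<bullet> kgrad \<zeta> x) * (K n (x - y) *\<^sub>R F y))"
          by (rule Bochner_Integration.integral_cong) (auto simp: algebra_simps inner_add_right)
        also have "\<dots> = (\<zeta> x *\<^sub>R \<Phi> x) \<bullet> (LINT y|M. F y *\<^sub>R kgrad (K n) (x - y)) + (\<Phi> x \<bullet> kgrad \<zeta> x) * KF n x"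
          unfolding KF_def
          by (subst Bochner_Integration.integral_add)
            (use i1 Kab[OF integrable_F, of n x] in \<open>auto simp del: inner_scaleR_left inner_scaleR_right real_scaleR_def mult_scaleR_right\<close>)
        finally show ?thesis by (simp add: wg)
      qed
    qed
    also have "\<dots> = (LINT x|M. (\<zeta> x *\<^sub>R \<Phi> x) \<bullet> KG n x) + (LINT x|M. (\<Phi> x \<bullet> kgrad \<zeta> x) \<bullet> KF n x)"
    proof (rule Bochner_Integration.integral_add)
      \<comment> \<open>The weight is zero off \<open>?V\<close>, so \<open>avg n G\<close> may take
        the place of \<open>KG n\<close>, and the L^2 contraction gives integrability.\<close>
      have "(\<zeta> x *\<^sub>R \<Phi> x) \<bullet> KG n x = (\<zeta> x *\<^sub>R \<Phi> x) \<bullet> avg n G x" for x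
        using \<zeta>supp[of x] outside(2)[of x]
        by (cases "x \<in> U"; cases "x \<in> ball p \<rho>") (simp_all add: avg_def KG_def)
      moreover have "integrable M (\<lambda>x. (\<zeta> x *\<^sub>R \<Phi> x) \<bullet> avg n G x)"
        by (rule integrable_inner_square)
          (use square_integrable_scale[OF cont\<zeta> \<Phi> \<Phi>2 outside(2)] avg_contraction_L2(1)[OF G G2] in auto)
      ultimately show "integrable M (\<lambda>x. (\<zeta> x *\<^sub>R \<Phi> x) \<bullet> KG n x)" by (simp only:)
      have "(\<Phi> x \<bullet> kgrad \<zeta> x) \<bullet> KF n x = (\<Phi> x \<bullet> kgrad \<zeta> x) \<bullet> avg n F x" for x
        using gsupp[of x] outside(2)[of x]
        by (cases "x \<in> U"; cases "x \<in> ball p \<rho>") (simp_all add: avg_def KF_def)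
      moreover have "integrable M (\<lambda>x. (\<Phi> x \<bullet> kgrad \<zeta> x) \<bullet> avg n F x)"
        by (rule integrable_inner_square)
          (use square_integrable_inner[OF contg\<zeta> \<Phi> \<Phi>2 outside(2)] avg_contraction_L2(1)[OF F F2] in auto)
      ultimately show "integrable M (\<lambda>x. (\<Phi> x \<bullet> kgrad \<zeta> x) \<bullet> KF n x)" by (simp only:)
    qed
    finally show ?thesis .
  qed
  have lim1: "(\<lambda>n. LINT x|M. (\<zeta> x *\<^sub>R F x) \<bullet> KF n x) \<longlonglongrightarrow> (LINT x|M. (\<zeta> x *\<^sub>R F x) \<bullet> F x)"
    unfolding KF_def
    by (rule avg_tendsto_inner[OF F _ F2])
      (use square_integrable_scale[OF cont\<zeta> F F2 outside(1)] \<zeta>supp outside in auto)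
  have lim2: "(\<lambda>n. LINT x|M. (\<zeta> x *\<^sub>R \<Phi> x) \<bullet> KG n x) \<longlonglongrightarrow> (LINT x|M. (\<zeta> x *\<^sub>R \<Phi> x) \<bullet> G x)"
    unfolding KG_def
    by (rule avg_tendsto_inner[OF G _ G2])
      (use square_integrable_scale[OF cont\<zeta> \<Phi> \<Phi>2 outside(2)] \<zeta>supp outside in auto)
  have lim3: "(\<lambda>n. LINT x|M. (\<Phi> x \<bullet> kgrad \<zeta> x) \<bullet> KF n x) \<longlonglongrightarrow> (LINT x|M. (\<Phi> x \<bullet> kgrad \<zeta> x) \<bullet> F x)"
    unfolding KF_def
    by (rule avg_tendsto_inner[OF F _ F2])
      (use square_integrable_inner[OF contg\<zeta> \<Phi> \<Phi>2 outside(2)] gsupp outside in auto)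
  \<comment> \<open>Both sides of \<open>ident\<close> converge as the kernels concentrate;
    uniqueness of limits removes the mollification.\<close>
  have "\<kappa> * (LINT x|M. (\<zeta> x *\<^sub>R F x) \<bullet> F x)
     = - ((LINT x|M. (\<zeta> x *\<^sub>R \<Phi> x) \<bullet> G x) + (LINT x|M. (\<Phi> x \<bullet> kgrad \<zeta> x) \<bullet> F x))"
    using tendsto_mult_left[OF lim1, of \<kappa>] tendsto_minus[OF tendsto_add[OF lim2 lim3]]
    unfolding ident by (rule LIMSEQ_unique)
  also have "(LINT x|M. (\<zeta> x *\<^sub>R \<Phi> x) \<bullet> G x) + (LINT x|M. (\<Phi> x \<bullet> kgrad \<zeta> x) \<bullet> F x)
      = (LINT x|M. (\<zeta> x *\<^sub>R \<Phi> x) \<bullet> G x + (\<Phi> x \<bullet> kgrad \<zeta> x) \<bullet> F x)"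
    by (rule Bochner_Integration.integral_add[symmetric]; rule integrable_inner_square)
      (use square_integrable_inner[OF contg\<zeta> \<Phi> \<Phi>2 outside(2)] F2 G2
         square_integrable_scale[OF cont\<zeta> \<Phi> \<Phi>2 outside(2)] in auto)
  also have "\<dots> = (LINT x|M. \<Phi> x \<bullet> (F x *\<^sub>R kgrad \<zeta> x + \<zeta> x *\<^sub>R G x))"
    by (rule Bochner_Integration.integral_cong) (auto simp: inner_add_right)
  finally show ?thesis by (simp add: energy_identity_def power2_eq_square ac_simps)
qed

lemma energy_integrable:
  assumes \<zeta>: "smooth \<zeta>"
  shows "integrable M (\<lambda>x. \<zeta> x * (F x)\<^sup>2)" "integrable M (\<lambda>x. \<Phi> x \<bullet> (F x *\<^sub>R kgrad \<zeta> x + \<zeta> x *\<^sub>R G x))"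
proof -
  have cont\<zeta>: "continuous_on UNIV \<zeta>" by (rule smooth_continuous_on[OF \<zeta>])
  have contg\<zeta>: "continuous_on UNIV (kgrad \<zeta>)" by (rule continuous_on_kgrad[OF \<zeta>])
  have [measurable]: "\<zeta> \<in> borel_measurable borel" "kgrad \<zeta> \<in> borel_measurable borel"
    using cont\<zeta> contg\<zeta> by (auto intro: borel_measurable_continuous_onI)
  have "integrable M (\<lambda>x. (\<zeta> x *\<^sub>R F x) \<bullet> F x)"
    by (rule integrable_inner_square) (use square_integrable_scale[OF cont\<zeta> F F2 outside(1)] F2 in auto)
  then show "integrable M (\<lambda>x. \<zeta> x * (F x)\<^sup>2)" by (simp add: power2_eq_square ac_simps)
  have "integrable M (\<lambda>x. (\<zeta> x *\<^sub>R \<Phi> x) \<bullet> G x)" "integrable M (\<lambda>x. (\<Phi> x \<bullet> kgrad \<zeta> x) \<bullet> F x)"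
    by (rule integrable_inner_square;
       use square_integrable_inner[OF contg\<zeta> \<Phi> \<Phi>2 outside(2)] F2 G2
         square_integrable_scale[OF cont\<zeta> \<Phi> \<Phi>2 outside(2)] in auto)+
  then have "integrable M (\<lambda>x. (\<zeta> x *\<^sub>R \<Phi> x) \<bullet> G x + (\<Phi> x \<bullet> kgrad \<zeta> x) \<bullet> F x)" by simp
  then show "integrable M (\<lambda>x. \<Phi> x \<bullet> (F x *\<^sub>R kgrad \<zeta> x + \<zeta> x *\<^sub>R G x))"
    by (simp add: inner_add_right ac_simps)
qed

lemma energy_identity_add:
  assumes u: "smooth u" "energy_identity u" and v: "smooth v" "energy_identity v"
  shows "energy_identity (\<lambda>x. u x + v x)"
proof -
  have "(LINT x|M. (u x + v x) * (F x)\<^sup>2) = (LINT x|M. u x * (F x)\<^sup>2) + (LINT x|M. v x * (F x)\<^sup>2)"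
    using energy_integrable(1)[OF u(1)] energy_integrable(1)[OF v(1)] by (simp add: distrib_right)
  moreover have "\<Phi> x \<bullet> (F x *\<^sub>R kgrad (\<lambda>x. u x + v x) x + (u x + v x) *\<^sub>R G x)
      = \<Phi> x \<bullet> (F x *\<^sub>R kgrad u x + u x *\<^sub>R G x) + \<Phi> x \<bullet> (F x *\<^sub>R kgrad v x + v x *\<^sub>R G x)" for x
    by (simp add: kgrad_add u v algebra_simps)
  ultimately show ?thesis
    using u(2) v(2) energy_integrable(2)[OF u(1)] energy_integrable(2)[OF v(1)]
    by (simp add: energy_identity_def distrib_left)
qed

lemma energy_equality:
  assumes moll: "\<And>p. p \<in> closure U \<Longrightarrow> \<exists>\<rho>>0. mollifiable M U p \<rho>"
  shows "\<kappa> * (LINT x|M. (F x)\<^sup>2) = - (LINT x|M. \<Phi> x \<bullet> G x)"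
proof -
  \<comment> \<open>Value 1 up to \<rho>/4 yields the finite cover; value 0 from \<rho>/2 on leaves
    the margin that \<open>energy_identity_local\<close> requires.\<close>
  have "\<exists>\<rho> b. \<rho> > 0 \<and> mollifiable M U p \<rho> \<and> smooth b \<and> (\<forall>x. dist x p < \<rho> / 4 \<longrightarrow> b x = (1::real)) \<and>
      (\<forall>x. \<rho> / 2 \<le> dist x p \<longrightarrow> b x = 0)" if p: "p \<in> closure U" for p
  proof -
    obtain \<rho> where \<rho>: "\<rho> > 0" "mollifiable M U p \<rho>" using moll[OF p] by blast
    obtain b where "smooth b" "\<And>x. dist x p < \<rho> / 2 / 2 \<Longrightarrow> b x = (1::real)" "\<And>x. \<rho> / 2 \<le> dist x p \<Longrightarrow> b x = 0"
      using smooth_plateau[of "\<rho> / 2" p] \<rho>(1) by auto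
    then show ?thesis using \<rho> by (intro exI[of _ \<rho>] exI[of _ b]) auto
  qed
  then have "\<forall>p\<in>closure U. \<exists>\<rho> b. \<rho> > 0 \<and> mollifiable M U p \<rho> \<and> smooth b \<and>
      (\<forall>x. dist x p < \<rho> / 4 \<longrightarrow> b x = (1::real)) \<and> (\<forall>x. \<rho> / 2 \<le> dist x p \<longrightarrow> b x = 0)" by blast
  from bchoice[OF this] obtain \<rho> where "\<forall>p\<in>closure U. \<exists>b. \<rho> p > 0 \<and> mollifiable M U p (\<rho> p) \<and> smooth b \<and>
      (\<forall>x. dist x p < \<rho> p / 4 \<longrightarrow> b x = (1::real)) \<and> (\<forall>x. \<rho> p / 2 \<le> dist x p \<longrightarrow> b x = 0)" by blast
  from bchoice[OF this] obtain b
    where \<rho>: "\<And>p. p \<in> closure U \<Longrightarrow> \<rho> p > (0::real)" "\<And>p. p \<in> closure U \<Longrightarrow> mollifiable M U p (\<rho> p)"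
    and b: "\<And>p. p \<in> closure U \<Longrightarrow> smooth (b p)"
      "\<And>p x. p \<in> closure U \<Longrightarrow> dist x p < \<rho> p / 4 \<Longrightarrow> b p x = (1::real)"
      "\<And>p x. p \<in> closure U \<Longrightarrow> \<rho> p / 2 \<le> dist x p \<Longrightarrow> b p x = 0"
    by blast
  have "compact (closure U)" using bounded_U by simp
  then obtain T where T: "T \<subseteq> closure U" "finite T" "closure U \<subseteq> (\<Union>p\<in>T. ball p (\<rho> p / 4))"
    by (rule compactE_image[of _ "closure U" "\<lambda>p. ball p (\<rho> p / 4)"]) (use \<rho>(1) in force)+
  have sm: "smooth (\<lambda>x. \<Prod>p\<in>S. 1 - b p x)" if "S \<subseteq> closure U" "finite S" for S
    by (rule smooth_prod[OF that(2)], rule smooth_minus[OF smooth_const]) (use that b(1) in blast)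
  have en: "energy_identity (\<lambda>x. 1 - (\<Prod>p\<in>S. 1 - b p x))" if "S \<subseteq> closure U" "finite S" for S
    using that(2,1)
  proof (induction S rule: finite_induct)
    case empty
    show ?case by (simp add: energy_identity_def kgrad_const)
  next
    case (insert q S)
    have q: "q \<in> closure U" and S: "S \<subseteq> closure U" using insert by auto
    let ?P = "\<lambda>x. \<Prod>p\<in>S. 1 - b p x"
    have "energy_identity (\<lambda>x. b q x * ?P x)"
      by (rule energy_identity_local[OF \<rho>(2)[OF q], of _ "\<rho> q / 2"])
        (use smooth_mult[OF b(1)[OF q] sm[OF S insert(1)]] \<rho>(1)[OF q] b(3)[OF q] in auto)
    then have "energy_identity (\<lambda>x. (1 - ?P x) + b q x * ?P x)"
      by (intro energy_identity_add insert.IH S smooth_minus smooth_const sm[OF S insert(1)]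
          smooth_mult[OF b(1)[OF q] sm[OF S insert(1)]])
    moreover have "(1 - ?P x) + b q x * ?P x = 1 - (\<Prod>p\<in>insert q S. 1 - b p x)" for x
      using insert(1,2) by (simp add: algebra_simps)
    ultimately show ?case by simp
  qed
  let ?Z = "\<lambda>x. 1 - (\<Prod>p\<in>T. 1 - b p x)"
  let ?O = "\<Union>p\<in>T. ball p (\<rho> p / 4)"
  have one: "?Z x = 1" if "x \<in> ?O" for x
  proof -
    obtain p where "p \<in> T" "x \<in> ball p (\<rho> p / 4)" using \<open>x \<in> ?O\<close> by blast
    then have p: "p \<in> T" "dist x p < \<rho> p / 4" by (simp_all add: dist_commute)
    then have "1 - b p x = 0" using b(2)[of p x] T(1) by auto
    then show ?thesis using p(1) T(2) by (simp add: prod_zero_iff) blast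
  qed
  have sub: "x \<in> ?O" if "x \<in> U" for x using that T(3) closure_subset by blast
  \<comment> \<open>The cutoff is constant on an open set containing \<open>U\<close>, so its
    gradient term drops out of the identity.\<close>
  have "kgrad ?Z x = 0" if "x \<in> U" for x
    by (rule kgrad_locally_const[of ?O]) (use one sub[OF that] in auto)
  then have "\<Phi> x \<bullet> (F x *\<^sub>R kgrad ?Z x + ?Z x *\<^sub>R G x) = \<Phi> x \<bullet> G x" "?Z x * (F x)\<^sup>2 = (F x)\<^sup>2" for x
    using one[OF sub] outside[of x] by (cases "x \<in> U"; simp)+
  with en[OF T(1,2)] show ?thesis by (simp only: energy_identity_def)
qed

text \<open>The gradient is absorbed by the coercive term, leaving \<kappa> times the integral of
  F^2 bounded by V^2/(4c) times the same integral; the strict inequality for \<kappa> forces it to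
  be zero.\<close>

lemma solution_zero:
  assumes moll: "\<And>p. p \<in> closure U \<Longrightarrow> \<exists>\<rho>>0. mollifiable M U p \<rho>"
    and coercive: "AE x in M. \<Phi> x \<bullet> G x \<ge> c * (norm (G x))\<^sup>2 - V * \<bar>F x\<bar> * norm (G x)"
    and c: "c > 0" and \<kappa>: "\<kappa> > V\<^sup>2 / (4 * c)"
  shows "AE x in M. F x = 0"
proof -
  let ?I = "LINT x|M. (F x)\<^sup>2"
  have F2': "integrable M (\<lambda>x. (F x)\<^sup>2)" using F2 by simp
  have "(LINT x|M. - (\<Phi> x \<bullet> G x)) \<le> (LINT x|M. V\<^sup>2 / (4 * c) * (F x)\<^sup>2)"
  proof (rule integral_mono_AE)
    show "integrable M (\<lambda>x. - (\<Phi> x \<bullet> G x))"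
      using integrable_inner_square[OF \<Phi> G \<Phi>2 G2] by simp
    show "integrable M (\<lambda>x. V\<^sup>2 / (4 * c) * (F x)\<^sup>2)" using F2' by simp
    \<comment> \<open>Completing the square in \<open>g\<close>; equality occurs at g = V|f|/(2c),
      which is where the threshold comes from.\<close>
    have "V * \<bar>f\<bar> * g - c * g\<^sup>2 \<le> V\<^sup>2 / (4 * c) * f\<^sup>2" for f g :: real
    proof -
      have "0 \<le> (2 * c * g - V * \<bar>f\<bar>)\<^sup>2" by simp
      then have "4 * c * (V * \<bar>f\<bar> * g - c * g\<^sup>2) \<le> V\<^sup>2 * f\<^sup>2"
        by (simp add: power2_diff power_mult_distrib algebra_simps power2_eq_square)
      then show ?thesis using c by (simp add: field_simps)
    qed
    note bd = this
    show "AE x in M. - (\<Phi> x \<bullet> G x) \<le> V\<^sup>2 / (4 * c) * (F x)\<^sup>2"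
      using coercive
    proof eventually_elim
      case (elim x)
      then show ?case using bd[of "F x" "norm (G x)"] by linarith
    qed
  qed
  then have "\<kappa> * ?I \<le> V\<^sup>2 / (4 * c) * ?I" using energy_equality[OF moll] by simp
  then have "\<not> 0 < ?I"
    using mult_strict_right_mono[OF \<kappa>, of ?I] by linarith
  moreover have "0 \<le> ?I" by (rule integral_nonneg_AE) simp
  ultimately have "?I = 0" by (rule order.antisym[OF leI])
  then have "AE x in M. (F x)\<^sup>2 = 0"
    using integral_nonneg_eq_0_iff_AE[OF F2'] by simp
  then show ?thesis by simp
qed

end

section \<open>The domain and its mollifiers\<close>

definition chart :: "(real^2) \<times> (real^2) \<Rightarrow> state" where
  "chart e = (plane_chart (fst e), snd e)"

definition plane_states :: "state set" where
  "plane_states = {x. fst x $ 1 + fst x $ 2 + fst x $ 3 = 0}"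

definition state_measure :: "state measure" where
  "state_measure = plane_measure \<Otimes>\<^sub>M lborel"

text \<open>A density on the whole space instead of a restricted space: the measurable sets stay the
  Borel sets, so smooth functions and translated kernels need no restriction, and functions are
  extended by zero.\<close>

definition domain_measure :: "(real^2) set \<Rightarrow> state measure" where
  "domain_measure D = density state_measure (indicator (misorientations \<times> D))"

lemma bounded_linear_plane_chart: "bounded_linear plane_chart"
  using linear_plane_chart linear_conv_bounded_linear by blast

lemma plane_chart_measurable [measurable]: "plane_chart \<in> borel_measurable borel"
  by (intro borel_measurable_continuous_onI linear_continuous_on bounded_linear_plane_chart)

lemma linear_chart: "linear chart"
  using linear_plane_chart by (intro linearI) (auto simp: chart_def linear_add linear_scale)

lemma norm_chart: "norm (chart e) = norm e"
  by (cases e) (simp add: chart_def norm_Pair norm_plane_chart)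

lemma chart_diff: "chart e - chart e' = chart (e - e')"
  using linear_diff[OF linear_chart] by simp

lemma chart_measurable [measurable]: "chart \<in> borel_measurable borel"
  by (intro borel_measurable_continuous_onI linear_continuous_on)
    (use linear_chart linear_conv_bounded_linear in blast)

lemma range_chart: "range chart = plane_states"
proof -
  have "x \<in> range chart \<longleftrightarrow> fst x \<in> range plane_chart" for x
    by (cases x) (auto simp: chart_def image_iff)
  then show ?thesis unfolding range_plane_chart plane_states_def by blast
qed

lemma closed_plane_states: "closed plane_states"
  unfolding plane_states_def by (intro closed_Collect_eq continuous_intros)

lemma sets_plane_measure [measurable_cong, simp]: "sets plane_measure = sets borel"
  by (simp add: plane_measure_def)

text \<open>Images of sigma-finite measures can fail to be sigma-finite. Here the chart is
  isometric, so preimages of centred balls are balls of the same radius and have finite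
  measure.\<close>

lemma sigma_finite_plane_measure: "sigma_finite_measure plane_measure"
proof
  let ?A = "range (\<lambda>n::nat. ball (0::real^3) (real n))"
  have "emeasure plane_measure (ball 0 (real n)) \<noteq> \<infinity>" for n :: nat
  proof -
    have "plane_chart -` ball 0 (real n) = ball 0 (real n)"
      by (auto simp: norm_plane_chart)
    then show ?thesis
      unfolding plane_measure_def using emeasure_lborel_ball_finite[of "0::real^2" "real n"]
      by (subst emeasure_distr) auto
  qed
  moreover have "\<Union>?A = UNIV"
    using reals_Archimedean2 by (auto simp: dist_norm)
  ultimately show "\<exists>A. countable A \<and> A \<subseteq> sets plane_measure \<and> \<Union>A = space plane_measure \<and>
      (\<forall>a\<in>A. emeasure plane_measure a \<noteq> \<infinity>)"
    by (intro exI[of _ ?A]) (auto simp: plane_measure_def)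
qed

interpretation plane_measure: sigma_finite_measure plane_measure
  by (rule sigma_finite_plane_measure)

interpretation plane_lborel: pair_sigma_finite plane_measure "lborel :: (real^2) measure" ..

lemma sets_state_measure [measurable_cong, simp]: "sets state_measure = sets borel"
  unfolding state_measure_def by (simp add: borel_prod[symmetric] cong: sets_pair_measure_cong)

lemma space_state_measure [simp]: "space state_measure = UNIV"
  using sets_eq_imp_space_eq[OF sets_state_measure] by simp

text \<open>Presents the measure as the image of Lebesgue measure on R^4, from which translation
  invariance and positivity on relatively open balls are inherited.\<close>

lemma state_measure_eq_distr: "state_measure = distr lborel borel chart"
proof -
  have "state_measure = distr lborel borel plane_chart \<Otimes>\<^sub>M distr lborel borel (\<lambda>x::real^2. x)"
    by (simp add: state_measure_def plane_measure_def distr_id2)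
  also have "\<dots> = distr (lborel \<Otimes>\<^sub>M lborel) (borel \<Otimes>\<^sub>M borel) (\<lambda>(p, a). (plane_chart p, a))"
    by (rule pair_measure_distr)
      (auto simp: distr_id2 lborel.sigma_finite_measure_axioms)
  also have "(\<lambda>(p, a). (plane_chart p, a)) = chart" by (auto simp: chart_def)
  finally show ?thesis by (simp add: lborel_prod borel_prod)
qed

lemma sigma_finite_state_measure: "sigma_finite_measure state_measure"
  unfolding state_measure_def by (rule plane_lborel.sigma_finite_measure_axioms)

lemma AE_plane_states: "AE x in state_measure. x \<in> plane_states"
  unfolding state_measure_eq_distr
proof (subst AE_distr_iff)
  show "{x \<in> space borel. x \<in> plane_states} \<in> sets borel" using closed_plane_states by simp
  have "chart e \<in> plane_states" for e using range_chart by blast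
  then show "AE e in lborel. chart e \<in> plane_states" by simp
qed measurable

lemma misorientations_measurable [measurable]: "misorientations \<in> sets borel"
proof -
  have "misorientations = (\<Inter>j. {\<theta>. - pi/4 < \<theta>$j} \<inter> {\<theta>. \<theta>$j < pi/4}) \<inter> {\<theta>. \<theta>$1 + \<theta>$2 + \<theta>$3 = 0}"
    by (auto simp: misorientations_def)
  also have "\<dots> \<in> sets borel"
    by (intro sets.Int sets.finite_INT borel_open borel_closed open_Collect_less closed_Collect_eq continuous_intros) auto
  finally show ?thesis .
qed

lemma misorientations_bound: "\<theta> \<in> misorientations \<Longrightarrow> \<bar>\<theta>$j\<bar> < pi / 4"
  unfolding misorientations_def abs_less_iff by (drule CollectD) (metis minus_divide_left minus_less_iff)

lemma bounded_misorientations: "bounded misorientations"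
proof -
  have "norm \<theta> \<le> 3 * (pi / 4)" if "\<theta> \<in> misorientations" for \<theta>
  proof -
    have "norm \<theta> \<le> (\<Sum>j\<in>UNIV. \<bar>\<theta>$j\<bar>)" by (rule norm_le_l1_cart)
    also have "\<dots> \<le> (\<Sum>j\<in>(UNIV::3 set). pi / 4)"
      using misorientations_bound[OF that] by (intro sum_mono less_imp_le)
    finally show ?thesis by simp
  qed
  then show ?thesis unfolding bounded_iff by blast
qed

text \<open>A shift or reflection within the plane corresponds through \<open>chart\<close> to one
  of the parameter space, where Lebesgue measure is invariant. A shift leaving the plane has no such
  counterpart, hence the assumption on \<open>x\<close>.\<close>

lemma integral_state_measure_translate:
  fixes g :: "state \<Rightarrow> real"
  assumes [measurable]: "g \<in> borel_measurable borel" and x: "x \<in> plane_states"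
  shows "(LINT y|state_measure. g (x - y)) = (LINT z|state_measure. g z)"
    and "(LINT y|state_measure. g (y - x)) = (LINT z|state_measure. g z)"
    and "integrable state_measure g \<Longrightarrow> integrable state_measure (\<lambda>y. g (x - y))"
    and "integrable state_measure g \<Longrightarrow> integrable state_measure (\<lambda>y. g (y - x))"
proof -
  obtain e where e: "x = chart e" using x range_chart by blast
  have l1: "(lborel :: ((real^2) \<times> (real^2)) measure) = distr lborel borel (\<lambda>z. e - z)"
    using lborel_affine[of "-1" e] by (simp add: density_1)
  have l2: "(lborel :: ((real^2) \<times> (real^2)) measure) = distr lborel borel (\<lambda>z. z - e)"
    using lborel_affine[of 1 "- e"] by (simp add: density_1)
  have g: "(\<lambda>z. g (chart z)) \<in> borel_measurable borel" by measurable
  show "(LINT y|state_measure. g (x - y)) = (LINT z|state_measure. g z)"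
    using integral_distr[of "\<lambda>z. e - z" lborel borel "\<lambda>z. g (chart z)"] g l1[symmetric]
    by (simp add: state_measure_eq_distr integral_distr e chart_diff)
  show "(LINT y|state_measure. g (y - x)) = (LINT z|state_measure. g z)"
    using integral_distr[of "\<lambda>z. z - e" lborel borel "\<lambda>z. g (chart z)"] g l2[symmetric]
    by (simp add: state_measure_eq_distr integral_distr e chart_diff)
  show "integrable state_measure (\<lambda>y. g (x - y))" if "integrable state_measure g"
    using integrable_distr_eq[of "\<lambda>z. e - z" lborel borel "\<lambda>z. g (chart z)"] g l1[symmetric] that
    by (simp add: state_measure_eq_distr integrable_distr_eq e chart_diff)
  show "integrable state_measure (\<lambda>y. g (y - x))" if "integrable state_measure g"
    using integrable_distr_eq[of "\<lambda>z. z - e" lborel borel "\<lambda>z. g (chart z)"] g l2[symmetric] that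
    by (simp add: state_measure_eq_distr integrable_distr_eq e chart_diff)
qed

lemma bump_measurable [measurable]: "bump p r \<in> borel_measurable borel"
  by (intro borel_measurable_continuous_onI smooth_continuous_on smooth_bump)

lemma bump_eq_0_iff: "r > 0 \<Longrightarrow> bump p r x = 0 \<longleftrightarrow> r \<le> dist x p"
  using bump_pos_iff[of r p x] bump_nonneg[of p r x] by auto

text \<open>With its centre in the plane, the bump is positive on the chart image of a full ball of
  R^4, so its mass can be normalised.\<close>

lemma bump_mass:
  assumes p: "p \<in> plane_states" and r: "r > 0"
  shows "integrable state_measure (bump p r)" "(LINT x|state_measure. bump p r x) > 0"
proof -
  obtain e where e: "p = chart e" using p range_chart by blast
  have eq: "bump p r (chart z) > 0 \<longleftrightarrow> z \<in> ball e r" for z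
    by (simp add: bump_pos_iff[OF r] e dist_norm chart_diff norm_chart norm_minus_commute)
  have fin: "emeasure lborel (ball e r) < \<infinity>" by (rule emeasure_lborel_ball_finite)
  have i: "integrable lborel (\<lambda>z. bump p r (chart z))"
  proof (rule Bochner_Integration.integrable_bound)
    show "integrable lborel (indicator (ball e r) :: _ \<Rightarrow> real)" using fin by simp
    have "\<bar>bump p r (chart z)\<bar> \<le> indicator (ball e r) z" for z
      using eq[of z] bump_nonneg[of p r "chart z"] bump_le_1[of p r "chart z"] by (auto simp: indicator_def)
    then show "AE z in lborel. norm (bump p r (chart z)) \<le> norm (indicator (ball e r) z :: real)" by simp
  qed measurable
  then show "integrable state_measure (bump p r)"
    by (simp add: state_measure_eq_distr integrable_distr_eq)
  have "(LINT z|lborel. bump p r (chart z)) \<noteq> 0"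
  proof
    assume "(LINT z|lborel. bump p r (chart z)) = 0"
    then have "AE z in lborel. bump p r (chart z) = 0"
      using integral_nonneg_eq_0_iff_AE[OF i AE_I2[OF bump_nonneg]] by blast
    then have "AE z in lborel. z \<notin> ball e r"
      by eventually_elim (use eq in force)
    then have "emeasure lborel (ball e r) = 0"
      by (subst (asm) AE_iff_measurable[of "ball e r"]) auto
    then have "ball e r \<in> null_sets lborel" by auto
    then show False using open_not_negligible[of "ball e r"] r
      by (auto simp: negligible_iff_null_sets null_sets_completionI)
  qed
  moreover have "(LINT z|lborel. bump p r (chart z)) \<ge> 0"
    by (rule integral_nonneg_AE) (simp add: bump_nonneg)
  ultimately show "(LINT x|state_measure. bump p r x) > 0"
    by (simp add: state_measure_eq_distr integral_distr)
qed

text \<open>Moving by \<delta> along the inward axis raises the height above the graph by \<delta>,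
  while a perturbation of size \<epsilon> costs less: uniform continuity of \<open>h\<close> on a
  compact interval bounds the change of the graph by \<delta>/2.\<close>

lemma C2_boundary_inward:
  fixes D :: "(real^2) set"
  assumes D: "open D" "C2_boundary D" and p: "p \<in> closure D"
  obtains r :: real and w :: "real^2" where "r > 0" "\<And>\<delta>. 0 < \<delta> \<Longrightarrow> \<delta> < r \<Longrightarrow>
      \<exists>\<epsilon>>0. \<forall>a\<in>D \<inter> ball p r. \<forall>z :: real^2. norm z \<le> \<epsilon> \<longrightarrow> a + \<delta> *\<^sub>R w - z \<in> D"
proof (cases "p \<in> D")
  case True
  then obtain r where r: "r > 0" "ball p r \<subseteq> D" using D(1) open_contains_ball by blast
  \<comment> \<open>At an interior point the zero shift suffices, because a whole ball is
    available.\<close>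
  show ?thesis
  proof (rule that[of "r/2" 0])
    fix \<delta> :: real
    show "\<exists>\<epsilon>>0. \<forall>a\<in>D \<inter> ball p (r/2). \<forall>z. norm z \<le> \<epsilon> \<longrightarrow> a + \<delta> *\<^sub>R 0 - z \<in> D"
    proof (intro exI[of _ "r/2"] conjI ballI allI impI)
      fix a z :: "real^2" assume a: "a \<in> D \<inter> ball p (r/2)" and z: "norm z \<le> r/2"
      have "dist p (a - z) \<le> dist p a + dist a (a - z)" by (rule dist_triangle)
      also have "\<dots> < r" using a z by (simp add: dist_norm)
      finally show "a + \<delta> *\<^sub>R 0 - z \<in> D" using r by auto
    qed (use r in simp)
  qed (use r in simp)
next
  case False
  then have "p \<in> frontier D" using p D(1) by (simp add: frontier_def interior_open)
  then obtain R u w h where R: "R > 0" and u: "norm u = 1" and w: "norm w = 1" and uw: "u \<bullet> w = 0"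
    and h: "class_C 2 h" and eq: "D \<inter> ball p R = {y \<in> ball p R. h (u \<bullet> y) < w \<bullet> y}"
    using D(2) unfolding C2_boundary_def by blast
  have "continuous_on UNIV h" by (rule class_C_imp_continuous[OF h])
  then have "uniformly_continuous_on (cball (u \<bullet> p) R) h"
    by (intro compact_uniformly_continuous) (auto intro: continuous_on_subset)
  note uc = this
  \<comment> \<open>With R/4 for the distance from \<open>p\<close>, for the shift and for the
    perturbation, the moved point stays in the ball of radius R where the graph description
    holds.\<close>
  show ?thesis
  proof (rule that[of "R/4" w])
    fix \<delta> :: real assume \<delta>: "0 < \<delta>" "\<delta> < R/4"
    obtain d where d: "d > 0" "\<And>s t. s \<in> cball (u \<bullet> p) R \<Longrightarrow> t \<in> cball (u \<bullet> p) R \<Longrightarrow> dist s t < d \<Longrightarrow> dist (h s) (h t) < \<delta> / 2"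
      using uc \<delta>(1) unfolding uniformly_continuous_on_def by (metis half_gt_zero)
    \<comment> \<open>R/4 keeps the point in the chart, d/2 stays below the modulus of continuity,
      and \<delta>/2 leaves a height gain of at least \<delta>/2.\<close>
    define \<epsilon> where "\<epsilon> = min (R/4) (min (d/2) (\<delta>/2))"
    have \<epsilon>: "0 < \<epsilon>" "\<epsilon> \<le> R/4" "\<epsilon> < d" "\<epsilon> \<le> \<delta>/2" using R d \<delta> by (auto simp: \<epsilon>_def min_def)
    show "\<exists>\<epsilon>>0. \<forall>a\<in>D \<inter> ball p (R/4). \<forall>z. norm z \<le> \<epsilon> \<longrightarrow> a + \<delta> *\<^sub>R w - z \<in> D"
    proof (intro exI[of _ \<epsilon>] conjI ballI allI impI)
      fix a z :: "real^2" assume a: "a \<in> D \<inter> ball p (R/4)" and z: "norm z \<le> \<epsilon>"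
      let ?y = "a + \<delta> *\<^sub>R w - z"
      have "a \<in> D \<inter> ball p R" using a R by simp
      then have ha: "h (u \<bullet> a) < w \<bullet> a" unfolding eq by simp
      have "norm (p - ?y) \<le> norm (p - a) + norm (\<delta> *\<^sub>R w) + norm z"
        using norm_triangle_ineq4[of "p - a" "\<delta> *\<^sub>R w"] norm_triangle_ineq[of "(p - a) - \<delta> *\<^sub>R w" z]
        by (simp add: algebra_simps)
      also have "\<dots> < R" using a z \<epsilon> \<delta> w by (simp add: dist_norm)
      finally have yb: "?y \<in> ball p R" by (simp add: dist_norm)
      have uz: "\<bar>u \<bullet> z\<bar> \<le> \<epsilon>" and wz: "\<bar>w \<bullet> z\<bar> \<le> \<epsilon>"
        using Cauchy_Schwarz_ineq2[of u z] Cauchy_Schwarz_ineq2[of w z] u w z by auto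
      have in_cball: "u \<bullet> y \<in> cball (u \<bullet> p) R" if "y \<in> ball p R" for y
        using Cauchy_Schwarz_ineq2[of u "p - y"] u that by (simp add: dist_norm inner_diff_right)
      have uy: "u \<bullet> ?y = u \<bullet> a - u \<bullet> z" using uw by (simp add: inner_diff_right inner_add_right)
      have "dist (u \<bullet> ?y) (u \<bullet> a) < d" using uz \<epsilon>(3) by (simp add: uy dist_real_def)
      then have "dist (h (u \<bullet> ?y)) (h (u \<bullet> a)) < \<delta> / 2"
        using d(2) in_cball[OF yb] in_cball[of a] a R by auto
      then have "h (u \<bullet> ?y) < h (u \<bullet> a) + \<delta> / 2" unfolding dist_real_def by linarith
      also have "\<dots> < w \<bullet> a + \<delta> / 2" using ha by simp
      also have "\<dots> \<le> w \<bullet> ?y"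
      proof -
        have "w \<bullet> w = 1" using w by (simp add: dot_square_norm)
        then have "w \<bullet> ?y = w \<bullet> a + \<delta> - w \<bullet> z" by (simp add: inner_diff_right inner_add_right)
        then show ?thesis using wz \<epsilon>(4) by simp
      qed
      finally have "?y \<in> D \<inter> ball p R" unfolding eq using yb by simp
      then show "?y \<in> D" by simp
    qed (rule \<epsilon>)
  qed (use R in simp)
qed

text \<open>The domain is a convex hexagon around the origin, so - p points inwards even at corners.
  Coordinatewise \<theta> - \<delta> p is (1 - \<delta>) \<theta> + \<delta> (\<theta> - p); since
  \<theta> - p is below pi/8 instead of pi/4, a slack of \<delta> pi/8 remains for
  \<open>z\<close>.\<close>

lemma misorientations_inward:
  assumes p: "p$1 + p$2 + p$3 = 0" and \<delta>: "0 < \<delta>" "\<delta> < 1"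
    and \<theta>: "\<theta> \<in> misorientations" "\<theta> \<in> ball p (pi/8)"
    and z: "norm z \<le> \<delta> * (pi/8)" "z$1 + z$2 + z$3 = 0"
  shows "\<theta> + \<delta> *\<^sub>R (- p) - z \<in> misorientations"
proof -
  have "- pi/4 < (\<theta> + \<delta> *\<^sub>R (- p) - z)$j \<and> (\<theta> + \<delta> *\<^sub>R (- p) - z)$j < pi/4" for j
  proof -
    have 1: "\<bar>\<theta>$j\<bar> < pi/4" by (rule misorientations_bound[OF \<theta>(1)])
    have "\<bar>(\<theta> - p)$j\<bar> \<le> norm (\<theta> - p)" by (rule component_le_norm_cart)
    then have 2: "\<bar>\<theta>$j - p$j\<bar> < pi/8" using \<theta>(2) by (simp add: dist_norm norm_minus_commute)
    have 3: "\<bar>z$j\<bar> \<le> \<delta> * (pi/8)" using component_le_norm_cart[of z j] z(1) by linarith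
    have "(\<theta> + \<delta> *\<^sub>R (- p) - z)$j = (1 - \<delta>) * \<theta>$j + \<delta> * (\<theta>$j - p$j) - z$j"
      by (simp add: algebra_simps)
    also have "\<bar>\<dots>\<bar> \<le> \<bar>(1 - \<delta>) * \<theta>$j\<bar> + \<bar>\<delta> * (\<theta>$j - p$j)\<bar> + \<bar>z$j\<bar>" by linarith
    also have "\<dots> = (1 - \<delta>) * \<bar>\<theta>$j\<bar> + \<delta> * \<bar>\<theta>$j - p$j\<bar> + \<bar>z$j\<bar>" using \<delta> by (simp add: abs_mult)
    also have "\<dots> < (1 - \<delta>) * (pi/4) + \<delta> * (pi/8) + \<delta> * (pi/8)"
      using 1 2 3 \<delta> by (intro add_less_le_mono add_strict_mono mult_strict_left_mono) auto
    also have "\<dots> = pi/4" by (simp add: field_simps)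
    finally show ?thesis by linarith
  qed
  moreover have "(\<theta> + \<delta> *\<^sub>R (- p) - z)$1 + (\<theta> + \<delta> *\<^sub>R (- p) - z)$2 + (\<theta> + \<delta> *\<^sub>R (- p) - z)$3 =
     (\<theta>$1 + \<theta>$2 + \<theta>$3) - \<delta> * (p$1 + p$2 + p$3) - (z$1 + z$2 + z$3)"
    by (simp add: algebra_simps)
  moreover have "\<theta>$1 + \<theta>$2 + \<theta>$3 = 0" using \<theta>(1) by (simp add: misorientations_def)
  ultimately show ?thesis using p z(2) by (simp add: misorientations_def)
qed



lemma domain_subset_plane_states: "misorientations \<times> D \<subseteq> plane_states"
  by (auto simp: misorientations_def plane_states_def)

lemma plane_states_add: "x \<in> plane_states \<Longrightarrow> y \<in> plane_states \<Longrightarrow> x + y \<in> plane_states"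
  and plane_states_diff: "x \<in> plane_states \<Longrightarrow> y \<in> plane_states \<Longrightarrow> x - y \<in> plane_states"
  and plane_states_scaleR: "x \<in> plane_states \<Longrightarrow> c *\<^sub>R x \<in> plane_states"
proof -
  have *: "c * s + c * t + c * u = c * (s + t + u)" for s t u :: real by (simp add: algebra_simps)
  show "x \<in> plane_states \<Longrightarrow> y \<in> plane_states \<Longrightarrow> x + y \<in> plane_states"
    and "x \<in> plane_states \<Longrightarrow> y \<in> plane_states \<Longrightarrow> x - y \<in> plane_states"
    and "x \<in> plane_states \<Longrightarrow> c *\<^sub>R x \<in> plane_states"
    by (simp_all add: plane_states_def *)
qed

text \<open>The inward directions of the two factors are combined into one. Perturbations are
  confined to \<open>plane_states\<close>, since a full ambient ball never lies in the
  domain.\<close>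

lemma domain_inward:
  assumes D: "open D" "C2_boundary D" and p: "p \<in> closure (misorientations \<times> D)"
  obtains r W where "r > 0" "W \<in> plane_states" "\<And>\<delta>. 0 < \<delta> \<Longrightarrow> \<delta> < r \<Longrightarrow>
      \<exists>\<epsilon>>0. \<forall>x\<in>(misorientations \<times> D) \<inter> ball p r. \<forall>z\<in>plane_states. norm z \<le> \<epsilon> \<longrightarrow>
        x + \<delta> *\<^sub>R W - z \<in> misorientations \<times> D"
proof -
  have p2: "snd p \<in> closure D" using p by (auto simp: closure_Times mem_Times_iff)
  have pp: "p \<in> plane_states"
    using closure_minimal[OF domain_subset_plane_states closed_plane_states] p by blast
  then have p1: "fst p $ 1 + fst p $ 2 + fst p $ 3 = 0" by (simp add: plane_states_def)
  obtain r w where r: "r > 0" "\<And>\<delta>. 0 < \<delta> \<Longrightarrow> \<delta> < r \<Longrightarrow>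
      \<exists>\<epsilon>>0. \<forall>a\<in>D \<inter> ball (snd p) r. \<forall>z. norm z \<le> \<epsilon> \<longrightarrow> a + \<delta> *\<^sub>R w - z \<in> D"
    using C2_boundary_inward[OF D p2] by blast
  \<comment> \<open>The bound 1 on \<delta> and the radius pi/8 are the requirements of
    \<open>misorientations_inward\<close>.\<close>
  let ?r = "min r (min 1 (pi / 8))"
  show ?thesis
  proof (rule that[of ?r "(- fst p, w)"])
    show "?r > 0" using r by simp
    show "(- fst p, w) \<in> plane_states" using p1 by (simp add: plane_states_def)
    fix \<delta> :: real assume \<delta>: "0 < \<delta>" "\<delta> < ?r"
    obtain \<epsilon> where \<epsilon>: "\<epsilon> > 0" "\<And>a z. a \<in> D \<Longrightarrow> a \<in> ball (snd p) r \<Longrightarrow> norm z \<le> \<epsilon> \<Longrightarrow> a + \<delta> *\<^sub>R w - z \<in> D"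
      using r(2)[of \<delta>] \<delta> by auto
    \<comment> \<open>The admissible perturbation is the smaller of the slacks in the two
      factors.\<close>
    show "\<exists>\<epsilon>>0. \<forall>x\<in>(misorientations \<times> D) \<inter> ball p ?r. \<forall>z\<in>plane_states. norm z \<le> \<epsilon> \<longrightarrow>
        x + \<delta> *\<^sub>R (- fst p, w) - z \<in> misorientations \<times> D"
    proof (intro exI[of _ "min \<epsilon> (\<delta> * (pi/8))"] conjI ballI impI)
      show "min \<epsilon> (\<delta> * (pi/8)) > 0" using \<epsilon> \<delta> by simp
      fix x z assume x: "x \<in> (misorientations \<times> D) \<inter> ball p ?r" and z: "z \<in> plane_states" "norm z \<le> min \<epsilon> (\<delta> * (pi/8))"
      have xp: "dist (fst p) (fst x) < ?r" "dist (snd p) (snd x) < ?r"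
        using x dist_fst_le[of p x] dist_snd_le[of p x] by auto
      have zn: "norm (fst z) \<le> \<delta> * (pi/8)" "norm (snd z) \<le> \<epsilon>"
        using z(2) norm_fst_le[of "fst z" "snd z"] norm_snd_le[of "snd z" "fst z"] by auto
      have "fst x + \<delta> *\<^sub>R (- fst p) - fst z \<in> misorientations"
        by (rule misorientations_inward[OF p1]) (use \<delta> x xp zn z(1) in \<open>auto simp: plane_states_def\<close>)
      moreover have "snd x + \<delta> *\<^sub>R w - snd z \<in> D"
        by (rule \<epsilon>(2)) (use x xp zn in auto)
      ultimately show "x + \<delta> *\<^sub>R (- fst p, w) - z \<in> misorientations \<times> D"
        by (simp add: mem_Times_iff)
    qed
  qed
qed

section \<open>Finite measure on the domain and its shifted kernels\<close>

lemma sets_domain_measure [measurable_cong, simp]: "sets (domain_measure D) = sets borel"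
  by (simp add: domain_measure_def)

lemma space_domain_measure [simp]: "space (domain_measure D) = UNIV"
  by (simp add: domain_measure_def)

lemma domain_measurable: "open D \<Longrightarrow> misorientations \<times> D \<in> sets borel"
  by (rule borel_Times) auto

lemma AE_domain_measure_iff:
  "open D \<Longrightarrow> (AE x in domain_measure D. P x) \<longleftrightarrow> (AE x in state_measure. x \<in> misorientations \<times> D \<longrightarrow> P x)"
  unfolding domain_measure_def using domain_measurable[of D]
  by (subst AE_density) (auto simp: indicator_def split: if_splits elim!: eventually_mono)

lemma finite_domain_measure:
  assumes "open D" "bounded D"
  shows "finite_measure (domain_measure D)"
proof
  have [measurable]: "misorientations \<times> D \<in> sets borel" by (rule domain_measurable[OF assms(1)])
  have "bounded (chart -` (misorientations \<times> D))"
  proof -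
    obtain B where "\<forall>x\<in>misorientations \<times> D. norm x \<le> B"
      using bounded_Times[OF bounded_misorientations assms(2)] bounded_iff by blast
    then have "norm e \<le> B" if "e \<in> chart -` (misorientations \<times> D)" for e
      using that norm_chart[of e] by fastforce
    then show ?thesis unfolding bounded_iff by blast
  qed
  then have "emeasure lborel (chart -` (misorientations \<times> D)) < \<infinity>"
    by (rule emeasure_bounded_finite)
  moreover have "emeasure (domain_measure D) (space (domain_measure D)) = emeasure state_measure (misorientations \<times> D)"
    by (simp add: domain_measure_def emeasure_density)
  moreover have "emeasure state_measure (misorientations \<times> D) = emeasure lborel (chart -` (misorientations \<times> D))"
    unfolding state_measure_eq_distr by (subst emeasure_distr) auto
  ultimately show "emeasure (domain_measure D) (space (domain_measure D)) \<noteq> \<infinity>" by simp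
qed

lemma integral_domain_measure:
  fixes g :: "state \<Rightarrow> 'b::euclidean_space"
  assumes "open D" "g \<in> borel_measurable borel"
  shows "(LINT x|domain_measure D. g x) = (LINT x|state_measure. indicator (misorientations \<times> D) x *\<^sub>R g x)"
  unfolding domain_measure_def
  using integral_density[of g state_measure "indicator (misorientations \<times> D)"] assms domain_measurable[OF assms(1)]
  by (simp add: ennreal_indicator)

text \<open>The kernel is supported near \<open>- \<delta> *\<^sub>R W\<close>, so averaging at a point of \<open>U\<close> near \<open>p\<close> only uses
  values in a compact part of \<open>U\<close>: the domain has the segment property at \<open>p\<close>.\<close>

lemma domain_mollifiable:
  assumes D: "open D" "bounded D" "C2_boundary D" and p: "p \<in> closure (misorientations \<times> D)"
  shows "\<exists>\<rho>>0. mollifiable (domain_measure D) (misorientations \<times> D) p \<rho>"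
proof -
  let ?U = "misorientations \<times> D" and ?M = "domain_measure D"
  have U [measurable]: "?U \<in> sets borel" by (rule domain_measurable[OF D(1)])
  interpret finite_measure ?M by (rule finite_domain_measure[OF D(1,2)])
  obtain \<rho> W where \<rho>: "\<rho> > 0" and W: "W \<in> plane_states" and inw: "\<And>\<delta>. 0 < \<delta> \<Longrightarrow> \<delta> < \<rho> \<Longrightarrow>
      \<exists>\<epsilon>>0. \<forall>x\<in>?U \<inter> ball p \<rho>. \<forall>z\<in>plane_states. norm z \<le> \<epsilon> \<longrightarrow> x + \<delta> *\<^sub>R W - z \<in> ?U"
    by (rule domain_inward[OF D(1,3) p]) blast
  \<comment> \<open>The \<open>+ 2\<close> makes the shift strictly smaller than \<rho> already for
    \<open>n = 0\<close>.\<close>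
  define \<delta> where "\<delta> n = \<rho> / real (n + 2)" for n
  have \<delta>: "0 < \<delta> n" "\<delta> n < \<rho>" for n
    using \<rho> by (auto simp: \<delta>_def divide_simps)
  have \<delta>0: "\<delta> \<longlonglongrightarrow> 0"
    unfolding \<delta>_def by (rule LIMSEQ_ignore_initial_segment[OF lim_const_over_n])
  have "\<forall>n. \<exists>\<epsilon>. 0 < \<epsilon> \<and> \<epsilon> \<le> \<delta> n \<and> (\<forall>x\<in>?U \<inter> ball p \<rho>. \<forall>z\<in>plane_states. norm z \<le> \<epsilon> \<longrightarrow> x + \<delta> n *\<^sub>R W - z \<in> ?U)"
  proof
    fix n
    obtain \<epsilon> where "\<epsilon> > 0" "\<forall>x\<in>?U \<inter> ball p \<rho>. \<forall>z\<in>plane_states. norm z \<le> \<epsilon> \<longrightarrow> x + \<delta> n *\<^sub>R W - z \<in> ?U"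
      using inw[OF \<delta>] by blast
    then show "\<exists>\<epsilon>. 0 < \<epsilon> \<and> \<epsilon> \<le> \<delta> n \<and> (\<forall>x\<in>?U \<inter> ball p \<rho>. \<forall>z\<in>plane_states. norm z \<le> \<epsilon> \<longrightarrow> x + \<delta> n *\<^sub>R W - z \<in> ?U)"
      using \<delta>(1)[of n] by (intro exI[of _ "min \<epsilon> (\<delta> n)"]) auto
  qed
  from choice[OF this] obtain \<epsilon> where \<epsilon>: "\<And>n. 0 < \<epsilon> n" "\<And>n. \<epsilon> n \<le> \<delta> n"
    and inside: "\<And>n x z. x \<in> ?U \<inter> ball p \<rho> \<Longrightarrow> z \<in> plane_states \<Longrightarrow> norm z \<le> \<epsilon> n \<Longrightarrow> x + \<delta> n *\<^sub>R W - z \<in> ?U"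
    by blast
  \<comment> \<open>With this centre, K n (x - y) is nonzero only for \<open>y\<close> within
    \<epsilon> n of x + \<delta> n W, a point pushed into the domain.\<close>
  let ?q = "\<lambda>n. - \<delta> n *\<^sub>R W"
  have q: "?q n \<in> plane_states" for n by (rule plane_states_scaleR[OF W])
  define m where "m n = (LINT x|state_measure. bump (?q n) (\<epsilon> n) x)" for n
  have m: "m n > 0" for n unfolding m_def by (rule bump_mass(2)[OF q \<epsilon>(1)])
  define K where "K n x = inverse (m n) * bump (?q n) (\<epsilon> n) x" for n x
  have K0: "K n x \<ge> 0" for n x
    unfolding K_def using m[of n] by (intro mult_nonneg_nonneg bump_nonneg) simp
  have [measurable]: "K n \<in> borel_measurable borel" for n unfolding K_def by measurable
  have Kint: "integrable state_measure (K n)" for n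
    unfolding K_def using bump_mass(1)[OF q \<epsilon>(1)] by simp
  have Kmass: "(LINT x|state_measure. K n x) = 1" for n
    unfolding K_def using m[of n] by (simp add: m_def)
  have Kz: "K n x = 0 \<longleftrightarrow> \<epsilon> n \<le> norm (x + \<delta> n *\<^sub>R W)" for n x
    using m[of n] by (simp add: K_def bump_eq_0_iff[OF \<epsilon>(1)] dist_norm)
  have near: "y \<in> ?U" if "x \<in> ?U \<inter> ball p \<rho>" "y \<in> plane_states" "norm (x + \<delta> n *\<^sub>R W - y) \<le> \<epsilon> n" for x y n
  proof -
    have "x \<in> plane_states" using that(1) domain_subset_plane_states[of D] by blast
    then have "x + \<delta> n *\<^sub>R W - y \<in> plane_states"
      using that(2) W by (intro plane_states_diff plane_states_add plane_states_scaleR)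
    from inside[OF that(1) this that(3)] show ?thesis by simp
  qed
  have eq: "x - y + \<delta> n *\<^sub>R W = x + \<delta> n *\<^sub>R W - y" for x y :: state and n by simp
  \<comment> \<open>The range of the kernel is the length of the shift plus \<epsilon> n, and
    \<epsilon> n is at most \<delta> n.\<close>
  have "approximate_identity ?M (?U \<inter> ball p \<rho>) (\<lambda>n x y. K n (x - y)) (\<lambda>n. \<delta> n * norm W + \<delta> n)"
  proof
    show "sets ?M = sets borel" by simp
    show "?U \<inter> ball p \<rho> \<in> sets borel" by measurable
    show "(\<lambda>z. K n (fst z - snd z)) \<in> borel_measurable (borel \<Otimes>\<^sub>M borel)" for n by measurable
    show "0 \<le> K n (x - y)" for n x y by (rule K0)
    show "\<exists>B. \<forall>x y. K n (x - y) \<le> B" for n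
      using m[of n] bump_le_1 by (intro exI[of _ "inverse (m n)"]) (auto simp: K_def divide_simps)
    show "(LINT y|?M. K n (x - y)) = 1" if x: "x \<in> ?U \<inter> ball p \<rho>" for n x
    proof -
      have xp: "x \<in> plane_states" using x domain_subset_plane_states[of D] by blast
      have "(LINT y|?M. K n (x - y)) = (LINT y|state_measure. indicator ?U y *\<^sub>R K n (x - y))"
        by (rule integral_domain_measure[OF D(1)]) measurable
      \<comment> \<open>By \<open>near\<close>, all points of the plane at which the kernel is
        nonzero lie in the domain, so restricting to the domain loses no mass.\<close>
      also have "\<dots> = (LINT y|state_measure. K n (x - y))"
      proof (rule integral_cong_AE)
        show "AE y in state_measure. indicator ?U y *\<^sub>R K n (x - y) = K n (x - y)"
          using AE_plane_states
        proof eventually_elim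
          case (elim y)
          show ?case
          proof (cases "y \<in> ?U")
            case False
            then have "\<not> norm (x + \<delta> n *\<^sub>R W - y) \<le> \<epsilon> n" using near[OF x elim] by blast
            then have "K n (x - y) = 0" by (simp add: Kz eq)
            then show ?thesis by simp
          qed simp
        qed
      qed measurable
      also have "\<dots> = 1" using integral_state_measure_translate(1)[of "K n", OF _ xp] Kmass by simp
      finally show ?thesis .
    qed
    \<comment> \<open>For fixed \<open>y\<close> the kernel in \<open>x\<close> is shifted the other
      way and may leave the domain, so only an inequality holds.\<close>
    show "AE y in ?M. (LINT x|?M. indicator (?U \<inter> ball p \<rho>) x * K n (x - y)) \<le> 1" for n
    proof -
      have "(LINT x|?M. indicator (?U \<inter> ball p \<rho>) x * K n (x - y)) \<le> 1" if y: "y \<in> ?U" for y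
      proof -
        have yp: "y \<in> plane_states" using y domain_subset_plane_states[of D] by blast
        have "(LINT x|?M. indicator (?U \<inter> ball p \<rho>) x * K n (x - y))
          = (LINT x|state_measure. indicator ?U x *\<^sub>R (indicator (?U \<inter> ball p \<rho>) x * K n (x - y)))"
          by (rule integral_domain_measure[OF D(1)])
            (intro borel_measurable_times borel_measurable_indicator sets.Int U borel_open[OF open_ball]; measurable)
        also have "\<dots> \<le> (LINT x|state_measure. K n (x - y))"
        proof (rule integral_mono')
          show "integrable state_measure (\<lambda>x. K n (x - y))"
            by (rule integral_state_measure_translate(4)[OF _ yp Kint]) measurable
          show "indicator ?U x *\<^sub>R (indicator (?U \<inter> ball p \<rho>) x * K n (x - y)) \<le> K n (x - y)" for x
            using K0[of n "x - y"] by (simp add: indicator_def)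
        qed (rule K0)
        also have "\<dots> = 1" using integral_state_measure_translate(2)[of "K n", OF _ yp] Kmass by simp
        finally show ?thesis .
      qed
      then show ?thesis by (auto simp: AE_domain_measure_iff[OF D(1)])
    qed
    show "K n (x - y) = 0" if "\<delta> n * norm W + \<delta> n \<le> dist x y" for n x y
    proof -
      have "norm (x - y) \<le> norm (x - y + \<delta> n *\<^sub>R W) + norm (\<delta> n *\<^sub>R W)"
        using norm_triangle_ineq4[of "x - y + \<delta> n *\<^sub>R W" "\<delta> n *\<^sub>R W"] by simp
      then show ?thesis using that \<epsilon>(2)[of n] \<delta>(1)[of n] by (simp add: Kz dist_norm)
    qed
    show "(\<lambda>n. \<delta> n * norm W + \<delta> n) \<longlonglongrightarrow> 0"
      using tendsto_add[OF tendsto_mult_left_zero[OF \<delta>0] \<delta>0] by simp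
  qed
  moreover have "smooth (K n)" for n
    unfolding K_def by (rule smooth_mult[OF smooth_const smooth_bump])
  \<comment> \<open>The closed ball is cut with the plane, because the ambient ball itself is not
    contained in the domain.\<close>
  moreover have "\<exists>C. compact C \<and> C \<subseteq> ?U \<and> (\<forall>y\<in>?U - C. K n (x - y) = 0)" if x: "x \<in> ?U \<inter> ball p \<rho>" for n x
  proof (intro exI[of _ "plane_states \<inter> cball (x + \<delta> n *\<^sub>R W) (\<epsilon> n)"] conjI)
    show "compact (plane_states \<inter> cball (x + \<delta> n *\<^sub>R W) (\<epsilon> n))"
      by (intro closed_Int_compact closed_plane_states compact_cball)
    show "plane_states \<inter> cball (x + \<delta> n *\<^sub>R W) (\<epsilon> n) \<subseteq> ?U"
      using near[OF x] by (auto simp: dist_norm)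
    show "\<forall>y\<in>?U - plane_states \<inter> cball (x + \<delta> n *\<^sub>R W) (\<epsilon> n). K n (x - y) = 0"
    proof
      fix y assume "y \<in> ?U - plane_states \<inter> cball (x + \<delta> n *\<^sub>R W) (\<epsilon> n)"
      then have "\<not> norm (x + \<delta> n *\<^sub>R W - y) \<le> \<epsilon> n"
        using domain_subset_plane_states[of D] by (auto simp: dist_norm)
      then show "K n (x - y) = 0" by (simp add: Kz eq)
    qed
  qed
  ultimately have "mollifiable ?M ?U p \<rho>"
    unfolding mollifiable_def by (intro exI[of _ K] exI[of _ "\<lambda>n. \<delta> n * norm W + \<delta> n"]) blast
  then show ?thesis using \<rho> by blast
qed

section \<open>Laplace transform in time\<close>

text \<open>Jensen's inequality for a probability measure, again by expanding the variance about the
  mean.\<close>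

lemma norm_integral_square_le:
  fixes u :: "'a \<Rightarrow> 'b::euclidean_space"
  assumes N: "finite_measure N" "measure N (space N) = 1" and [measurable]: "u \<in> borel_measurable N" and u2: "integrable N (\<lambda>t. (norm (u t))\<^sup>2)"
  shows "(norm (LINT t|N. u t))\<^sup>2 \<le> (LINT t|N. (norm (u t))\<^sup>2)"
proof -
  interpret finite_measure N by fact
  have ui: "integrable N (\<lambda>t. norm (u t))"
    using norm_square_integrable_imp_integrable[OF finite_measure_axioms _ u2] by simp
  define m where "m = (LINT t|N. norm (u t))"
  have "0 \<le> (LINT t|N. (norm (u t) - m)\<^sup>2)" by (rule integral_nonneg_AE) simp
  also have "\<dots> = (LINT t|N. (norm (u t))\<^sup>2 - 2 * m * norm (u t) + m\<^sup>2)"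
    by (rule Bochner_Integration.integral_cong) (auto simp: power2_diff)
  also have "\<dots> = (LINT t|N. (norm (u t))\<^sup>2) - 2 * m * m + m\<^sup>2"
    using ui u2 N(2) by (simp add: m_def)
  finally have "m\<^sup>2 \<le> (LINT t|N. (norm (u t))\<^sup>2)" by (simp add: power2_eq_square)
  moreover have "norm (LINT t|N. u t) \<le> m" unfolding m_def by (rule integral_norm_bound)
  then have "(norm (LINT t|N. u t))\<^sup>2 \<le> m\<^sup>2" by (intro power_mono) auto
  ultimately show ?thesis by linarith
qed

text \<open>Bounds on time slices give integrability on the product, and Jensen in time shows that
  the time average is again in L^2. Time is the first coordinate because the hypotheses integrate
  over space inside.\<close>

lemma square_integrable_pair:
  fixes u :: "'a \<times> 'c \<Rightarrow> 'b::euclidean_space"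
  assumes N: "finite_measure N" "measure N (space N) = 1" and M: "finite_measure M" and [measurable]: "u \<in> borel_measurable (N \<Otimes>\<^sub>M M)"
    and 1: "AE t in N. integrable M (\<lambda>x. (norm (u (t, x)))\<^sup>2)"
    and 2: "integrable N (\<lambda>t. LINT x|M. (norm (u (t, x)))\<^sup>2)"
  shows "integrable (N \<Otimes>\<^sub>M M) (\<lambda>z. (norm (u z))\<^sup>2)" "integrable (N \<Otimes>\<^sub>M M) u"
    "AE x in M. integrable N (\<lambda>t. u (t, x))"
    "(\<lambda>x. LINT t|N. u (t, x)) \<in> borel_measurable M"
    "integrable M (\<lambda>x. (norm (LINT t|N. u (t, x)))\<^sup>2)"
proof -
  interpret N: finite_measure N by fact
  interpret M: finite_measure M by fact
  interpret P: pair_sigma_finite N M ..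
  have fin: "finite_measure (N \<Otimes>\<^sub>M M)"
    by (rule finite_measure_pair_measure[OF M.finite_measure_axioms N.finite_measure_axioms])
  show i2: "integrable (N \<Otimes>\<^sub>M M) (\<lambda>z. (norm (u z))\<^sup>2)"
    by (rule P.Fubini_integrable) (use 1 2 in auto)
  show i1: "integrable (N \<Otimes>\<^sub>M M) u"
    by (rule norm_square_integrable_imp_integrable[OF fin _ i2]) measurable
  show "AE x in M. integrable N (\<lambda>t. u (t, x))"
    using P.AE_integrable_snd[of "\<lambda>t x. u (t, x)"] i1 by simp
  show m: "(\<lambda>x. LINT t|N. u (t, x)) \<in> borel_measurable M"
    using P.integrable_snd[of "\<lambda>t x. u (t, x)"] i1 by auto
  have "(\<lambda>(t, x). (norm (u (t, x)))\<^sup>2) = (\<lambda>z. (norm (u z))\<^sup>2)" by auto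
  with i2 have i2': "integrable (N \<Otimes>\<^sub>M M) (\<lambda>(t, x). (norm (u (t, x)))\<^sup>2)" by (simp only:)
  note i3 = P.integrable_snd[OF i2'] P.AE_integrable_snd[OF i2']
  show "integrable M (\<lambda>x. (norm (LINT t|N. u (t, x)))\<^sup>2)"
  proof (rule Bochner_Integration.integrable_bound[OF i3(1)])
    show "AE x in M. norm ((norm (LINT t|N. u (t, x)))\<^sup>2) \<le> norm (LINT t|N. (norm (u (t, x)))\<^sup>2)"
      using i3(2) AE_space
    proof eventually_elim
      case (elim x)
      have "(\<lambda>t. u (t, x)) \<in> borel_measurable N" using elim(2) by measurable
      from norm_integral_square_le[OF N this elim(1)]
      show ?case by (simp add: abs_ge_self order_trans)
    qed
  qed (use m in measurable)
qed

text \<open>The factor \<open>s\<close> turns the kernel into the exponential probability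
  distribution, so Jensen applies with constant one; the transforms below are \<open>s\<close> times
  the usual ones.\<close>

definition laplace_density :: "real \<Rightarrow> real \<Rightarrow> real" where
  "laplace_density s t = indicator {0..} t * (s * exp (- (s * t)))"

definition laplace_measure :: "real \<Rightarrow> real measure" where
  "laplace_measure s = density lborel (laplace_density s)"

lemma laplace_density_measurable [measurable]: "laplace_density s \<in> borel_measurable borel"
  unfolding laplace_density_def by measurable

lemma laplace_density_nonneg: "s > 0 \<Longrightarrow> 0 \<le> laplace_density s t"
  by (simp add: laplace_density_def)

lemma sets_laplace_measure [measurable_cong, simp]: "sets (laplace_measure s) = sets borel"
  by (simp add: laplace_measure_def)

lemma space_laplace_measure [simp]: "space (laplace_measure s) = UNIV"
  by (simp add: laplace_measure_def)

lemma laplace_tail: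
  fixes s a :: real
  assumes s: "s > 0"
  shows "has_bochner_integral lborel (\<lambda>t. indicator {a..} t * (s * exp (- (s * t)))) (exp (- (s * a)))"
proof (rule has_bochner_integral_nn_integral)
  have "((\<lambda>x. - exp (- (s * x))) \<longlongrightarrow> - 0) at_top"
    using s by (intro tendsto_minus filterlim_compose[OF exp_at_bot]
      filterlim_compose[OF filterlim_uminus_at_bot_at_top] filterlim_tendsto_pos_mult_at_top[OF tendsto_const] filterlim_ident)
  then have "(\<integral>\<^sup>+x. ennreal (s * exp (- (s * x))) * indicator {a..} x \<partial>lborel) = 0 - - exp (- (s * a))"
    using s by (intro nn_integral_FTC_atLeast) (auto intro!: derivative_eq_intros)
  moreover have "ennreal (s * exp (- (s * x))) * indicator {a..} x = ennreal (indicator {a..} x * (s * exp (- (s * x))))" for x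
    by (auto simp: indicator_def)
  ultimately show "(\<integral>\<^sup>+x. ennreal (indicator {a..} x * (s * exp (- (s * x)))) \<partial>lborel) = ennreal (exp (- (s * a)))"
    by simp
qed (use s in auto)

lemma laplace_measure_mass:
  assumes "s > 0"
  shows "finite_measure (laplace_measure s)" "measure (laplace_measure s) (space (laplace_measure s)) = 1"
proof -
  have "(\<integral>\<^sup>+x. ennreal (laplace_density s x) \<partial>lborel) = ennreal (exp (- (s * 0)))"
    using laplace_tail[OF assms, of 0] assms unfolding laplace_density_def
    by (subst nn_integral_eq_integral) (auto simp: has_bochner_integral_iff)
  then have "emeasure (laplace_measure s) (space (laplace_measure s)) = 1"
    by (simp add: laplace_measure_def emeasure_density)
  then show "finite_measure (laplace_measure s)" "measure (laplace_measure s) (space (laplace_measure s)) = 1"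
    by (auto intro: finite_measureI simp: measure_def)
qed

lemma AE_laplace_measure:
  assumes "AE t in lborel. P t" "s > 0"
  shows "AE t in laplace_measure s. P t"
  unfolding laplace_measure_def using assms(1)
  by (subst AE_density) (auto elim!: eventually_mono)

lemma integral_laplace_measure:
  fixes g :: "real \<Rightarrow> 'b::euclidean_space"
  assumes "s > 0" "g \<in> borel_measurable borel"
  shows "(LINT t|laplace_measure s. g t) = (LINT t|lborel. laplace_density s t *\<^sub>R g t)"
    and "integrable (laplace_measure s) g \<longleftrightarrow> integrable lborel (\<lambda>t. laplace_density s t *\<^sub>R g t)"
  unfolding laplace_measure_def
  using integral_density[of g lborel "laplace_density s"] integrable_density[of g lborel "laplace_density s"]
    assms laplace_density_nonneg by auto

lemma integrable_laplace_measure_of_lborel: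
  fixes g :: "real \<Rightarrow> 'b::euclidean_space"
  assumes s: "s > 0" and g: "integrable lborel g"
  shows "integrable (laplace_measure s) g"
proof -
  have [measurable]: "g \<in> borel_measurable borel" using g by auto
  have "integrable lborel (\<lambda>t. laplace_density s t *\<^sub>R g t)"
  proof (rule Bochner_Integration.integrable_bound)
    show "integrable lborel (\<lambda>t. s * norm (g t))" using g by simp
    have "norm (laplace_density s t *\<^sub>R g t) \<le> norm (s * norm (g t))" for t
    proof -
      have "\<bar>laplace_density s t\<bar> \<le> s" using s by (auto simp: laplace_density_def indicator_def abs_mult)
      from mult_right_mono[OF this norm_ge_zero[of "g t"]] show ?thesis using s by simp
    qed
    then show "AE t in lborel. norm (laplace_density s t *\<^sub>R g t) \<le> norm (s * norm (g t))" by simp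
  qed measurable
  then show ?thesis using integral_laplace_measure(2)[OF s, of g] by simp
qed

section \<open>Injectivity of the Laplace transform\<close>

lemma integral_zero_all_sets_imp_AE_zero:
  fixes w :: "'a \<Rightarrow> real"
  assumes w: "integrable N w" and zero: "\<And>A. A \<in> sets N \<Longrightarrow> (LINT x|N. indicator A x * w x) = 0"
  shows "AE x in N. w x = 0"
proof -
  have [measurable]: "w \<in> borel_measurable N" using w by auto
  have nonneg: "AE x in N. u x \<le> 0" if u: "integrable N u" and z: "\<And>A. A \<in> sets N \<Longrightarrow> (LINT x|N. indicator A x * u x) = 0" for u :: "'a \<Rightarrow> real"
  proof -
    have [measurable]: "u \<in> borel_measurable N" using u by auto
    let ?A = "{x \<in> space N. 0 < u x}"
    have A: "?A \<in> sets N" by measurable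
    have i: "integrable N (\<lambda>x. indicator ?A x * u x)"
      using integrable_mult_indicator[OF A u] by simp
    have "AE x in N. indicator ?A x * u x = 0"
      using integral_nonneg_eq_0_iff_AE[OF i] z[OF A] by (auto simp: indicator_def)
    then show ?thesis using AE_space by eventually_elim (auto simp: indicator_def split: if_splits)
  qed
  have "AE x in N. w x \<le> 0" by (rule nonneg[OF w zero])
  moreover have "AE x in N. - w x \<le> 0" by (rule nonneg) (use w zero in auto)
  ultimately show ?thesis by eventually_elim auto
qed

lemma Int_stable_halflines: "Int_stable (range (\<lambda>a::real. {..<a}))"
proof (rule Int_stableI_image)
  fix a b :: real
  show "\<exists>c\<in>UNIV. {..<a} \<inter> {..<b} = {..<c}"
    by (intro bexI[of _ "min a b"]) auto
qed

text \<open>A Dynkin argument: half-lines are stable under intersection and generate the Borel sets,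
  the vanishing total integral handles complements, and dominated convergence handles disjoint
  unions.\<close>

lemma integral_halflines_zero_imp_AE_zero:
  fixes w :: "real \<Rightarrow> real"
  assumes w: "integrable lborel w" and zero: "\<And>a. (LINT t|lborel. indicator {..<a} t * w t) = 0"
    and total: "(LINT t|lborel. w t) = 0"
  shows "AE t in lborel. w t = 0"
proof (rule integral_zero_all_sets_imp_AE_zero[OF w])
  have [measurable]: "w \<in> borel_measurable borel" using w by auto
  fix A :: "real set" assume "A \<in> sets lborel"
  then have "A \<in> sigma_sets UNIV (range (\<lambda>a. {..<a}))"
    by (simp add: borel_Iio)
  have sb: "range (\<lambda>a::real. {..<a}) \<subseteq> Pow UNIV" by simp
  have meas: "B \<in> sets borel" if "B \<in> sigma_sets UNIV (range (\<lambda>a::real. {..<a}))" for B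
    using that by (simp add: borel_Iio)
  have int: "integrable lborel (\<lambda>t. indicator B t * w t)" if "B \<in> sets borel" for B
    using integrable_mult_indicator[of B lborel w] w that by simp
  from Int_stable_halflines sb \<open>A \<in> sigma_sets UNIV _\<close> show "(LINT t|lborel. indicator A t * w t) = 0"
  proof (induction A rule: sigma_sets_induct_disjoint)
    case (basic A) then show ?case using zero by auto
  next
    case empty show ?case by simp
  next
    case (compl A)
    have "indicator (UNIV - A) t * w t = w t - indicator A t * w t" for t by (simp add: indicator_def)
    then show ?case using compl(2) total w int[OF meas[OF compl(1)]] by simp
  next
    case (union A)
    have A: "A i \<in> sets borel" for i using meas union(2) by auto
    then have [measurable]: "A i \<in> sets borel" for i .
    have "(\<lambda>m. LINT t|lborel. (\<Sum>i<m. indicator (A i) t * w t)) \<longlonglongrightarrow> (LINT t|lborel. indicator (\<Union>i. A i) t * w t)"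
    proof (rule integral_dominated_convergence[where w = "\<lambda>t. norm (w t)"])
      have sums: "(\<Sum>i<m. indicator (A i) t * w t) = indicator (\<Union>i<m. A i) t * w t" for m t
      proof -
        have "indicat_real (\<Union>i<m. A i) t = (\<Sum>i<m. indicator (A i) t)"
          using union(1) by (intro indicator_UN_disjoint) (auto simp: disjoint_family_on_def)
        then show ?thesis by (simp only: sum_distrib_right)
      qed
      have "(\<lambda>m. \<Sum>i<m. indicator (A i) t * w t) \<longlonglongrightarrow> indicator (\<Union>i. A i) t * w t" for t
      proof (cases "t \<in> (\<Union>i. A i)")
        case True
        then obtain j where "t \<in> A j" by blast
        then have "(\<Sum>i<m. indicator (A i) t * w t) = indicator (\<Union>i. A i) t * w t" if "m \<ge> Suc j" for m
          unfolding sums using that True by (force simp: indicator_def)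
        then show ?thesis by (intro tendsto_eventually) (auto simp: eventually_sequentially)
      next
        case False
        then show ?thesis by (simp add: indicator_def)
      qed
      then show "AE t in lborel. (\<lambda>m. \<Sum>i<m. indicator (A i) t * w t) \<longlonglongrightarrow> indicator (\<Union>i. A i) t * w t" by simp
      show "AE t in lborel. norm (\<Sum>i<m. indicator (A i) t * w t) \<le> norm (w t)" for m
        unfolding sums by (auto simp: indicator_def)
    qed (use w in auto)
    moreover have "(LINT t|lborel. (\<Sum>i<m. indicator (A i) t * w t)) = 0" for m
      using int[OF A] union(3) by (subst Bochner_Integration.integral_sum) auto
    ultimately show ?case by (simp add: LIMSEQ_const_iff)
  qed
qed

text \<open>Substituting \<open>y = exp (- t)\<close> turns the hypothesis into vanishing moments on \<open>[0, 1]\<close>.\<close>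

lemma laplace_transform_zero_imp_AE_zero:
  fixes w :: "real \<Rightarrow> real"
  assumes w: "integrable lborel w" and supp: "\<And>t. t \<le> 0 \<Longrightarrow> w t = 0"
    and zero: "\<And>n::nat. (LINT t|lborel. exp (- (real n * t)) * w t) = 0"
  shows "AE t in lborel. w t = 0"
proof (rule integral_halflines_zero_imp_AE_zero[OF w])
  have [measurable]: "w \<in> borel_measurable borel" using w by auto
  show "(LINT t|lborel. w t) = 0" using zero[of 0] by simp
  let ?E = "\<lambda>t::real. exp (- t)"
  have int: "integrable lborel (\<lambda>t. q (?E t) * w t)" if q: "continuous_on UNIV q" for q :: "real \<Rightarrow> real"
  proof -
    have [measurable]: "q \<in> borel_measurable borel" using q by (rule borel_measurable_continuous_onI)
    have "compact (q ` {0..1})" by (intro compact_continuous_image) (use q continuous_on_subset in auto)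
    then obtain B where B: "\<And>y. y \<in> {0..1} \<Longrightarrow> norm (q y) \<le> B"
      using compact_imp_bounded bounded_iff by (metis imageI)
    show ?thesis
    proof (rule Bochner_Integration.integrable_bound)
      show "integrable lborel (\<lambda>t. B * norm (w t))" using w by simp
      have "norm (q (?E t) * w t) \<le> norm (B * norm (w t))" for t
      proof (cases "t \<le> 0")
        case False
        then have "norm (q (?E t)) \<le> \<bar>B\<bar>" by (intro order_trans[OF B abs_ge_self]) auto
        from mult_right_mono[OF this norm_ge_zero[of "w t"]] show ?thesis by (simp add: abs_mult)
      qed (simp add: supp)
      then show "AE t in lborel. norm (q (?E t) * w t) \<le> norm (B * norm (w t))" by simp
    qed measurable
  qed
  have poly: "(LINT t|lborel. g (?E t) * w t) = 0" if g: "real_polynomial_function g" for g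
  proof -
    obtain a n where "g = (\<lambda>x. \<Sum>i\<le>n. a i * x ^ i)" using real_polynomial_function_imp_sum[OF g] by blast
    note geq = this
    have pw: "?E t ^ i = exp (- (real i * t))" for t i by (simp flip: exp_of_nat_mult)
    have "(LINT t|lborel. g (?E t) * w t) = (LINT t|lborel. (\<Sum>i\<le>n. a i * (exp (- (real i * t)) * w t)))"
      by (simp add: geq sum_distrib_right pw mult.assoc)
    also have "\<dots> = (\<Sum>i\<le>n. LINT t|lborel. a i * (exp (- (real i * t)) * w t))"
    proof (rule Bochner_Integration.integral_sum)
      fix i
      have "continuous_on UNIV (\<lambda>y::real. y ^ i)" by (intro continuous_intros)
      from int[OF this] show "integrable lborel (\<lambda>t. a i * (exp (- (real i * t)) * w t))"
        unfolding pw by simp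
    qed
    also have "\<dots> = 0" using zero by simp
    finally show ?thesis .
  qed
  \<comment> \<open>Uniform approximation by polynomials on [0, 1] is enough: where \<open>w\<close>
    does not vanish, \<open>t\<close> is positive and exp(-t) lies in that interval.\<close>
  have cont: "(LINT t|lborel. q (?E t) * w t) = 0" if q: "continuous_on UNIV q" for q
  proof -
    have le: "norm (LINT t|lborel. q (?E t) * w t) \<le> e * (LINT t|lborel. norm (w t))" if e: "e > 0" for e
    proof -
      obtain g where g: "real_polynomial_function g" "\<And>y. y \<in> {0..1} \<Longrightarrow> \<bar>q y - g y\<bar> < e"
        using Stone_Weierstrass_real_polynomial_function[of "{0..1}" q e] q e continuous_on_subset by blast
      have cg: "continuous_on UNIV g"
        using g(1) by (simp add: continuous_on_polymonial_function real_polynomial_function_eq)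
      have "(LINT t|lborel. q (?E t) * w t) = (LINT t|lborel. q (?E t) * w t - g (?E t) * w t)"
        using int[OF q] int[OF cg] poly[OF g(1)] by simp
      also have "norm \<dots> \<le> (LINT t|lborel. norm (q (?E t) * w t - g (?E t) * w t))" by (rule integral_norm_bound)
      also have "\<dots> \<le> (LINT t|lborel. e * norm (w t))"
      proof (rule integral_mono)
        fix t
        show "norm (q (?E t) * w t - g (?E t) * w t) \<le> e * norm (w t)"
        proof (cases "t \<le> 0")
          case False
          then have "\<bar>q (?E t) - g (?E t)\<bar> \<le> e" by (intro less_imp_le g(2)) auto
          from mult_right_mono[OF this norm_ge_zero[of "w t"]] show ?thesis
            by (simp add: abs_mult flip: left_diff_distrib)
        qed (simp add: supp)
      qed (use int[OF q] int[OF cg] w in auto)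
      finally show ?thesis by simp
    qed
    let ?I = "LINT t|lborel. norm (w t)"
    have I: "0 \<le> ?I" by (rule integral_nonneg_AE) simp
    have "norm (LINT t|lborel. q (?E t) * w t) \<le> 0"
    proof (rule field_le_epsilon)
      fix e :: real assume e: "e > 0"
      have "norm (LINT t|lborel. q (?E t) * w t) \<le> e / (?I + 1) * ?I"
        by (rule le) (use e I in \<open>auto intro!: divide_pos_pos add_nonneg_pos\<close>)
      also have "\<dots> = e * (?I / (?I + 1))" by simp
      also have "\<dots> \<le> e * 1" using e I by (intro mult_left_mono) (auto simp: divide_le_eq_1 add_nonneg_pos)
      finally show "norm (LINT t|lborel. q (?E t) * w t) \<le> 0 + e" by simp
    qed
    then show ?thesis by simp
  qed
  fix a :: real
  \<comment> \<open>Continuous ramps that increase to the indicator of y > exp(-a); under the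
    substitution this is the half-line t < a.\<close>
  define q where "q k y = min 1 (max 0 (real k * (y - ?E a)))" for k y
  have qc: "continuous_on UNIV (q k)" for k unfolding q_def by (intro continuous_intros)
  have [measurable]: "q k \<in> borel_measurable borel" for k using qc by (rule borel_measurable_continuous_onI)
  have "(\<lambda>k. LINT t|lborel. q k (?E t) * w t) \<longlonglongrightarrow> (LINT t|lborel. indicator {..<a} t * w t)"
  proof (rule integral_dominated_convergence[where w = "\<lambda>t. norm (w t)"])
    have "(\<lambda>k. q k (?E t)) \<longlonglongrightarrow> indicator {..<a} t" for t
    proof (cases "t < a")
      case True
      then have p: "?E t - ?E a > 0" by simp
      obtain N :: nat where N: "1 / (?E t - ?E a) < real N" using reals_Archimedean2 by blast
      have "q k (?E t) = 1" if "k \<ge> N" for k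
      proof -
        have "1 \<le> real N * (?E t - ?E a)" using N p by (simp add: field_simps)
        also have "\<dots> \<le> real k * (?E t - ?E a)" using that p by (intro mult_right_mono) auto
        finally show ?thesis by (simp add: q_def)
      qed
      then show ?thesis using True by (intro tendsto_eventually) (auto simp: eventually_sequentially)
    next
      case False
      then have "q k (?E t) = 0" for k by (simp add: q_def mult_nonneg_nonpos)
      then show ?thesis using False by simp
    qed
    then show "AE t in lborel. (\<lambda>k. q k (?E t) * w t) \<longlonglongrightarrow> indicator {..<a} t * w t"
      by (intro AE_I2 tendsto_mult tendsto_const) auto
    have "norm (q k (?E t) * w t) \<le> norm (w t)" for k t
    proof -
      have "\<bar>q k (?E t)\<bar> \<le> 1" by (auto simp: q_def)
      from mult_right_mono[OF this norm_ge_zero[of "w t"]] show ?thesis by (simp add: abs_mult)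
    qed
    then show "AE t in lborel. norm (q k (?E t) * w t) \<le> norm (w t)" for k by simp
  qed (use w in auto)
  then show "(LINT t|lborel. indicator {..<a} t * w t) = 0"
    using cont[OF qc] by (simp add: LIMSEQ_const_iff)
qed

section \<open>The evolution problem\<close>

definition diffuse :: "real \<Rightarrow> real \<Rightarrow> state \<Rightarrow> state" where
  "diffuse c1 c2 g = (c1 *\<^sub>R fst g, c2 *\<^sub>R snd g)"

lemma bounded_linear_diffuse: "bounded_linear (diffuse c1 c2)"
  unfolding diffuse_def
  by (intro bounded_linear_Pair bounded_linear_const_scaleR bounded_linear_fst bounded_linear_snd)

lemma diffuse_measurable [measurable]: "diffuse c1 c2 \<in> borel_measurable borel"
  by (intro borel_measurable_continuous_onI linear_continuous_on bounded_linear_diffuse)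

text \<open>\<open>f\<close> and \<open>G\<close> are Borel and vanish outside the cylinder,
  including for nonpositive times. The zero in \<open>weak_eq\<close> is the initial datum. Its
  exceptional set of \<open>T\<close> may depend on \<psi>, which is harmless because
  \<open>T\<close> is integrated for each \<psi> separately.\<close>

locale weak_evolution = finite_measure M for M :: "state measure" +
  fixes U :: "state set" and f :: "state \<times> real \<Rightarrow> real" and G :: "state \<times> real \<Rightarrow> state"
    and v :: "state \<Rightarrow> state" and c1 c2 C V :: real
  assumes sets_M [measurable_cong]: "sets M = sets borel"
    and U [measurable]: "U \<in> sets borel" and bounded_U: "bounded U"
    and f [measurable]: "f \<in> borel_measurable borel" and G [measurable]: "G \<in> borel_measurable borel"
    and v [measurable]: "v \<in> borel_measurable borel" and v_bound: "\<And>x. norm (v x) \<le> V"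
    and c_pos: "c1 > 0" "c2 > 0"
    and f_bound: "AE t in lborel. integrable M (\<lambda>x. (norm (f (x, t)))\<^sup>2) \<and> (LINT x|M. (norm (f (x, t)))\<^sup>2) \<le> C"
    and G_bound: "AE t in lborel. integrable M (\<lambda>x. (norm (G (x, t)))\<^sup>2)"
    and G_int: "integrable lborel (\<lambda>t. LINT x|M. (norm (G (x, t)))\<^sup>2)"
    and outside: "\<And>x t. x \<notin> U \<or> t \<le> 0 \<Longrightarrow> f (x, t) = 0" "\<And>x t. x \<notin> U \<or> t \<le> 0 \<Longrightarrow> G (x, t) = 0"
    and weak_grad: "AE t in lborel. \<forall>\<psi> K. smooth \<psi> \<longrightarrow> compact K \<longrightarrow> K \<subseteq> U \<longrightarrow> (\<forall>x\<in>U - K. \<psi> x = 0) \<longrightarrow>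
        (LINT x|M. f (x, t) *\<^sub>R kgrad \<psi> x) = - (LINT x|M. \<psi> x *\<^sub>R G (x, t))"
    and weak_eq: "\<And>\<psi>. smooth \<psi> \<Longrightarrow> AE T in lborel. 0 < T \<longrightarrow>
        (LINT x|M. f (x, T) * \<psi> x) + (LINT t|lborel. indicator {0<..<T} t *
          (LINT x|M. (diffuse c1 c2 (G (x, t)) - f (x, t) *\<^sub>R v x) \<bullet> kgrad \<psi> x)) = 0"
    and moll: "\<And>p. p \<in> closure U \<Longrightarrow> \<exists>\<rho>>0. mollifiable M U p \<rho>"
begin

definition flux :: "state \<times> real \<Rightarrow> state" where
  "flux z = diffuse c1 c2 (G z) - f z *\<^sub>R v (fst z)"

lemma flux_measurable [measurable]: "flux \<in> borel_measurable borel"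
proof -
  have [measurable]: "f \<in> borel_measurable (borel \<Otimes>\<^sub>M borel)" "G \<in> borel_measurable (borel \<Otimes>\<^sub>M borel)"
    using f G by (simp_all add: borel_prod)
  have "flux \<in> borel_measurable (borel \<Otimes>\<^sub>M borel)" unfolding flux_def[abs_def] by measurable
  then show ?thesis by (simp add: borel_prod)
qed

section \<open>The transformed problem for a fixed parameter \<open>s\<close>\<close>

context
  fixes s :: real
  assumes s: "s > 0"
begin

abbreviation "\<tau> \<equiv> laplace_measure s"

interpretation T: finite_measure \<tau> by (rule laplace_measure_mass(1)[OF s])

interpretation TM: pair_sigma_finite \<tau> M ..

lemma measurable_swap_time:
  assumes "u \<in> borel_measurable (borel :: (state \<times> real) measure)"
  shows "(\<lambda>z. u (snd z, fst z)) \<in> borel_measurable (\<tau> \<Otimes>\<^sub>M M)"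
proof -
  have [measurable]: "u \<in> borel_measurable (borel \<Otimes>\<^sub>M borel)" using assms by (simp add: borel_prod)
  show ?thesis by measurable
qed

definition F\<^sub>s :: "state \<Rightarrow> real" where "F\<^sub>s x = (LINT t|\<tau>. f (x, t))"
definition G\<^sub>s :: "state \<Rightarrow> state" where "G\<^sub>s x = (LINT t|\<tau>. G (x, t))"
definition \<Phi>\<^sub>s :: "state \<Rightarrow> state" where "\<Phi>\<^sub>s x = (LINT t|\<tau>. flux (x, t))"

lemma f_square:
  "AE t in \<tau>. integrable M (\<lambda>x. (norm (f (x, t)))\<^sup>2)" "integrable \<tau> (\<lambda>t. LINT x|M. (norm (f (x, t)))\<^sup>2)"
proof -
  have [measurable]: "f \<in> borel_measurable (borel \<Otimes>\<^sub>M borel)" using f by (simp add: borel_prod)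
  show "AE t in \<tau>. integrable M (\<lambda>x. (norm (f (x, t)))\<^sup>2)"
    using AE_laplace_measure[OF f_bound s] by eventually_elim auto
  have m: "(\<lambda>t. LINT x|M. (norm (f (x, t)))\<^sup>2) \<in> borel_measurable \<tau>" by measurable
  show "integrable \<tau> (\<lambda>t. LINT x|M. (norm (f (x, t)))\<^sup>2)"
  proof (rule T.integrable_const_bound[where B = C, OF _ m])
    show "AE t in \<tau>. norm (LINT x|M. (norm (f (x, t)))\<^sup>2) \<le> C"
      using AE_laplace_measure[OF f_bound s] by eventually_elim simp
  qed
qed

lemma G_square:
  "AE t in \<tau>. integrable M (\<lambda>x. (norm (G (x, t)))\<^sup>2)" "integrable \<tau> (\<lambda>t. LINT x|M. (norm (G (x, t)))\<^sup>2)"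
  using AE_laplace_measure[OF G_bound s] integrable_laplace_measure_of_lborel[OF s G_int] by auto

text \<open>In order: square-integrability and integrability on the product, integrability in time
  for almost every state, and measurability and square-integrability of the time average.\<close>

lemmas f_facts = square_integrable_pair[OF laplace_measure_mass[OF s] finite_measure_axioms
    measurable_swap_time[OF f], simplified fst_conv snd_conv, OF f_square]

lemmas G_facts = square_integrable_pair[OF laplace_measure_mass[OF s] finite_measure_axioms
    measurable_swap_time[OF G], simplified fst_conv snd_conv, OF G_square]

lemma flux_norm_le: "(norm (flux z))\<^sup>2 \<le> 2 * (c1 + c2)\<^sup>2 * (norm (G z))\<^sup>2 + 2 * V\<^sup>2 * (norm (f z))\<^sup>2"
proof -
  have "(norm (flux z))\<^sup>2 \<le> 2 * (norm (diffuse c1 c2 (G z)))\<^sup>2 + 2 * (norm (f z *\<^sub>R v (fst z)))\<^sup>2"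
    unfolding flux_def by (rule norm_square_diff_le)
  moreover have "(norm (diffuse c1 c2 (G z)))\<^sup>2 \<le> (c1 + c2)\<^sup>2 * (norm (G z))\<^sup>2"
  proof -
    have "norm (diffuse c1 c2 g) \<le> (c1 + c2) * norm g" for g
    proof -
      have "norm (diffuse c1 c2 g) \<le> norm (c1 *\<^sub>R fst g) + norm (c2 *\<^sub>R snd g)"
        unfolding diffuse_def by (rule norm_Pair_le)
      also have "\<dots> \<le> c1 * norm g + c2 * norm g"
        using c_pos norm_fst_le[of "fst g" "snd g"] norm_snd_le[of "snd g" "fst g"] by (intro add_mono) auto
      finally show ?thesis by (simp add: distrib_right)
    qed
    then have "(norm (diffuse c1 c2 (G z)))\<^sup>2 \<le> ((c1 + c2) * norm (G z))\<^sup>2" by (intro power_mono) auto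
    then show ?thesis by (simp add: power_mult_distrib)
  qed
  moreover have "(norm (f z *\<^sub>R v (fst z)))\<^sup>2 \<le> V\<^sup>2 * (norm (f z))\<^sup>2"
  proof -
    have "norm (f z *\<^sub>R v (fst z)) \<le> V * norm (f z)"
      using mult_left_mono[OF v_bound[of "fst z"] norm_ge_zero[of "f z"]] by (simp add: mult.commute)
    then have "(norm (f z *\<^sub>R v (fst z)))\<^sup>2 \<le> (V * norm (f z))\<^sup>2" by (intro power_mono) auto
    then show ?thesis by (simp add: power_mult_distrib)
  qed
  ultimately show ?thesis by linarith
qed

lemma flux_square:
  "AE t in \<tau>. integrable M (\<lambda>x. (norm (flux (x, t)))\<^sup>2)" "integrable \<tau> (\<lambda>t. LINT x|M. (norm (flux (x, t)))\<^sup>2)"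
proof -
  let ?b = "\<lambda>t x. 2 * (c1 + c2)\<^sup>2 * (norm (G (x, t)))\<^sup>2 + 2 * V\<^sup>2 * (norm (f (x, t)))\<^sup>2"
  have [measurable]: "flux \<in> borel_measurable (borel \<Otimes>\<^sub>M borel)" by (simp add: borel_prod)
  have *: "AE t in \<tau>. integrable M (\<lambda>x. (norm (flux (x, t)))\<^sup>2) \<and>
      (LINT x|M. (norm (flux (x, t)))\<^sup>2) \<le> 2 * (c1 + c2)\<^sup>2 * (LINT x|M. (norm (G (x, t)))\<^sup>2) + 2 * V\<^sup>2 * (LINT x|M. (norm (f (x, t)))\<^sup>2)"
    using G_square(1) f_square(1)
  proof eventually_elim
    case (elim t)
    have b: "integrable M (?b t)" using elim by simp
    have i: "integrable M (\<lambda>x. (norm (flux (x, t)))\<^sup>2)"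
      by (rule Bochner_Integration.integrable_bound[OF b]) (use flux_norm_le in \<open>auto intro: order_trans[OF _ abs_ge_self]\<close>)
    have "(LINT x|M. (norm (flux (x, t)))\<^sup>2) \<le> (LINT x|M. ?b t x)"
      by (rule integral_mono[OF i b flux_norm_le])
    then show ?case using i elim by simp
  qed
  then show "AE t in \<tau>. integrable M (\<lambda>x. (norm (flux (x, t)))\<^sup>2)" by eventually_elim simp
  have m: "(\<lambda>t. LINT x|M. (norm (flux (x, t)))\<^sup>2) \<in> borel_measurable \<tau>" by measurable
  show "integrable \<tau> (\<lambda>t. LINT x|M. (norm (flux (x, t)))\<^sup>2)"
  proof (rule Bochner_Integration.integrable_bound[OF _ m])
    show "integrable \<tau> (\<lambda>t. 2 * (c1 + c2)\<^sup>2 * (LINT x|M. (norm (G (x, t)))\<^sup>2) + 2 * V\<^sup>2 * (LINT x|M. (norm (f (x, t)))\<^sup>2))"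
      using f_square(2) G_square(2) by simp
    show "AE t in \<tau>. norm (LINT x|M. (norm (flux (x, t)))\<^sup>2) \<le> norm (2 * (c1 + c2)\<^sup>2 * (LINT x|M. (norm (G (x, t)))\<^sup>2) + 2 * V\<^sup>2 * (LINT x|M. (norm (f (x, t)))\<^sup>2))"
      using * by eventually_elim (auto intro: order_trans[OF _ abs_ge_self])
  qed
qed

lemmas flux_facts = square_integrable_pair[OF laplace_measure_mass[OF s] finite_measure_axioms
    measurable_swap_time[OF flux_measurable], simplified fst_conv snd_conv, OF flux_square]

lemma flux_outside: "x \<notin> U \<or> t \<le> 0 \<Longrightarrow> flux (x, t) = 0"
  using outside[of x t] by (auto simp: flux_def diffuse_def zero_prod_def)

text \<open>A general bilinear \<open>b\<close> covers multiplication, scalar multiplication on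
  either side and the inner product with one proof; \<open>h\<close> is continuous, hence bounded
  where \<open>u\<close> does not vanish.\<close>

lemma integrable_pairing:
  fixes u :: "state \<times> real \<Rightarrow> 'b::euclidean_space" and h :: "state \<Rightarrow> 'c::euclidean_space"
    and b :: "'b \<Rightarrow> 'c \<Rightarrow> 'd::euclidean_space"
  assumes b: "bounded_bilinear b" and [measurable]: "u \<in> borel_measurable borel"
    and u: "integrable (\<tau> \<Otimes>\<^sub>M M) (\<lambda>z. u (snd z, fst z))" "\<And>x t. x \<notin> U \<Longrightarrow> u (x, t) = 0"
    and h: "continuous_on UNIV h"
  shows "integrable (\<tau> \<Otimes>\<^sub>M M) (\<lambda>(t, x). b (u (x, t)) (h x))"
proof -
  obtain B where B: "B \<ge> 0" "\<And>x. x \<in> U \<Longrightarrow> norm (h x) \<le> B" using continuous_norm_bounded_on[OF h bounded_U] by blast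
  obtain K where K: "K > 0" "\<And>a c. norm (b a c) \<le> norm a * norm c * K"
    using bounded_bilinear.pos_bounded[OF b] by blast
  have [measurable]: "h \<in> borel_measurable borel" using h by (rule borel_measurable_continuous_onI)
  have [measurable]: "(\<lambda>z. u (snd z, fst z)) \<in> borel_measurable (\<tau> \<Otimes>\<^sub>M M)"
    by (rule measurable_swap_time) measurable
  have "continuous_on UNIV (\<lambda>z. b (fst z) (snd z))"
    by (intro bounded_bilinear.continuous_on[OF b] continuous_intros)
  then have bm: "(\<lambda>z. b (fst z) (snd z)) \<in> borel_measurable (borel \<Otimes>\<^sub>M borel)"
    unfolding borel_prod by (rule borel_measurable_continuous_onI)
  have hm: "(\<lambda>z. h (snd z)) \<in> borel_measurable (\<tau> \<Otimes>\<^sub>M M)" by measurable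
  have m: "(\<lambda>z. b (u (snd z, fst z)) (h (snd z))) \<in> borel_measurable (\<tau> \<Otimes>\<^sub>M M)"
    using measurable_compose[OF measurable_Pair[OF _ hm] bm, of "\<lambda>z. u (snd z, fst z)"] by simp
  have "norm (b (u (x, t)) (h x)) \<le> norm (K * B * norm (u (x, t)))" for x t
  proof (cases "x \<in> U")
    case True
    have "norm (b (u (x, t)) (h x)) \<le> norm (u (x, t)) * norm (h x) * K" by (rule K)
    also have "\<dots> \<le> norm (u (x, t)) * B * K"
      using B True K by (intro mult_right_mono mult_left_mono) auto
    finally show ?thesis using K B by (simp add: ac_simps)
  qed (simp add: u bounded_bilinear.zero_left[OF b])
  then show ?thesis
    by (intro Bochner_Integration.integrable_bound[OF integrable_mult_right[OF integrable_norm[OF u(1)], of "K * B"]])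
      (use m in \<open>auto simp: case_prod_beta\<close>)
qed

text \<open>Fubini exchanges the integrals, and linearity of \<open>b\<close> in its first argument
  moves the time average out of it, for almost every \<open>x\<close> only.\<close>

lemma time_swap:
  fixes u :: "state \<times> real \<Rightarrow> 'b::euclidean_space" and h :: "state \<Rightarrow> 'c::euclidean_space"
    and b :: "'b \<Rightarrow> 'c \<Rightarrow> 'd::euclidean_space"
  assumes b: "bounded_bilinear b" and [measurable]: "u \<in> borel_measurable borel"
    and u: "integrable (\<tau> \<Otimes>\<^sub>M M) (\<lambda>z. u (snd z, fst z))" "\<And>x t. x \<notin> U \<Longrightarrow> u (x, t) = 0"
    and h: "continuous_on UNIV h"
  shows "(LINT x|M. b (LINT t|\<tau>. u (x, t)) (h x)) = (LINT t|\<tau>. LINT x|M. b (u (x, t)) (h x))"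
    and "integrable \<tau> (\<lambda>t. LINT x|M. b (u (x, t)) (h x))"
proof -
  note i = integrable_pairing[OF assms]
  show "integrable \<tau> (\<lambda>t. LINT x|M. b (u (x, t)) (h x))" by (rule TM.integrable_fst[OF i])
  have [measurable]: "h \<in> borel_measurable borel" using h by (rule borel_measurable_continuous_onI)
  have u': "integrable (\<tau> \<Otimes>\<^sub>M M) (\<lambda>(t, x). u (x, t))"
    using u(1) by (simp only: case_prod_beta')
  have "AE x in M. integrable \<tau> (\<lambda>t. u (x, t))"
    by (rule TM.AE_integrable_snd[OF u'])
  then have "AE x in M. b (LINT t|\<tau>. u (x, t)) (h x) = (LINT t|\<tau>. b (u (x, t)) (h x))"
  proof eventually_elim
    case (elim x)
    show ?case
      using integral_bounded_linear[OF bounded_bilinear.bounded_linear_left[OF b] elim] by simp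
  qed
  moreover have "(\<lambda>x. LINT t|\<tau>. u (x, t)) \<in> borel_measurable M"
    using TM.integrable_snd[OF u'] by auto
  then have "(\<lambda>x. b (LINT t|\<tau>. u (x, t)) (h x)) \<in> borel_measurable M"
  proof -
    assume m: "(\<lambda>x. LINT t|\<tau>. u (x, t)) \<in> borel_measurable M"
    have "continuous_on UNIV (\<lambda>z. b (fst z) (snd z))"
      by (intro bounded_bilinear.continuous_on[OF b] continuous_intros)
    then have bm: "(\<lambda>z. b (fst z) (snd z)) \<in> borel_measurable (borel \<Otimes>\<^sub>M borel)"
      unfolding borel_prod by (rule borel_measurable_continuous_onI)
    have hm: "h \<in> borel_measurable M" by measurable
    show ?thesis using measurable_compose[OF measurable_Pair[OF m hm] bm] by simp
  qed
  moreover have "(\<lambda>x. LINT t|\<tau>. b (u (x, t)) (h x)) \<in> borel_measurable M"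
    using TM.integrable_snd[OF i] by auto
  ultimately have "(LINT x|M. b (LINT t|\<tau>. u (x, t)) (h x)) = (LINT x|M. LINT t|\<tau>. b (u (x, t)) (h x))"
    by (intro integral_cong_AE)
  also have "\<dots> = (LINT t|\<tau>. LINT x|M. b (u (x, t)) (h x))"
    by (rule TM.Fubini_integral[OF i])
  finally show "(LINT x|M. b (LINT t|\<tau>. u (x, t)) (h x)) = (LINT t|\<tau>. LINT x|M. b (u (x, t)) (h x))" .
qed

text \<open>Integrating the weak formulation against \<open>s * exp (- (s * T))\<close> and exchanging the order of
  integration turns the running time integral into a factor \<open>1 / s\<close>.\<close>

lemma laplace_of_primitive:
  fixes \<beta> :: "real \<Rightarrow> real"
  assumes \<beta>: "integrable \<tau> \<beta>" and [measurable]: "\<beta> \<in> borel_measurable borel" and neg: "\<And>t. t \<le> 0 \<Longrightarrow> \<beta> t = 0"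
  shows "s * (LINT T|\<tau>. (LINT t|lborel. indicator {0<..<T} t * \<beta> t)) = (LINT t|\<tau>. \<beta> t)"
    and "(\<lambda>T. LINT t|lborel. indicator {0<..<T} t * \<beta> t) \<in> borel_measurable borel"
proof -
  interpret LT: pair_sigma_finite lborel \<tau> ..
  have ind: "indicator {0<..<T} t = (if 0 < t \<and> t < T then 1 else 0 :: real)" for t T :: real by auto
  \<comment> \<open>For fixed positive \<open>t\<close>, the condition t < T leaves a tail of the
    exponential distribution, of mass exp(- s t).\<close>
  have inner: "(LINT T|\<tau>. indicator {0<..<T} t * b) = exp (- (s * t)) * b" if t: "t > 0" for t b
  proof -
    have "(LINT T|\<tau>. indicator {0<..<T} t * b) = (LINT T|lborel. laplace_density s T *\<^sub>R (indicator {0<..<T} t * b))"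
      unfolding ind by (rule integral_laplace_measure(1)[OF s]) measurable
    also have "\<dots> = (LINT T|lborel. indicator {t..} T * (s * exp (- (s * T))) * b)"
    proof (rule integral_cong_AE)
      \<comment> \<open>The two indicators differ only at \<open>T = t\<close>, the open interval of
        the running integral against the closed tail.\<close>
      show "AE T in lborel. laplace_density s T *\<^sub>R (indicator {0<..<T} t * b) = indicator {t..} T * (s * exp (- (s * T))) * b"
        using AE_lborel_singleton[of t] by eventually_elim (use t in \<open>auto simp: laplace_density_def indicator_def\<close>)
      show "(\<lambda>T. laplace_density s T *\<^sub>R (indicator {0<..<T} t * b)) \<in> borel_measurable lborel"
        unfolding ind by measurable
    qed measurable
    also have "\<dots> = exp (- (s * t)) * b"
      using laplace_tail[OF s, of t] by (simp add: has_bochner_integral_iff)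
    finally show ?thesis .
  qed
  have m: "(\<lambda>(t, T). indicator {0<..<T} t * \<beta> t) \<in> borel_measurable (lborel \<Otimes>\<^sub>M \<tau>)"
    unfolding ind case_prod_beta by measurable
  \<comment> \<open>The tail mass is the density divided by \<open>s\<close>, the source of the
    factor in the statement. The point \<open>t = 0\<close> is excluded because the density includes
    it and the indicator does not.\<close>
  have eq: "indicator {0<..} t * exp (- (s * t)) * b = (1 / s) * (laplace_density s t * b)" if "t \<noteq> 0" for t b
    using that s by (auto simp: laplace_density_def indicator_def)
  have \<beta>l: "integrable lborel (\<lambda>t. laplace_density s t * \<beta> t)"
    using integral_laplace_measure(2)[OF s, of \<beta>] \<beta> by simp
  have int: "integrable (lborel \<Otimes>\<^sub>M \<tau>) (\<lambda>(t, T). indicator {0<..<T} t * \<beta> t)"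
  proof (rule LT.Fubini_integrable[OF m])
    have "(LINT T|\<tau>. norm (indicator {0<..<T} t * \<beta> t)) = indicator {0<..} t * exp (- (s * t)) * \<bar>\<beta> t\<bar>" for t
    proof (cases "t > 0")
      case True
      then show ?thesis using inner[OF True, of "\<bar>\<beta> t\<bar>"] by (simp add: abs_mult)
    qed (simp add: neg)
    moreover have "integrable lborel (\<lambda>t. indicator {0<..} t * exp (- (s * t)) * \<bar>\<beta> t\<bar>)"
    proof (rule integrable_cong_AE_imp)
      show "integrable lborel (\<lambda>t. (1 / s) * \<bar>laplace_density s t * \<beta> t\<bar>)"
        using integrable_abs[OF \<beta>l] by simp
      show "AE t in lborel. (1 / s) * \<bar>laplace_density s t * \<beta> t\<bar> = indicator {0<..} t * exp (- (s * t)) * \<bar>\<beta> t\<bar>"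
        using AE_lborel_singleton[of 0]
        by eventually_elim (use eq laplace_density_nonneg[OF s] in \<open>auto simp: abs_mult\<close>)
    qed measurable
    ultimately show "integrable lborel (\<lambda>t. LINT T|\<tau>. norm (case (t, T) of (t, T) \<Rightarrow> indicator {0<..<T} t * \<beta> t))"
      by simp
    show "AE t in lborel. integrable \<tau> (\<lambda>T. case (t, T) of (t, T) \<Rightarrow> indicator {0<..<T} t * \<beta> t)"
    proof (rule AE_I2)
      fix t
      have "(\<lambda>T. indicator {0<..<T} t * \<beta> t) \<in> borel_measurable \<tau>" unfolding ind by measurable
      then show "integrable \<tau> (\<lambda>T. case (t, T) of (t, T) \<Rightarrow> indicator {0<..<T} t * \<beta> t)"
        by (intro T.integrable_const_bound[where B = "\<bar>\<beta> t\<bar>"]) (auto simp: indicator_def)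
    qed
  qed
  have "(LINT T|\<tau>. (LINT t|lborel. indicator {0<..<T} t * \<beta> t)) = (LINT t|lborel. (LINT T|\<tau>. indicator {0<..<T} t * \<beta> t))"
    by (rule LT.Fubini_integral[OF int])
  also have "\<dots> = (LINT t|lborel. (1 / s) * (laplace_density s t * \<beta> t))"
  proof (rule integral_cong_AE)
    have "(LINT T|\<tau>. indicator {0<..<T} t * \<beta> t) = (1 / s) * (laplace_density s t * \<beta> t)" if "t \<noteq> 0" for t
    proof (cases "t > 0")
      case True
      have "(LINT T|\<tau>. indicator {0<..<T} t * \<beta> t) = exp (- (s * t)) * \<beta> t" by (rule inner[OF True])
      also have "\<dots> = (1 / s) * (laplace_density s t * \<beta> t)" using eq[OF that, of "\<beta> t"] True by simp
      finally show ?thesis .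
    qed (simp add: neg)
    then show "AE t in lborel. (LINT T|\<tau>. indicator {0<..<T} t * \<beta> t) = (1 / s) * (laplace_density s t * \<beta> t)"
      using AE_lborel_singleton[of 0] by (auto elim!: eventually_mono)
    show "(\<lambda>t. LINT T|\<tau>. indicator {0<..<T} t * \<beta> t) \<in> borel_measurable lborel"
      using LT.integrable_fst[OF int] by auto
  qed measurable
  also have "\<dots> = (1 / s) * (LINT t|\<tau>. \<beta> t)"
    using integral_laplace_measure(1)[OF s, of \<beta>] by simp
  finally show "s * (LINT T|\<tau>. (LINT t|lborel. indicator {0<..<T} t * \<beta> t)) = (LINT t|\<tau>. \<beta> t)"
    using s by simp
  show "(\<lambda>T. LINT t|lborel. indicator {0<..<T} t * \<beta> t) \<in> borel_measurable borel"
    unfolding ind by measurable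
qed

text \<open>With a test function of \<open>x\<close> alone, the equation relates the value at
  \<open>T\<close> to a primitive in \<open>T\<close>; \<open>laplace_of_primitive\<close> trades
  that primitive for the factor \<open>s\<close>.\<close>

lemma transformed_equation:
  assumes \<psi>: "smooth \<psi>"
  shows "s * (LINT x|M. F\<^sub>s x * \<psi> x) = - (LINT x|M. \<Phi>\<^sub>s x \<bullet> kgrad \<psi> x)"
proof -
  let ?\<beta> = "\<lambda>t. LINT x|M. flux (x, t) \<bullet> kgrad \<psi> x"
  have [measurable]: "flux \<in> borel_measurable (borel \<Otimes>\<^sub>M borel)" "f \<in> borel_measurable (borel \<Otimes>\<^sub>M borel)"
    using f by (simp_all add: borel_prod)
  have [measurable]: "\<psi> \<in> borel_measurable borel" "kgrad \<psi> \<in> borel_measurable borel"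
    using smooth_continuous_on[OF \<psi>] continuous_on_kgrad[OF \<psi>] by (auto intro: borel_measurable_continuous_onI)
  note sw1 = time_swap[OF bounded_bilinear_mult f f_facts(2) _ smooth_continuous_on[OF \<psi>]]
  note sw2 = time_swap[OF bounded_bilinear_inner flux_measurable flux_facts(2) _ continuous_on_kgrad[OF \<psi>]]
  have \<beta>: "integrable \<tau> ?\<beta>" "?\<beta> \<in> borel_measurable borel" "\<And>t. t \<le> 0 \<Longrightarrow> ?\<beta> t = 0"
    using sw2(2) flux_outside by auto
  have "s * (LINT x|M. F\<^sub>s x * \<psi> x) = s * (LINT T|\<tau>. LINT x|M. f (x, T) * \<psi> x)"
    unfolding F\<^sub>s_def using sw1(1) outside(1) by simp
  also have "(LINT T|\<tau>. LINT x|M. f (x, T) * \<psi> x) = (LINT T|\<tau>. - (LINT t|lborel. indicator {0<..<T} t * ?\<beta> t))"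
  proof (rule integral_cong_AE)
    show "AE T in \<tau>. (LINT x|M. f (x, T) * \<psi> x) = - (LINT t|lborel. indicator {0<..<T} t * ?\<beta> t)"
      using AE_laplace_measure[OF weak_eq[OF \<psi>] s]
    proof eventually_elim
      case (elim T)
      show ?case
      proof (cases "T > 0")
        case True
        then show ?thesis using elim by (simp add: flux_def)
      next
        case False
        then show ?thesis using outside(1) by simp
      qed
    qed
    show "(\<lambda>T. - (LINT t|lborel. indicator {0<..<T} t * ?\<beta> t)) \<in> borel_measurable \<tau>"
      using laplace_of_primitive(2)[OF \<beta>] by measurable
  qed measurable
  also have "s * \<dots> = - (LINT t|\<tau>. ?\<beta> t)"
    using laplace_of_primitive(1)[OF \<beta>] by simp
  also have "(LINT t|\<tau>. ?\<beta> t) = (LINT x|M. \<Phi>\<^sub>s x \<bullet> kgrad \<psi> x)"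
    unfolding \<Phi>\<^sub>s_def using sw2(1) flux_outside by simp
  finally show ?thesis .
qed

text \<open>The defining identity of weak gradients is linear in the pair of function and gradient,
  so it survives averaging in time.\<close>

lemma transformed_gradient:
  assumes \<psi>: "smooth \<psi>" and K: "compact K" "K \<subseteq> U" "\<And>x. x \<in> U - K \<Longrightarrow> \<psi> x = 0"
  shows "(LINT x|M. F\<^sub>s x *\<^sub>R kgrad \<psi> x) = - (LINT x|M. \<psi> x *\<^sub>R G\<^sub>s x)"
proof -
  have [measurable]: "G \<in> borel_measurable (borel \<Otimes>\<^sub>M borel)" "f \<in> borel_measurable (borel \<Otimes>\<^sub>M borel)"
    using f G by (simp_all add: borel_prod)
  have [measurable]: "\<psi> \<in> borel_measurable borel" "kgrad \<psi> \<in> borel_measurable borel"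
    using smooth_continuous_on[OF \<psi>] continuous_on_kgrad[OF \<psi>] by (auto intro: borel_measurable_continuous_onI)
  note sw1 = time_swap[OF bounded_bilinear_scaleR f f_facts(2) _ continuous_on_kgrad[OF \<psi>]]
  note sw2 = time_swap[OF bounded_bilinear.flip[OF bounded_bilinear_scaleR] G G_facts(2) _ smooth_continuous_on[OF \<psi>]]
  have "(LINT x|M. F\<^sub>s x *\<^sub>R kgrad \<psi> x) = (LINT t|\<tau>. LINT x|M. f (x, t) *\<^sub>R kgrad \<psi> x)"
    unfolding F\<^sub>s_def using sw1(1) outside(1) by simp
  also have "\<dots> = (LINT t|\<tau>. - (LINT x|M. \<psi> x *\<^sub>R G (x, t)))"
  proof (rule integral_cong_AE)
    show "AE t in \<tau>. (LINT x|M. f (x, t) *\<^sub>R kgrad \<psi> x) = - (LINT x|M. \<psi> x *\<^sub>R G (x, t))"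
      using AE_laplace_measure[OF weak_grad s] by eventually_elim (use \<psi> K in blast)
  qed measurable
  also have "\<dots> = - (LINT x|M. \<psi> x *\<^sub>R G\<^sub>s x)"
    unfolding G\<^sub>s_def using sw2(1) outside(2) by simp
  finally show ?thesis .
qed

text \<open>The drift does not depend on time, so it comes out of the time integral and the
  structure of the flux is preserved.\<close>

lemma \<Phi>\<^sub>s_eq: "AE x in M. \<Phi>\<^sub>s x = diffuse c1 c2 (G\<^sub>s x) - F\<^sub>s x *\<^sub>R v x"
  using f_facts(3) G_facts(3)
proof eventually_elim
  case (elim x)
  have "integrable \<tau> (\<lambda>t. diffuse c1 c2 (G (x, t)))" "(LINT t|\<tau>. diffuse c1 c2 (G (x, t))) = diffuse c1 c2 (G\<^sub>s x)"
    using integrable_bounded_linear[OF bounded_linear_diffuse elim(2)]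
      integral_bounded_linear[OF bounded_linear_diffuse elim(2)] by (auto simp: G\<^sub>s_def)
  then show ?case using elim(1) by (simp add: \<Phi>\<^sub>s_def flux_def F\<^sub>s_def)
qed

text \<open>\<open>min c1 c2\<close> is the ellipticity constant and \<open>V\<close> bounds the
  drift, so the threshold of \<open>solution_zero\<close> becomes a lower bound for
  \<open>s\<close>.\<close>

lemma transform_zero:
  assumes large: "s > V\<^sup>2 / (4 * min c1 c2)"
  shows "AE x in M. F\<^sub>s x = 0"
proof -
  interpret E: weak_elliptic M U F\<^sub>s G\<^sub>s \<Phi>\<^sub>s s
  proof
    show "sets M = sets borel" by (rule sets_M)
    show "U \<in> sets borel" "bounded U" by (rule U, rule bounded_U)
    show "F\<^sub>s \<in> borel_measurable M" "G\<^sub>s \<in> borel_measurable M" "\<Phi>\<^sub>s \<in> borel_measurable M"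
      using f_facts(4) G_facts(4) flux_facts(4) by (simp_all add: F\<^sub>s_def[abs_def] G\<^sub>s_def[abs_def] \<Phi>\<^sub>s_def[abs_def])
    show "integrable M (\<lambda>x. (norm (F\<^sub>s x))\<^sup>2)" "integrable M (\<lambda>x. (norm (G\<^sub>s x))\<^sup>2)" "integrable M (\<lambda>x. (norm (\<Phi>\<^sub>s x))\<^sup>2)"
      using f_facts(5) G_facts(5) flux_facts(5) by (simp_all add: F\<^sub>s_def[abs_def] G\<^sub>s_def[abs_def] \<Phi>\<^sub>s_def[abs_def])
    show "F\<^sub>s x = 0" if "x \<notin> U" for x using outside(1) that by (simp add: F\<^sub>s_def)
    show "\<Phi>\<^sub>s x = 0" if "x \<notin> U" for x using flux_outside that by (simp add: \<Phi>\<^sub>s_def)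
  qed (use transformed_gradient transformed_equation in blast)+
  show ?thesis
  proof (rule E.solution_zero[OF moll _ _ large])
    show "min c1 c2 > 0" using c_pos by simp
    show "AE x in M. min c1 c2 * (norm (G\<^sub>s x))\<^sup>2 - V * \<bar>F\<^sub>s x\<bar> * norm (G\<^sub>s x) \<le> \<Phi>\<^sub>s x \<bullet> G\<^sub>s x"
      using \<Phi>\<^sub>s_eq
    proof eventually_elim
      case (elim x)
      let ?g = "G\<^sub>s x"
      have "diffuse c1 c2 ?g \<bullet> ?g = c1 * (norm (fst ?g))\<^sup>2 + c2 * (norm (snd ?g))\<^sup>2"
        by (simp add: diffuse_def inner_prod_def power2_norm_eq_inner)
      also have "\<dots> \<ge> min c1 c2 * (norm (fst ?g))\<^sup>2 + min c1 c2 * (norm (snd ?g))\<^sup>2"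
        by (intro add_mono mult_right_mono) auto
      also have "min c1 c2 * (norm (fst ?g))\<^sup>2 + min c1 c2 * (norm (snd ?g))\<^sup>2 = min c1 c2 * (norm ?g)\<^sup>2"
        by (simp add: norm_prod_def distrib_left)
      finally have 1: "min c1 c2 * (norm ?g)\<^sup>2 \<le> diffuse c1 c2 ?g \<bullet> ?g" .
      have "\<bar>(F\<^sub>s x *\<^sub>R v x) \<bullet> ?g\<bar> \<le> norm (F\<^sub>s x *\<^sub>R v x) * norm ?g" by (rule Cauchy_Schwarz_ineq2)
      also have "\<dots> \<le> V * \<bar>F\<^sub>s x\<bar> * norm ?g"
        using mult_left_mono[OF v_bound[of x] abs_ge_zero[of "F\<^sub>s x"]]
        by (intro mult_right_mono) (auto simp: mult.commute)
      finally show ?case using 1 unfolding elim inner_diff_left by linarith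
    qed
  qed
qed

end

text \<open>Only large parameters are available, so the density at \<open>s0\<close> is absorbed
  into the function; the parameters s0 + n then supply its transform at all natural numbers.\<close>

theorem solution_vanishes: "AE x in M. AE t in lborel. f (x, t) = 0"
proof -
  have [measurable]: "f \<in> borel_measurable (borel \<Otimes>\<^sub>M borel)" using f by (simp add: borel_prod)
  \<comment> \<open>The \<open>+ 1\<close> puts \<open>s0\<close>, and with it every s0 + n,
    strictly above the threshold and away from 0.\<close>
  define s0 where "s0 = V\<^sup>2 / (4 * min c1 c2) + 1"
  have s0: "s0 > 0" using c_pos by (auto simp: s0_def intro!: add_nonneg_pos divide_nonneg_pos)
  have "AE x in M. F\<^sub>s (s0 + real n) x = 0" for n
    by (rule transform_zero) (use s0 in \<open>auto simp: s0_def\<close>)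
  \<comment> \<open>Countably many parameters share one null set of states, off which the
    injectivity argument runs for each fixed \<open>x\<close>.\<close>
  then have "AE x in M. \<forall>n. F\<^sub>s (s0 + real n) x = 0" by (simp add: AE_all_countable)
  with f_facts(3)[OF s0] show ?thesis
  proof eventually_elim
    case (elim x)
    have [measurable]: "(\<lambda>t. f (x, t)) \<in> borel_measurable borel" by measurable
    define w where "w t = laplace_density s0 t * f (x, t)" for t
    have "AE t in lborel. w t = 0"
    proof (rule laplace_transform_zero_imp_AE_zero)
      show "integrable lborel w"
        using elim(1) integral_laplace_measure(2)[OF s0, of "\<lambda>t. f (x, t)"] by (simp add: w_def[abs_def])
      show "w t = 0" if "t \<le> 0" for t using outside(1) that by (simp add: w_def)
      fix n :: nat
      have sn: "s0 + real n > 0" using s0 by simp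
      have "laplace_density (s0 + real n) t = (s0 + real n) / s0 * (exp (- (real n * t)) * laplace_density s0 t)" for t
      proof -
        have "exp (- ((s0 + real n) * t)) = exp (- (real n * t)) * exp (- (s0 * t))"
          by (simp add: algebra_simps flip: exp_add)
        then show ?thesis using s0 by (simp add: laplace_density_def)
      qed
      then have "(LINT t|lborel. laplace_density (s0 + real n) t * f (x, t))
          = (LINT t|lborel. (s0 + real n) / s0 * (exp (- (real n * t)) * w t))"
        by (simp add: w_def ac_simps)
      moreover have "(LINT t|lborel. laplace_density (s0 + real n) t * f (x, t)) = 0"
        using elim(2)[THEN spec, of n] integral_laplace_measure(1)[OF sn, of "\<lambda>t. f (x, t)"]
        unfolding F\<^sub>s_def[OF sn] by simp
      ultimately show "(LINT t|lborel. exp (- (real n * t)) * w t) = 0" using sn s0 by simp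
    qed
    then show ?case
    proof eventually_elim
      case (elim t)
      \<comment> \<open>The density is positive for nonnegative times, and \<open>f\<close> is zero
        for nonpositive ones.\<close>
      then show ?case using s0 outside(1)[of x t] by (auto simp: w_def laplace_density_def indicator_def split: if_splits)
    qed
  qed
qed

end

section \<open>Borel representatives and the drift\<close>

text \<open>Measurability of \<open>u\<close> is a conclusion: this handles the drift, which is not
  known to be Borel on the null set where some \<open>a = X j\<close>.\<close>

lemma borel_measurable_completion_AE:
  fixes u :: "'a \<Rightarrow> 'b::topological_space"
  assumes u': "u' \<in> borel_measurable M" and eq: "AE x in M. u x = u' x"
  shows "u \<in> borel_measurable (completion M)"
proof (rule measurableI)
  fix A :: "'b set" assume A: "A \<in> sets borel"
  show "u -` A \<inter> space (completion M) \<in> sets (completion M)"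
  proof (rule completion.in_sets_AE)
    show "u' -` A \<inter> space M \<in> sets (completion M)" using measurable_sets[OF u' A] by simp
    show "AE x in completion M. (x \<in> u' -` A \<inter> space M) = (x \<in> u -` A \<inter> space (completion M))"
      using AE_completion[OF eq] by eventually_elim simp
  qed auto
qed simp

lemma integral_completion_cong:
  fixes u :: "'a \<Rightarrow> 'b::{banach, second_countable_topology}"
  assumes "u' \<in> borel_measurable M" "AE x in M. u x = u' x"
  shows "integral\<^sup>L (completion M) u = integral\<^sup>L M u'"
    and "integrable (completion M) u \<longleftrightarrow> integrable M u'"
proof -
  have [measurable]: "u \<in> borel_measurable (completion M)" by (rule borel_measurable_completion_AE[OF assms])
  have [measurable]: "u' \<in> borel_measurable (completion M)" by (rule measurable_completion[OF assms(1)])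
  have eq: "AE x in completion M. u x = u' x" by (rule AE_completion[OF assms(2)])
  show "integral\<^sup>L (completion M) u = integral\<^sup>L M u'"
    using integral_cong_AE[OF _ _ eq] integral_completion[OF assms(1)] by simp
  show "integrable (completion M) u \<longleftrightarrow> integrable M u'"
    using integrable_cong_AE[OF _ _ eq] integrable_completion[OF assms(1)] by simp
qed

text \<open>The real-valued case is applied to each coordinate; finitely many null sets are
  discarded.\<close>

lemma completion_ex_borel_measurable_euclidean:
  fixes g :: "'a \<Rightarrow> 'b::euclidean_space"
  assumes g: "g \<in> borel_measurable (completion M)"
  shows "\<exists>g'\<in>borel_measurable M. AE x in M. g x = g' x"
proof -
  have "\<forall>b\<in>Basis. \<exists>h. h \<in> borel_measurable M \<and> (AE x in M. g x \<bullet> b = h x)"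
    using completion_ex_borel_measurable_real[of "\<lambda>x. g x \<bullet> b" M for b] g by auto
  from bchoice[OF this] obtain h where h: "\<And>b. b \<in> Basis \<Longrightarrow> h b \<in> borel_measurable M"
    "\<And>b. b \<in> Basis \<Longrightarrow> AE x in M. g x \<bullet> b = h b x"
    by blast
  have "AE x in M. \<forall>b\<in>Basis. g x \<bullet> b = h b x"
    using h(2) by (subst AE_ball_countable) (auto intro: countable_finite)
  then have "AE x in M. g x = (\<Sum>b\<in>Basis. h b x *\<^sub>R b)"
  proof eventually_elim
    case (elim x)
    then have "(\<Sum>b\<in>Basis. h b x *\<^sub>R b) = (\<Sum>b\<in>Basis. (g x \<bullet> b) *\<^sub>R b)" by simp
    then show ?case by (simp add: euclidean_representation)
  qed
  moreover have "(\<lambda>x. \<Sum>b\<in>Basis. h b x *\<^sub>R b) \<in> borel_measurable M"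
    using h(1) by (intro borel_measurable_sum borel_measurable_scaleR) auto
  ultimately show ?thesis by (intro bexI[of _ "\<lambda>x. \<Sum>b\<in>Basis. h b x *\<^sub>R b"])
qed

text \<open>The bridge from the completed and restricted measure of the problem to
  \<open>domain_measure\<close>: any integrand may be exchanged for a Borel function that agrees
  with it almost everywhere.\<close>

lemma space_measure_cong:
  fixes u :: "state \<Rightarrow> 'b::euclidean_space"
  assumes D: "open D" and u': "u' \<in> borel_measurable borel" and eq: "AE x in domain_measure D. u x = u' x"
  shows "integral\<^sup>L (space_measure D) u = integral\<^sup>L (domain_measure D) u'"
    and "integrable (space_measure D) u \<longleftrightarrow> integrable (domain_measure D) u'"
proof -
  let ?U = "misorientations \<times> D"
  have U [measurable]: "?U \<in> sets borel" by (rule domain_measurable[OF D])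
  have [measurable]: "u' \<in> borel_measurable state_measure" using u' by simp
  have sm: "space_measure D = restrict_space (completion state_measure) ?U"
    by (simp add: space_measure_def state_measure_def)
  have U': "?U \<inter> space (completion state_measure) \<in> sets (completion state_measure)"
    using U by simp
  have m: "(\<lambda>x. indicator ?U x *\<^sub>R u' x) \<in> borel_measurable state_measure" by measurable
  have "AE x in state_measure. x \<in> ?U \<longrightarrow> u x = u' x" using eq by (simp only: AE_domain_measure_iff[OF D])
  then have e: "AE x in state_measure. indicator ?U x *\<^sub>R u x = indicator ?U x *\<^sub>R u' x"
    by eventually_elim (auto simp: indicator_def)
  show "integral\<^sup>L (space_measure D) u = integral\<^sup>L (domain_measure D) u'"
    using integral_completion_cong(1)[OF m e]
    by (simp add: sm integral_restrict_space[OF U'] integral_domain_measure[OF D u'])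
  show "integrable (space_measure D) u \<longleftrightarrow> integrable (domain_measure D) u'"
    using integral_completion_cong(2)[OF m e] integrable_density[of u' state_measure "indicator ?U"]
    by (simp add: sm integrable_restrict_space[OF U'] domain_measure_def ennreal_indicator)
qed

lemma AE_lebesgue_on_pos: "(AE t in lebesgue_on {0<..}. P t) \<longleftrightarrow> (AE t in lborel. (0::real) < t \<longrightarrow> P t)"
  by (subst AE_restrict_space_iff) (auto simp: AE_completion_iff)

interpretation state_lborel: pair_sigma_finite state_measure "lborel :: real measure"
  using sigma_finite_state_measure lborel.sigma_finite_measure_axioms by (simp add: pair_sigma_finite_def)

lemma spacetime_measure_eq:
  "spacetime_measure D = restrict_space (completion (state_measure \<Otimes>\<^sub>M lborel)) ((misorientations \<times> D) \<times> {0<..})"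
  by (simp add: spacetime_measure_def state_measure_def)

lemma sets_state_lborel [simp]: "sets (state_measure \<Otimes>\<^sub>M (lborel :: real measure)) = sets borel"
proof -
  have "sets (state_measure \<Otimes>\<^sub>M (lborel :: real measure)) = sets (borel \<Otimes>\<^sub>M borel)"
    by (rule sets_pair_measure_cong) auto
  then show ?thesis by (simp only: borel_prod)
qed

lemma cylinder_measurable:
  assumes "open D"
  shows "(misorientations \<times> D) \<times> {0<..} \<in> sets (borel :: (state \<times> real) measure)"
  by (rule borel_Times[OF domain_measurable[OF assms]]) simp

text \<open>Two forms of agreement are needed: on space-time for the final conclusion, and on almost
  every time slice for the integrals over states.\<close>

lemma spacetime_borel_version:
  fixes u :: "state \<times> real \<Rightarrow> 'b::euclidean_space"
  assumes D: "open D" and u: "u \<in> borel_measurable (spacetime_measure D)"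
  obtains u' where "u' \<in> borel_measurable borel" "\<And>x t. x \<notin> misorientations \<times> D \<or> t \<le> 0 \<Longrightarrow> u' (x, t) = 0"
    "AE z in state_measure \<Otimes>\<^sub>M lborel. z \<in> (misorientations \<times> D) \<times> {0<..} \<longrightarrow> u z = u' z"
    "AE t in lborel. 0 < t \<longrightarrow> (AE x in domain_measure D. u (x, t) = u' (x, t))"
proof -
  let ?S = "(misorientations \<times> D) \<times> {0<..} :: (state \<times> real) set"
  let ?P = "state_measure \<Otimes>\<^sub>M (lborel :: real measure)"
  have S [measurable]: "?S \<in> sets borel" by (rule cylinder_measurable[OF D])
  have "?S \<in> sets (completion ?P)"
    by (rule sets_completionI_sets) (simp only: sets_state_lborel S)
  then have S': "?S \<inter> space (completion ?P) \<in> sets (completion ?P)"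
    by (rule sets.Int[OF _ sets.top])
  have "(\<lambda>z. indicator ?S z *\<^sub>R u z) \<in> borel_measurable (completion ?P)"
    using u borel_measurable_restrict_space_iff[OF S', of u] by (simp add: spacetime_measure_eq)
  then obtain h where h: "h \<in> borel_measurable ?P" "AE z in ?P. indicator ?S z *\<^sub>R u z = h z"
    using completion_ex_borel_measurable_euclidean by blast
  have hb [measurable]: "h \<in> borel_measurable borel"
    using h(1) unfolding measurable_cong_sets[OF sets_state_lborel refl] .
  define u' where "u' z = indicator ?S z *\<^sub>R h z" for z
  have m: "u' \<in> borel_measurable borel" unfolding u'_def by measurable
  have eq: "AE z in ?P. z \<in> ?S \<longrightarrow> u z = u' z"
    using h(2) by eventually_elim (auto simp: u'_def indicator_def)
  \<comment> \<open>The set where \<open>u\<close> and \<open>u'\<close> differ need not be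
    measurable in the product; Fubini is applied to a measurable null set containing it.\<close>
  obtain N where N: "\<And>z. z \<in> space ?P - N \<Longrightarrow> z \<in> ?S \<longrightarrow> u z = u' z" "N \<in> null_sets ?P"
    using AE_E3[OF eq] by blast
  have sp: "space ?P = UNIV" by (simp add: space_pair_measure)
  have "AE z in ?P. z \<notin> N" using N(2) by (rule AE_not_in)
  then have ae: "AE x in state_measure. AE t in lborel. (x, t) \<notin> N" by (rule state_lborel.AE_pair)
  have "{z \<in> space ?P. (fst z, snd z) \<notin> N} = UNIV - N" using sp by auto
  also have "\<dots> \<in> sets ?P" using N(2) sets.compl_sets[of N ?P] sp by auto
  finally have "AE t in lborel. AE x in state_measure. (x, t) \<notin> N"
    using state_lborel.AE_commute[of "\<lambda>x t. (x, t) \<notin> N"] ae by simp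
  then have ae': "AE t in lborel. 0 < t \<longrightarrow> (AE x in domain_measure D. u (x, t) = u' (x, t))"
  proof eventually_elim
    case (elim t)
    show ?case
    proof
      assume t: "0 < t"
      from elim have "AE x in state_measure. x \<in> misorientations \<times> D \<longrightarrow> u (x, t) = u' (x, t)"
      proof eventually_elim
        case (elim x)
        then show ?case using N(1)[of "(x, t)"] t sp by simp
      qed
      then show "AE x in domain_measure D. u (x, t) = u' (x, t)" by (simp only: AE_domain_measure_iff[OF D])
    qed
  qed
  show ?thesis
    by (rule that[OF m _ eq ae']) (auto simp: u'_def indicator_def)
qed

text \<open>Makes the points \<open>X j\<close> negligible, where the energy may fail to be
  differentiable in \<open>a\<close>.\<close>

lemma AE_snd_neq: "AE x in state_measure. snd x \<noteq> c"
proof -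
  have "{x \<in> space (plane_measure \<Otimes>\<^sub>M lborel). snd x \<noteq> c} \<in> sets (plane_measure \<Otimes>\<^sub>M (lborel :: (real^2) measure))"
    by measurable
  moreover have "AE \<theta> in plane_measure. AE a in lborel. snd (\<theta>, a) \<noteq> c"
    using AE_lborel_singleton[of c] by simp
  ultimately show ?thesis unfolding state_measure_def by (rule plane_lborel.AE_pair_measure)
qed

section \<open>Gradients of the energy and a bounded Borel version of the drift\<close>

lemma energy_theta_grad:
  assumes \<sigma>: "\<And>s. (\<sigma> has_real_derivative \<sigma>' s) (at s)"
  shows "grad (\<lambda>\<theta>. energy \<sigma> X \<theta> a) \<theta> = (\<chi> k. \<sigma>' (\<theta> $ k) * norm (a - X k))"
proof -
  have c: "((\<lambda>\<theta>::real^3. \<theta> $ j) has_derivative (\<lambda>h. h $ j)) (at \<theta>)" for j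
    by (rule bounded_linear_imp_has_derivative) (rule bounded_linear_vec_nth)
  have "((\<lambda>\<theta>. energy \<sigma> X \<theta> a) has_derivative (\<lambda>h. \<Sum>j\<in>UNIV. \<sigma>' (\<theta> $ j) * h $ j * norm (a - X j))) (at \<theta>)"
    unfolding energy_def
    using has_derivative_compose[OF c \<sigma>[unfolded has_field_derivative_def]]
    by (intro has_derivative_sum has_derivative_mult_left) (simp add: mult.commute)
  then have "frechet_derivative (\<lambda>\<theta>. energy \<sigma> X \<theta> a) (at \<theta>) = (\<lambda>h. \<Sum>j\<in>UNIV. \<sigma>' (\<theta> $ j) * h $ j * norm (a - X j))"
    by (rule frechet_derivative_at[symmetric])
  moreover have "(\<Sum>j\<in>UNIV. \<sigma>' (\<theta> $ j) * axis k 1 $ j * norm (a - X j)) = \<sigma>' (\<theta> $ k) * norm (a - X k)" for k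
    by (subst sum.remove[of _ k]) (auto simp: axis_def intro!: sum.neutral)
  ultimately show ?thesis by (simp add: grad_def)
qed

lemma energy_a_grad:
  assumes "\<And>j. a \<noteq> X j"
  shows "grad (\<lambda>a. energy \<sigma> X \<theta> a) a = (\<Sum>j\<in>UNIV. \<sigma> (\<theta> $ j) *\<^sub>R (inverse (norm (a - X j)) *\<^sub>R (a - X j)))"
proof -
  have "((\<lambda>a. norm (a - X j)) has_derivative (\<lambda>h. h \<bullet> sgn (a - X j))) (at a)" for j
  proof -
    have "((\<lambda>a. a - X j) has_derivative (\<lambda>h. h)) (at a)" by (auto intro!: derivative_eq_intros)
    from has_derivative_compose[OF this has_derivative_norm] show ?thesis using assms[of j] by simp
  qed
  then have "((\<lambda>a. energy \<sigma> X \<theta> a) has_derivative (\<lambda>h. \<Sum>j\<in>UNIV. \<sigma> (\<theta> $ j) * (h \<bullet> sgn (a - X j)))) (at a)"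
    unfolding energy_def by (intro has_derivative_sum has_derivative_mult_right)
  then have "frechet_derivative (\<lambda>a. energy \<sigma> X \<theta> a) (at a) = (\<lambda>h. \<Sum>j\<in>UNIV. \<sigma> (\<theta> $ j) * (h \<bullet> sgn (a - X j)))"
    by (rule frechet_derivative_at[symmetric])
  then show ?thesis
    by (simp add: grad_def vec_eq_iff sgn_div_norm inner_axis' sum_component mult.assoc)
qed

text \<open>The \<theta>-part is continuous because \<sigma> is of class C^1, hence bounded on the
  bounded domain. The \<open>a\<close>-part combines unit vectors with the bounded coefficients
  \<sigma>, so it is bounded as well, with singular points only at the \<open>X j\<close>.\<close>

lemma drift_version:
  assumes D: "open D" "bounded D" and \<sigma>: "\<sigma> C1_differentiable_on UNIV"
  obtains v :: "state \<Rightarrow> state" and V where "v \<in> borel_measurable borel" "\<And>x. norm (v x) \<le> V"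
    "AE x in domain_measure D. v x = (drift_theta \<gamma> \<sigma> X (fst x) (snd x), drift_a \<eta> \<sigma> X (fst x) (snd x))"
proof -
  let ?U = "misorientations \<times> D"
  have U [measurable]: "?U \<in> sets borel" by (rule domain_measurable[OF D(1)])
  have bU: "bounded ?U" by (rule bounded_Times[OF bounded_misorientations D(2)])
  obtain \<sigma>' where "\<forall>s\<in>UNIV. (\<sigma> has_vector_derivative \<sigma>' s) (at s)" and c': "continuous_on UNIV \<sigma>'"
    using \<sigma> unfolding C1_differentiable_on_def by blast
  then have \<sigma>': "(\<sigma> has_real_derivative \<sigma>' s) (at s)" for s
    by (simp add: has_real_derivative_iff_has_vector_derivative)
  have c: "continuous_on UNIV \<sigma>"
    using DERIV_isCont[OF \<sigma>'] by (simp add: continuous_on_eq_continuous_at)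
  define vt where "vt x = - (3 * \<gamma>) *\<^sub>R ((mat 1 - (1/3) *\<^sub>R (\<chi> i j. 1)) *v (\<chi> k. \<sigma>' (fst x $ k) * norm (snd x - X k)))" for x :: state
  \<comment> \<open>At \<open>snd x = X j\<close> the convention \<open>inverse 0 = 0\<close> makes
    the summand zero, so the formula is Borel and its vectors have norm at most 1
    everywhere.\<close>
  define va where "va x = - \<eta> *\<^sub>R (\<Sum>j\<in>UNIV. \<sigma> (fst x $ j) *\<^sub>R (inverse (norm (snd x - X j)) *\<^sub>R (snd x - X j)))" for x :: state
  have cp: "continuous_on UNIV (\<lambda>x::state. fst x $ k)" for k by (intro continuous_intros)
  have cs: "continuous_on UNIV (\<lambda>x::state. \<sigma> (fst x $ k))" "continuous_on UNIV (\<lambda>x::state. \<sigma>' (fst x $ k))" for k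
    using continuous_on_compose2[OF c cp] continuous_on_compose2[OF c' cp] by auto
  have ct: "continuous_on UNIV vt"
    unfolding vt_def
    by (intro continuous_on_scaleR continuous_on_const linear_continuous_on_compose[OF _ matrix_vector_mul_linear]
        continuous_on_vec_lambda continuous_on_mult cs continuous_intros)
  have [measurable]: "vt \<in> borel_measurable borel" using ct by (rule borel_measurable_continuous_onI)
  have [measurable]: "(\<lambda>x::state. \<sigma> (fst x $ k)) \<in> borel_measurable borel" for k
    using cs(1) by (rule borel_measurable_continuous_onI)
  have [measurable]: "(\<lambda>x::state. snd x) \<in> borel_measurable borel"
    by (intro borel_measurable_continuous_onI continuous_intros)
  have [measurable]: "va \<in> borel_measurable borel" unfolding va_def by measurable
  obtain B1 where B1: "\<And>x. x \<in> ?U \<Longrightarrow> norm (vt x) \<le> B1" using continuous_norm_bounded_on[OF ct bU] by blast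
  have "continuous_on UNIV (\<lambda>x::state. \<Sum>j\<in>UNIV. \<bar>\<sigma> (fst x $ j)\<bar>)" by (intro continuous_intros cs)
  then obtain B2 where B2: "\<And>x. x \<in> ?U \<Longrightarrow> norm (\<Sum>j\<in>UNIV. \<bar>\<sigma> (fst x $ j)\<bar>) \<le> B2"
    using continuous_norm_bounded_on[OF _ bU] by blast
  have va_le: "norm (va x) \<le> \<bar>\<eta>\<bar> * norm (\<Sum>j\<in>UNIV. \<bar>\<sigma> (fst x $ j)\<bar>)" for x
  proof -
    have "norm (\<Sum>j\<in>UNIV. \<sigma> (fst x $ j) *\<^sub>R (inverse (norm (snd x - X j)) *\<^sub>R (snd x - X j))) \<le> (\<Sum>j\<in>UNIV. \<bar>\<sigma> (fst x $ j)\<bar>)"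
    proof (rule sum_norm_le)
      fix j :: 3
      have "norm (inverse (norm (snd x - X j)) *\<^sub>R (snd x - X j)) \<le> 1"
        by (cases "snd x = X j") auto
      from mult_left_mono[OF this abs_ge_zero[of "\<sigma> (fst x $ j)"]]
      show "norm (\<sigma> (fst x $ j) *\<^sub>R (inverse (norm (snd x - X j)) *\<^sub>R (snd x - X j))) \<le> \<bar>\<sigma> (fst x $ j)\<bar>"
        by (simp only: norm_scaleR mult_1_right real_norm_def)
    qed
    then have "norm (\<Sum>j\<in>UNIV. \<sigma> (fst x $ j) *\<^sub>R (inverse (norm (snd x - X j)) *\<^sub>R (snd x - X j))) \<le> norm (\<Sum>j\<in>UNIV. \<bar>\<sigma> (fst x $ j)\<bar>)"
      by (simp add: order_trans[OF _ abs_ge_self])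
    from mult_left_mono[OF this abs_ge_zero[of \<eta>]] show ?thesis by (simp add: va_def)
  qed
  \<comment> \<open>Cutting off outside the domain turns the bound on the domain into a global
    one.\<close>
  define v where "v x = indicator ?U x *\<^sub>R (vt x, va x)" for x
  show ?thesis
  proof (rule that[of v "\<bar>B1\<bar> + \<bar>\<eta>\<bar> * \<bar>B2\<bar>"])
    have "(\<lambda>x. (vt x, va x)) \<in> borel \<rightarrow>\<^sub>M borel \<Otimes>\<^sub>M borel" by measurable
    then have [measurable]: "(\<lambda>x. (vt x, va x)) \<in> borel_measurable borel" by (simp add: borel_prod)
    show "v \<in> borel_measurable borel" unfolding v_def[abs_def] by measurable
    show "norm (v x) \<le> \<bar>B1\<bar> + \<bar>\<eta>\<bar> * \<bar>B2\<bar>" for x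
    proof (cases "x \<in> ?U")
      case True
      have "norm (v x) \<le> norm (vt x) + norm (va x)" using True by (simp add: v_def norm_Pair_le)
      also have "\<dots> \<le> \<bar>B1\<bar> + \<bar>\<eta>\<bar> * \<bar>B2\<bar>"
        by (intro add_mono order_trans[OF B1[OF True] abs_ge_self] order_trans[OF va_le] mult_left_mono
            order_trans[OF B2[OF True] abs_ge_self]) simp
      finally show ?thesis .
    qed (simp add: v_def)
    have "AE x in state_measure. \<forall>j. snd x \<noteq> X j"
      using AE_snd_neq by (simp add: AE_all_countable)
    then have "AE x in state_measure. x \<in> ?U \<longrightarrow> v x = (drift_theta \<gamma> \<sigma> X (fst x) (snd x), drift_a \<eta> \<sigma> X (fst x) (snd x))"
    proof eventually_elim
      case (elim x)
      show ?case
        using elim by (simp add: v_def drift_theta_def drift_a_def tangential_grad_def energy_theta_grad[OF \<sigma>'] energy_a_grad vt_def va_def)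
    qed
    then show "AE x in domain_measure D. v x = (drift_theta \<gamma> \<sigma> X (fst x) (snd x), drift_a \<eta> \<sigma> X (fst x) (snd x))"
      by (simp only: AE_domain_measure_iff[OF D(1)])
  qed
qed

section \<open>Time slices of Borel representatives and assembly of the uniqueness result\<close>

lemma slice_square_integrable:
  fixes u u' :: "state \<times> real \<Rightarrow> 'b::euclidean_space"
  assumes D: "open D" and u' [measurable]: "u' \<in> borel_measurable borel" and zero: "\<forall>x. \<forall>t\<le>0. u' (x, t) = 0"
    and eq: "AE t in lborel. 0 < t \<longrightarrow> (AE x in domain_measure D. u (x, t) = u' (x, t))"
    and sq: "AE t in lebesgue_on {0<..}. square_integrable (space_measure D) (\<lambda>x. u (x, t))"
  shows "AE t in lborel. integrable (domain_measure D) (\<lambda>x. (norm (u' (x, t)))\<^sup>2)"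
    and "AE t in lborel. 0 < t \<longrightarrow> (LINT x|space_measure D. (norm (u (x, t)))\<^sup>2) = (LINT x|domain_measure D. (norm (u' (x, t)))\<^sup>2)"
proof -
  have [measurable]: "(\<lambda>x. u' (x, t)) \<in> borel_measurable borel" for t
  proof -
    have [measurable]: "u' \<in> borel_measurable (borel \<Otimes>\<^sub>M borel)" by (simp add: borel_prod)
    show ?thesis by measurable
  qed
  have c: "(LINT x|space_measure D. (norm (u (x, t)))\<^sup>2) = (LINT x|domain_measure D. (norm (u' (x, t)))\<^sup>2)"
    "integrable (space_measure D) (\<lambda>x. (norm (u (x, t)))\<^sup>2) \<longleftrightarrow> integrable (domain_measure D) (\<lambda>x. (norm (u' (x, t)))\<^sup>2)"
    if "AE x in domain_measure D. u (x, t) = u' (x, t)" for t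
  proof -
    have e: "AE x in domain_measure D. (norm (u (x, t)))\<^sup>2 = (norm (u' (x, t)))\<^sup>2"
      using that by eventually_elim simp
    show "(LINT x|space_measure D. (norm (u (x, t)))\<^sup>2) = (LINT x|domain_measure D. (norm (u' (x, t)))\<^sup>2)"
      "integrable (space_measure D) (\<lambda>x. (norm (u (x, t)))\<^sup>2) \<longleftrightarrow> integrable (domain_measure D) (\<lambda>x. (norm (u' (x, t)))\<^sup>2)"
      by (rule space_measure_cong[OF D _ e]; measurable)+
  qed
  show "AE t in lborel. 0 < t \<longrightarrow> (LINT x|space_measure D. (norm (u (x, t)))\<^sup>2) = (LINT x|domain_measure D. (norm (u' (x, t)))\<^sup>2)"
    using eq by eventually_elim (use c(1) in blast)
  show "AE t in lborel. integrable (domain_measure D) (\<lambda>x. (norm (u' (x, t)))\<^sup>2)"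
    using eq sq[unfolded AE_lebesgue_on_pos]
  proof eventually_elim
    case (elim t)
    have "u' (x, t) = 0" if "\<not> t > 0" for x using zero that by (simp del: split_paired_All)
    then show ?case using elim c(2)[of t] by (cases "t > 0") (auto simp: square_integrable_def)
  qed
qed

lemma slice_norm_integrable:
  fixes u u' :: "state \<times> real \<Rightarrow> 'b::euclidean_space"
  assumes D: "open D" "bounded D" and u' [measurable]: "u' \<in> borel_measurable borel" and zero: "\<forall>x. \<forall>t\<le>0. u' (x, t) = 0"
    and eq: "AE t in lborel. 0 < t \<longrightarrow> (AE x in domain_measure D. u (x, t) = u' (x, t))"
    and u: "in_L2_L2 D u"
  shows "integrable lborel (\<lambda>t. LINT x|domain_measure D. (norm (u' (x, t)))\<^sup>2)"
proof -
  interpret M: finite_measure "domain_measure D" by (rule finite_domain_measure[OF D])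
  have [measurable]: "u' \<in> borel_measurable (borel \<Otimes>\<^sub>M borel)" using u' by (simp add: borel_prod)
  have sq: "AE t in lebesgue_on {0<..}. square_integrable (space_measure D) (\<lambda>x. u (x, t))"
    and i: "integrable (lebesgue_on {0<..}) (\<lambda>t. LINT x|space_measure D. (norm (u (x, t)))\<^sup>2)"
    using u by (auto simp: in_L2_L2_def)
  have "integrable lebesgue (\<lambda>t. indicator {0<..} t *\<^sub>R (LINT x|space_measure D. (norm (u (x, t)))\<^sup>2))"
    using i by (subst (asm) integrable_restrict_space) auto
  moreover have e: "AE t in lborel. indicator {0<..} t *\<^sub>R (LINT x|space_measure D. (norm (u (x, t)))\<^sup>2) = (LINT x|domain_measure D. (norm (u' (x, t)))\<^sup>2)"
    using slice_square_integrable(2)[OF D(1) u' zero eq sq]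
  proof eventually_elim
    case (elim t)
    have "u' (x, t) = 0" if "\<not> t > 0" for x using zero that by (simp del: split_paired_All)
    then show ?case using elim by (cases "t > 0") auto
  qed
  moreover have m: "(\<lambda>t. LINT x|domain_measure D. (norm (u' (x, t)))\<^sup>2) \<in> borel_measurable lborel" by measurable
  ultimately show ?thesis using integral_completion_cong(2)[OF m e] by blast
qed

text \<open>It remains to pass from completed measures and almost-everywhere slices to Borel
  representatives that vanish outside the cylinder, for which the assumptions of
  \<open>weak_evolution\<close> can be verified.\<close>

theorem proposition3p4:
  fixes \<gamma> \<eta> \<beta>\<theta> \<beta>a :: real
    and \<sigma> :: "real \<Rightarrow> real"
    and X :: "3 \<Rightarrow> real^2"
    and D :: "(real^2) set"
    and f :: "((real^3) \<times> (real^2)) \<times> real \<Rightarrow> real"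
  assumes "\<gamma> > 0" and "\<eta> > 0" and "\<beta>\<theta> > 0" and "\<beta>a > 0"
    and "6 * \<gamma> / \<beta>\<theta>\<^sup>2 = 2 * \<eta> / \<beta>a\<^sup>2"
    and "open D" and "connected D" and "D \<noteq> {}" and "bounded D" and "C2_boundary D"
    and "\<sigma> C1_differentiable_on UNIV"
    and "weak_solution \<gamma> \<eta> \<beta>\<theta> \<beta>a \<sigma> X D (\<lambda>_. 0) f"
  shows "AE z in spacetime_measure D. f z = 0"
proof -
  let ?M = "domain_measure D" and ?U = "misorientations \<times> D"
  let ?c1 = "\<beta>\<theta>\<^sup>2 / 2" and ?c2 = "\<beta>a\<^sup>2 / 2"
  note D = \<open>open D\<close> and Db = \<open>bounded D\<close>
  interpret M: finite_measure ?M by (rule finite_domain_measure[OF D Db])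
  have U [measurable]: "?U \<in> sets borel" by (rule domain_measurable[OF D])
  have bU: "bounded ?U" by (rule bounded_Times[OF bounded_misorientations Db])
  have ws: "weak_solution \<gamma> \<eta> \<beta>\<theta> \<beta>a \<sigma> X D (\<lambda>_. 0) f" by fact
  then have Linf: "in_Linf_L2 D f" by (simp add: weak_solution_def)
  from ws obtain G H where G: "in_L2_L2 D G" and H: "in_L2_L2 D H"
    and wg: "AE t in lebesgue_on {0<..}. has_weak_gradients D (\<lambda>x. f (x, t)) (\<lambda>x. G (x, t)) (\<lambda>x. H (x, t))"
    and we: "\<And>\<phi>. smooth \<phi> \<Longrightarrow> AE T in lebesgue_on {0<..}.
              (LINT x|space_measure D. f (x, T) * \<phi> (x, T))
              - (LINT t:{0<..<T}|lebesgue. (LINT x|space_measure D. f (x, t) * deriv (\<lambda>s. \<phi> (x, s)) t))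
              + (LINT t:{0<..<T}|lebesgue.
                   (LINT (\<theta>, a)|space_measure D.
                      (?c1 *\<^sub>R G ((\<theta>, a), t) - f ((\<theta>, a), t) *\<^sub>R drift_theta \<gamma> \<sigma> X \<theta> a)
                        \<bullet> tangential_grad (\<lambda>\<theta>'. \<phi> ((\<theta>', a), t)) \<theta>
                      + (?c2 *\<^sub>R H ((\<theta>, a), t) - f ((\<theta>, a), t) *\<^sub>R drift_a \<eta> \<sigma> X \<theta> a)
                        \<bullet> grad (\<lambda>a'. \<phi> ((\<theta>, a'), t)) a))
              = (LINT x|space_measure D. 0 * \<phi> (x, 0))"
    unfolding weak_solution_def by blast
  obtain C where C: "AE t in lebesgue_on {0<..}. square_integrable (space_measure D) (\<lambda>x. f (x, t)) \<and>
        (LINT x|space_measure D. (norm (f (x, t)))\<^sup>2) \<le> C"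
    using Linf unfolding in_Linf_L2_def by blast
  have fm: "f \<in> borel_measurable (spacetime_measure D)" and Gm: "G \<in> borel_measurable (spacetime_measure D)"
    and Hm: "H \<in> borel_measurable (spacetime_measure D)"
    using Linf G H by (auto simp: in_Linf_L2_def in_L2_L2_def)
  obtain f' where f' [measurable]: "f' \<in> borel_measurable borel" and f0: "\<And>x t. x \<notin> ?U \<or> t \<le> 0 \<Longrightarrow> f' (x, t) = 0"
    and fz: "AE z in state_measure \<Otimes>\<^sub>M lborel. z \<in> ?U \<times> {0<..} \<longrightarrow> f z = f' z"
    and fe: "AE t in lborel. 0 < t \<longrightarrow> (AE x in ?M. f (x, t) = f' (x, t))"
    by (rule spacetime_borel_version[OF D fm]) blast
  obtain G1 where G1 [measurable]: "G1 \<in> borel_measurable borel" and G0: "\<And>x t. x \<notin> ?U \<or> t \<le> 0 \<Longrightarrow> G1 (x, t) = 0"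
    and Ge: "AE t in lborel. 0 < t \<longrightarrow> (AE x in ?M. G (x, t) = G1 (x, t))"
    by (rule spacetime_borel_version[OF D Gm]) blast
  obtain H1 where H1 [measurable]: "H1 \<in> borel_measurable borel" and H0: "\<And>x t. x \<notin> ?U \<or> t \<le> 0 \<Longrightarrow> H1 (x, t) = 0"
    and He: "AE t in lborel. 0 < t \<longrightarrow> (AE x in ?M. H (x, t) = H1 (x, t))"
    by (rule spacetime_borel_version[OF D Hm]) blast
  \<comment> \<open>The two partial gradients become one vector in R^5, as \<open>kgrad\<close> does
    for test functions.\<close>
  define G' where "G' z = (G1 z, H1 z)" for z
  have "G' \<in> borel \<rightarrow>\<^sub>M borel \<Otimes>\<^sub>M borel" unfolding G'_def by measurable
  then have G' [measurable]: "G' \<in> borel_measurable borel" by (simp add: borel_prod)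
  obtain v V where v [measurable]: "v \<in> borel_measurable borel" and V: "\<And>x. norm (v x) \<le> V"
    and ve: "AE x in ?M. v x = (drift_theta \<gamma> \<sigma> X (fst x) (snd x), drift_a \<eta> \<sigma> X (fst x) (snd x))"
    using drift_version[OF D Db \<open>\<sigma> C1_differentiable_on UNIV\<close>] by blast
  have [measurable]: "(\<lambda>x. f' (x, t)) \<in> borel_measurable borel" "(\<lambda>x. G1 (x, t)) \<in> borel_measurable borel"
    "(\<lambda>x. H1 (x, t)) \<in> borel_measurable borel" "(\<lambda>x. G' (x, t)) \<in> borel_measurable borel" for t
    using measurable_compose[OF measurable_Pair2'[of t borel borel], unfolded borel_prod] f' G1 H1 G' by simp_all
  have [measurable]: "f' \<in> borel_measurable (borel \<Otimes>\<^sub>M borel)" "G' \<in> borel_measurable (borel \<Otimes>\<^sub>M borel)"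
    using f' G' by (simp_all add: borel_prod)
  have fsq: "AE t in lebesgue_on {0<..}. square_integrable (space_measure D) (\<lambda>x. f (x, t))"
    using C by eventually_elim simp
  have zero: "\<forall>x. \<forall>t\<le>0. f' (x, t) = 0" "\<forall>x. \<forall>t\<le>0. G1 (x, t) = 0" "\<forall>x. \<forall>t\<le>0. H1 (x, t) = 0"
    using f0 G0 H0 by blast+
  note f_slice = slice_square_integrable[OF D f' zero(1) fe fsq]
  have Gsq: "AE t in lebesgue_on {0<..}. square_integrable (space_measure D) (\<lambda>x. G (x, t))"
    and Hsq: "AE t in lebesgue_on {0<..}. square_integrable (space_measure D) (\<lambda>x. H (x, t))"
    using G H by (auto simp: in_L2_L2_def)
  note G_slice = slice_square_integrable(1)[OF D G1 zero(2) Ge Gsq]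
  note H_slice = slice_square_integrable(1)[OF D H1 zero(3) He Hsq]
  have normG': "(norm (G' z))\<^sup>2 = (norm (G1 z))\<^sup>2 + (norm (H1 z))\<^sup>2" for z
    by (simp add: G'_def norm_prod_def)
  \<comment> \<open>The maximum with 0 covers nonpositive times, where the representative vanishes
    and the bound must be nonnegative.\<close>
  have bnd1: "AE t in lborel. integrable ?M (\<lambda>x. (norm (f' (x, t)))\<^sup>2) \<and> (LINT x|?M. (norm (f' (x, t)))\<^sup>2) \<le> max C 0"
    using f_slice(1) f_slice(2) C[unfolded AE_lebesgue_on_pos]
  proof eventually_elim
    case (elim t)
    have "f' (x, t) = 0" if "\<not> t > 0" for x using zero(1) that by (simp del: split_paired_All)
    then show ?case using elim by (cases "t > 0") auto
  qed
  have bnd2: "AE t in lborel. integrable ?M (\<lambda>x. (norm (G' (x, t)))\<^sup>2)"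
    using G_slice H_slice
  proof eventually_elim
    case (elim t) then show ?case by (simp add: normG')
  qed
  have bnd3: "integrable lborel (\<lambda>t. LINT x|?M. (norm (G' (x, t)))\<^sup>2)"
  proof (rule integrable_cong_AE_imp)
    show "integrable lborel (\<lambda>t. (LINT x|?M. (norm (G1 (x, t)))\<^sup>2) + (LINT x|?M. (norm (H1 (x, t)))\<^sup>2))"
      by (intro Bochner_Integration.integrable_add slice_norm_integrable[OF D Db G1 zero(2) Ge G] slice_norm_integrable[OF D Db H1 zero(3) He H])
    show "AE t in lborel. (LINT x|?M. (norm (G1 (x, t)))\<^sup>2) + (LINT x|?M. (norm (H1 (x, t)))\<^sup>2) = (LINT x|?M. (norm (G' (x, t)))\<^sup>2)"
      using G_slice H_slice
    proof eventually_elim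
      case (elim t) then show ?case by (simp add: normG')
    qed
  qed measurable
  have grad_eq: "AE t in lborel. \<forall>\<psi> K. smooth \<psi> \<longrightarrow> compact K \<longrightarrow> K \<subseteq> ?U \<longrightarrow> (\<forall>x\<in>?U - K. \<psi> x = 0) \<longrightarrow>
        (LINT x|?M. f' (x, t) *\<^sub>R kgrad \<psi> x) = - (LINT x|?M. \<psi> x *\<^sub>R G' (x, t))"
    using wg[unfolded AE_lebesgue_on_pos] fe Ge He bnd1 bnd2
  proof eventually_elim
    case (elim t)
    show ?case
    proof (intro allI impI)
      fix \<psi> :: "state \<Rightarrow> real" and K assume \<psi>: "smooth \<psi>" and K: "compact K" "K \<subseteq> ?U" "\<forall>x\<in>?U - K. \<psi> x = 0"
      show "(LINT x|?M. f' (x, t) *\<^sub>R kgrad \<psi> x) = - (LINT x|?M. \<psi> x *\<^sub>R G' (x, t))"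
      proof (cases "t > 0")
        case False
        then have "f' (x, t) = 0" "G' (x, t) = 0" for x
          using f0[of x t] G0[of x t] H0[of x t] by (auto simp: G'_def zero_prod_def)
        then show ?thesis by simp
      next
        case True
        note el = elim
        have [measurable]: "\<psi> \<in> borel_measurable borel" "kgrad \<psi> \<in> borel_measurable borel"
          using smooth_continuous_on[OF \<psi>] continuous_on_kgrad[OF \<psi>] by (auto intro: borel_measurable_continuous_onI)
        have [measurable]: "(\<lambda>x. fst (kgrad \<psi> x)) \<in> borel_measurable borel" "(\<lambda>x. snd (kgrad \<psi> x)) \<in> borel_measurable borel"
          using continuous_on_kgrad[OF \<psi>] by (auto intro!: borel_measurable_continuous_onI continuous_intros)
        have "test_function D \<psi>" using \<psi> K unfolding test_function_def by blast
        then have tf: "(LINT (\<theta>, a)|space_measure D. f ((\<theta>, a), t) *\<^sub>R tangential_grad (\<lambda>\<theta>'. \<psi> (\<theta>', a)) \<theta>)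
               = - (LINT x|space_measure D. \<psi> x *\<^sub>R G (x, t))"
            "(LINT (\<theta>, a)|space_measure D. f ((\<theta>, a), t) *\<^sub>R grad (\<lambda>a'. \<psi> (\<theta>, a')) a)
               = - (LINT x|space_measure D. \<psi> x *\<^sub>R H (x, t))"
          using el(1) True unfolding has_weak_gradients_def by auto
        have fa: "AE x in ?M. f (x, t) = f' (x, t)" and Ga: "AE x in ?M. G (x, t) = G1 (x, t)"
          and Ha: "AE x in ?M. H (x, t) = H1 (x, t)"
          using el True by auto
        have 1: "(LINT (\<theta>, a)|space_measure D. f ((\<theta>, a), t) *\<^sub>R tangential_grad (\<lambda>\<theta>'. \<psi> (\<theta>', a)) \<theta>)
            = (LINT x|?M. f' (x, t) *\<^sub>R fst (kgrad \<psi> x))"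
        proof (rule space_measure_cong(1)[OF D])
          show "AE x in ?M. (case x of (\<theta>, a) \<Rightarrow> f ((\<theta>, a), t) *\<^sub>R tangential_grad (\<lambda>\<theta>'. \<psi> (\<theta>', a)) \<theta>) = f' (x, t) *\<^sub>R fst (kgrad \<psi> x)"
            using fa by eventually_elim (auto simp: kgrad_def split: prod.split)
        qed measurable
        have 2: "(LINT (\<theta>, a)|space_measure D. f ((\<theta>, a), t) *\<^sub>R grad (\<lambda>a'. \<psi> (\<theta>, a')) a)
            = (LINT x|?M. f' (x, t) *\<^sub>R snd (kgrad \<psi> x))"
        proof (rule space_measure_cong(1)[OF D])
          show "AE x in ?M. (case x of (\<theta>, a) \<Rightarrow> f ((\<theta>, a), t) *\<^sub>R grad (\<lambda>a'. \<psi> (\<theta>, a')) a) = f' (x, t) *\<^sub>R snd (kgrad \<psi> x)"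
            using fa by eventually_elim (auto simp: kgrad_def split: prod.split)
        qed measurable
        have 3: "(LINT x|space_measure D. \<psi> x *\<^sub>R G (x, t)) = (LINT x|?M. \<psi> x *\<^sub>R G1 (x, t))"
        proof (rule space_measure_cong(1)[OF D])
          show "AE x in ?M. \<psi> x *\<^sub>R G (x, t) = \<psi> x *\<^sub>R G1 (x, t)" using Ga by eventually_elim simp
        qed measurable
        have 4: "(LINT x|space_measure D. \<psi> x *\<^sub>R H (x, t)) = (LINT x|?M. \<psi> x *\<^sub>R H1 (x, t))"
        proof (rule space_measure_cong(1)[OF D])
          show "AE x in ?M. \<psi> x *\<^sub>R H (x, t) = \<psi> x *\<^sub>R H1 (x, t)" using Ha by eventually_elim simp
        qed measurable
        have i1: "integrable ?M (\<lambda>x. f' (x, t) *\<^sub>R kgrad \<psi> x)"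
        proof -
          obtain B where B: "\<And>x. x \<in> ?U \<Longrightarrow> norm (kgrad \<psi> x) \<le> B"
            using continuous_norm_bounded_on[OF continuous_on_kgrad[OF \<psi>] bU] by blast
          have fi: "integrable ?M (\<lambda>x. f' (x, t))"
            by (rule norm_square_integrable_imp_integrable[OF M.finite_measure_axioms]) (use el in auto)
          show ?thesis
          proof (rule Bochner_Integration.integrable_bound)
            show "integrable ?M (\<lambda>x. \<bar>B\<bar> * norm (f' (x, t)))" using fi by simp
            have "norm (f' (x, t) *\<^sub>R kgrad \<psi> x) \<le> norm (\<bar>B\<bar> * norm (f' (x, t)))" for x
            proof (cases "x \<in> ?U")
              case True
              from mult_left_mono[OF order_trans[OF B[OF True] abs_ge_self] abs_ge_zero[of "f' (x, t)"]]
              show ?thesis by (simp add: mult.commute)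
            qed (simp add: f0)
            then show "AE x in ?M. norm (f' (x, t) *\<^sub>R kgrad \<psi> x) \<le> norm (\<bar>B\<bar> * norm (f' (x, t)))" by simp
          qed measurable
        qed
        have i2: "integrable ?M (\<lambda>x. \<psi> x *\<^sub>R G' (x, t))"
        proof -
          obtain B where B: "\<And>x. x \<in> ?U \<Longrightarrow> norm (\<psi> x) \<le> B"
            using continuous_norm_bounded_on[OF smooth_continuous_on[OF \<psi>] bU] by blast
          have gi: "integrable ?M (\<lambda>x. G' (x, t))"
            by (rule norm_square_integrable_imp_integrable[OF M.finite_measure_axioms]) (use el in auto)
          show ?thesis
          proof (rule Bochner_Integration.integrable_bound)
            show "integrable ?M (\<lambda>x. \<bar>B\<bar> * norm (G' (x, t)))" using gi by simp
            have "norm (\<psi> x *\<^sub>R G' (x, t)) \<le> norm (\<bar>B\<bar> * norm (G' (x, t)))" for x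
            proof (cases "x \<in> ?U")
              case True
              from mult_right_mono[OF order_trans[OF B[OF True] abs_ge_self] norm_ge_zero[of "G' (x, t)"]]
              show ?thesis by simp
            qed (simp add: G'_def G0 H0)
            then show "AE x in ?M. norm (\<psi> x *\<^sub>R G' (x, t)) \<le> norm (\<bar>B\<bar> * norm (G' (x, t)))" by simp
          qed measurable
        qed
        \<comment> \<open>The components of the vector identity are exactly the two identities of
          \<open>has_weak_gradients\<close>; projections commute with the integral once
          \<open>i1\<close> and \<open>i2\<close> are known.\<close>
        have "fst (LINT x|?M. f' (x, t) *\<^sub>R kgrad \<psi> x) = (LINT x|?M. f' (x, t) *\<^sub>R fst (kgrad \<psi> x))"
          "snd (LINT x|?M. f' (x, t) *\<^sub>R kgrad \<psi> x) = (LINT x|?M. f' (x, t) *\<^sub>R snd (kgrad \<psi> x))"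
          using integral_bounded_linear[OF bounded_linear_fst i1] integral_bounded_linear[OF bounded_linear_snd i1] by simp_all
        moreover have "fst (LINT x|?M. \<psi> x *\<^sub>R G' (x, t)) = (LINT x|?M. \<psi> x *\<^sub>R G1 (x, t))"
          "snd (LINT x|?M. \<psi> x *\<^sub>R G' (x, t)) = (LINT x|?M. \<psi> x *\<^sub>R H1 (x, t))"
          using integral_bounded_linear[OF bounded_linear_fst i2] integral_bounded_linear[OF bounded_linear_snd i2]
          by (simp_all add: G'_def)
        ultimately show ?thesis using tf 1 2 3 4 by (intro prod_eqI) simp_all
      qed
    qed
  qed
  have eqn: "AE T in lborel. 0 < T \<longrightarrow>
        (LINT x|?M. f' (x, T) * \<psi> x) + (LINT t|lborel. indicator {0<..<T} t *
          (LINT x|?M. (diffuse ?c1 ?c2 (G' (x, t)) - f' (x, t) *\<^sub>R v x) \<bullet> kgrad \<psi> x)) = 0" if \<psi>: "smooth \<psi>" for \<psi>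
  proof -
    have [measurable]: "\<psi> \<in> borel_measurable borel" "kgrad \<psi> \<in> borel_measurable borel"
      using smooth_continuous_on[OF \<psi>] continuous_on_kgrad[OF \<psi>] by (auto intro: borel_measurable_continuous_onI)
    \<comment> \<open>The test function is constant in time, so its time derivative vanishes and
      only the flux term is integrated over time.\<close>
    let ?\<phi> = "\<lambda>z :: state \<times> real. \<psi> (fst z)"
    let ?A = "\<lambda>t. LINT (\<theta>, a)|space_measure D.
                      (?c1 *\<^sub>R G ((\<theta>, a), t) - f ((\<theta>, a), t) *\<^sub>R drift_theta \<gamma> \<sigma> X \<theta> a)
                        \<bullet> tangential_grad (\<lambda>\<theta>'. \<psi> (\<theta>', a)) \<theta>
                      + (?c2 *\<^sub>R H ((\<theta>, a), t) - f ((\<theta>, a), t) *\<^sub>R drift_a \<eta> \<sigma> X \<theta> a)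
                        \<bullet> grad (\<lambda>a'. \<psi> (\<theta>, a')) a"
    let ?B = "\<lambda>t. LINT x|?M. (diffuse ?c1 ?c2 (G' (x, t)) - f' (x, t) *\<^sub>R v x) \<bullet> kgrad \<psi> x"
    have "smooth ?\<phi>" using smooth_affine[OF bounded_linear_fst \<psi>, of 0] by simp
    from we[OF this] have we': "AE T in lborel. 0 < T \<longrightarrow>
        (LINT x|space_measure D. f (x, T) * \<psi> x) + (LINT t:{0<..<T}|lebesgue. ?A t) = 0"
      unfolding AE_lebesgue_on_pos by simp
    have "AE t in lborel. 0 < t \<longrightarrow> ?A t = ?B t"
      using fe Ge He
    proof eventually_elim
      case (elim t)
      show ?case
      proof
        assume t: "0 < t"
        show "?A t = ?B t"
        proof (rule space_measure_cong(1)[OF D])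
          have fa: "AE x in ?M. f (x, t) = f' (x, t)" and Ga: "AE x in ?M. G (x, t) = G1 (x, t)"
            and Ha: "AE x in ?M. H (x, t) = H1 (x, t)"
            using elim t by auto
          show "AE x in ?M. (case x of (\<theta>, a) \<Rightarrow> (?c1 *\<^sub>R G ((\<theta>, a), t) - f ((\<theta>, a), t) *\<^sub>R drift_theta \<gamma> \<sigma> X \<theta> a)
                        \<bullet> tangential_grad (\<lambda>\<theta>'. \<psi> (\<theta>', a)) \<theta>
                      + (?c2 *\<^sub>R H ((\<theta>, a), t) - f ((\<theta>, a), t) *\<^sub>R drift_a \<eta> \<sigma> X \<theta> a)
                        \<bullet> grad (\<lambda>a'. \<psi> (\<theta>, a')) a)
              = (diffuse ?c1 ?c2 (G' (x, t)) - f' (x, t) *\<^sub>R v x) \<bullet> kgrad \<psi> x"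
            using fa Ga Ha ve
          proof eventually_elim
            case (elim x)
            obtain \<theta> a where x: "x = (\<theta>, a)" by (cases x)
            show ?case using elim unfolding x by (simp add: kgrad_def G'_def diffuse_def)
          qed
        qed measurable
      qed
    qed
    note AB = this
    have Bm: "?B \<in> borel_measurable borel" by measurable
    \<comment> \<open>\<open>?A\<close> is known only to agree with the Borel function
      \<open>?B\<close> at almost every positive time; passing to the completion covers its
      measurability.\<close>
    have int: "(LINT t:{0<..<T}|lebesgue. ?A t) = (LINT t|lborel. indicator {0<..<T} t * ?B t)" for T
      unfolding set_lebesgue_integral_def
    proof (rule integral_completion_cong(1))
      show "AE t in lborel. indicator {0<..<T} t *\<^sub>R ?A t = indicator {0<..<T} t * ?B t"
        using AB by eventually_elim (auto simp: indicator_def)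
      show "(\<lambda>t. indicator {0<..<T} t * ?B t) \<in> borel_measurable lborel"
        using Bm by (intro borel_measurable_times) auto
    qed
    show ?thesis using we' fe
    proof eventually_elim
      case (elim T)
      show ?case
      proof
        assume T: "0 < T"
        then have fa: "AE x in ?M. f (x, T) = f' (x, T)" using elim by simp
        have "(LINT x|space_measure D. f (x, T) * \<psi> x) = (LINT x|?M. f' (x, T) * \<psi> x)"
        proof (rule space_measure_cong(1)[OF D])
          show "AE x in ?M. f (x, T) * \<psi> x = f' (x, T) * \<psi> x" using fa by eventually_elim simp
        qed measurable
        then show "(LINT x|?M. f' (x, T) * \<psi> x) + (LINT t|lborel. indicator {0<..<T} t * ?B t) = 0"
          using elim(1) T int by simp
      qed
    qed
  qed
  interpret E: weak_evolution ?M ?U f' G' v ?c1 ?c2 "max C 0" V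
  proof
    show "sets ?M = sets borel" by simp
    show "?U \<in> sets borel" by (rule U)
    show "bounded ?U" by (rule bU)
    show "f' \<in> borel_measurable borel" "G' \<in> borel_measurable borel" "v \<in> borel_measurable borel"
      by (rule f' G' v)+
    show "norm (v x) \<le> V" for x by (rule V)
    show "0 < ?c1" "0 < ?c2" using \<open>\<beta>\<theta> > 0\<close> \<open>\<beta>a > 0\<close> by simp_all
    show "f' (x, t) = 0" if "x \<notin> ?U \<or> t \<le> 0" for x t by (rule f0[OF that])
    show "G' (x, t) = 0" if "x \<notin> ?U \<or> t \<le> 0" for x t using G0[OF that] H0[OF that] by (simp add: G'_def zero_prod_def)
    show "\<exists>\<rho>>0. mollifiable ?M ?U p \<rho>" if "p \<in> closure ?U" for p
      by (rule domain_mollifiable[OF D Db \<open>C2_boundary D\<close> that])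
  qed (fact bnd1 bnd2 bnd3 grad_eq eqn)+
  have "AE x in state_measure. x \<in> ?U \<longrightarrow> (AE t in lborel. f' (x, t) = 0)"
    using E.solution_vanishes by (simp only: AE_domain_measure_iff[OF D])
  then have ae: "AE x in state_measure. AE t in lborel. f' (x, t) = 0"
    by eventually_elim (use f0 in auto)
  \<comment> \<open>Borel measurability makes the zero set of \<open>f'\<close> measurable in the
    product, which is what turns the iterated null-set statement into one on space-time.\<close>
  have "f' \<in> borel_measurable (state_measure \<Otimes>\<^sub>M lborel)"
    using f' unfolding measurable_cong_sets[OF sets_state_lborel refl] .
  then have "{z \<in> space (state_measure \<Otimes>\<^sub>M lborel). f' z = 0} \<in> sets (state_measure \<Otimes>\<^sub>M lborel)" by measurable
  from state_lborel.AE_pair_measure[OF this ae]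
  have "AE z in state_measure \<Otimes>\<^sub>M lborel. z \<in> ?U \<times> {0<..} \<longrightarrow> f z = 0"
    using fz by eventually_elim auto
  moreover have "?U \<times> {0<..} \<inter> space (completion (state_measure \<Otimes>\<^sub>M lborel)) \<in> sets (completion (state_measure \<Otimes>\<^sub>M (lborel :: real measure)))"
    by (rule sets.Int[OF sets_completionI_sets sets.top]) (simp only: sets_state_lborel cylinder_measurable[OF D])
  ultimately show ?thesis
    unfolding spacetime_measure_eq by (subst AE_restrict_space_iff) (simp_all add: AE_completion_iff)
qed

end
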